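(* The branching rules for the chain, with respect to $n$, of the algebras $H(m,1,n)$ are multiplicity-free: in the decomposition into irreducibles of the restriction to $H(m,1,n-1)$ of any irreducible representation of $H(m,1,n)$, each irreducible representation of $H(m,1,n-1)$ appears with multiplicity equal either to $0$ or to $1$.
   Context: Parameters. Let $m,n\ge 1$. Either $K=\mathbb{C}(q,v_1,\dots,v_m)$ with $q,v_1,\dots,v_m$ indeterminates, or $K=\mathbb{C}$ and $q,v_1,\dots,v_m\in\mathbb{C}$, $q\neq0$, satisfy: $1+q^2+\dots+q^{2N}\neq0$ for all non-negative integers $N<n$; $q^{2i}v_j-v_k\neq0$ for all $i,j,k$ with $j\neq k$ and $-n<i<n$; $v_j\neq0$ for all $j=1,\dots,m$. Cyclotomic Hecke algebra. $H(m,1,n)$ is the associative unital $K$-algebra generated by $\tau,\sigma_1,\dots,\sigma_{n-1}$ with defining relations $\sigma_i\sigma_{i+1}\sigma_i=\sigma_{i+1}\sigma_i\sigma_{i+1}$; $\sigma_i\sigma_j=\sigma_j\sigma_i$ if $|i-j|>1$; $\tau\sigma_1\tau\sigma_1=\sigma_1\tau\sigma_1\tau$; $\tau\sigma_i=\sigma_i\tau$ for $i>1$; $\sigma_i^2=(q-q^{-1})\sigma_i+1$; $(\tau-v_1)\cdots(\tau-v_m)=0$. $H(m,1,0)=K$; $H(m,1,n-1)$ is identified with the subalgebra of $H(m,1,n)$ generated by $\tau,\sigma_1,\dots,\sigma_{n-2}$. *)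

theory Defs
  imports Complex_Main
    "HOL-Library.Poly_Mapping" "HOL-Library.FuncSet" "HOL-Library.Option_ord"
    "HOL-Computational_Algebra.Fraction_Field" "HOL-Algebra.QuotRing"
begin

datatype 'g words = Word (letters: "'g list")

instantiation words :: (type) monoid_add
begin

definition zero_words :: "'g words" where
  "zero_words = Word []"

definition plus_words :: "'g words \<Rightarrow> 'g words \<Rightarrow> 'g words" where
  "plus_words a b = Word (letters a @ letters b)"

instance
  by intro_classes (simp_all add: zero_words_def plus_words_def)

end

text \<open>
  The convolution product on \<^typ>\<open>'g words \<Rightarrow>\<^sub>0 'k\<close> provided by \<^theory>\<open>HOL-Library.Poly_Mapping\<close>
  is the product of the monoid algebra, so this type is the free unital associative algebra
  on \<^typ>\<open>'g\<close>. The additive notation for concatenation is forced by that theory.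
\<close>

definition letter :: "'g \<Rightarrow> 'g words \<Rightarrow>\<^sub>0 'k::field" where
  "letter g = Poly_Mapping.single (Word [g]) 1"

definition const :: "'k \<Rightarrow> 'g words \<Rightarrow>\<^sub>0 'k::field" where
  "const c = Poly_Mapping.single 0 c"

definition free_algebra :: "'g set \<Rightarrow> ('g words \<Rightarrow>\<^sub>0 'k::field) ring" where
  "free_algebra G =
    \<lparr>carrier = {p. \<forall>w \<in> Poly_Mapping.keys p. set (letters w) \<subseteq> G},
     mult = (*), one = 1, zero = 0, add = (+)\<rparr>"

datatype gen = Tau | Sigma nat

type_synonym 'k free_elt = "gen words \<Rightarrow>\<^sub>0 'k"

text \<open>There are no generators for \<open>n = 0\<close>, so that the algebra is then the ground field.\<close>

definition hecke_gens :: "nat \<Rightarrow> gen set" where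
  "hecke_gens n = (if n = 0 then {} else insert Tau (Sigma ` {1..<n}))"

abbreviation \<tau> :: "'k::field free_elt" where "\<tau> \<equiv> letter Tau"
abbreviation \<sigma> :: "nat \<Rightarrow> 'k::field free_elt" where "\<sigma> i \<equiv> letter (Sigma i)"

text \<open>A relation \<open>a = b\<close> is represented by \<open>a - b\<close>. The number of parameters \<open>v\<^sub>j\<close> is \<open>CARD('m)\<close>.\<close>

definition hecke_rels ::
    "'k::field \<Rightarrow> ('m::{finite,linorder} \<Rightarrow> 'k) \<Rightarrow> nat \<Rightarrow> 'k free_elt set" where
  "hecke_rels q v n =
     {\<sigma> i * \<sigma> (i + 1) * \<sigma> i - \<sigma> (i + 1) * \<sigma> i * \<sigma> (i + 1) | i. 1 \<le> i \<and> i + 1 < n}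
   \<union> {\<sigma> i * \<sigma> j - \<sigma> j * \<sigma> i | i j.
        1 \<le> i \<and> i < n \<and> 1 \<le> j \<and> j < n \<and> \<bar>int i - int j\<bar> > 1}
   \<union> {\<tau> * \<sigma> 1 * \<tau> * \<sigma> 1 - \<sigma> 1 * \<tau> * \<sigma> 1 * \<tau> | i::nat. 1 < n}
   \<union> {\<tau> * \<sigma> i - \<sigma> i * \<tau> | i. 1 < i \<and> i < n}
   \<union> {\<sigma> i * \<sigma> i - (const (q - inverse q) * \<sigma> i + 1) | i. 1 \<le> i \<and> i < n}
   \<union> {prod_list (map (\<lambda>j. \<tau> - const (v j)) (sorted_list_of_set UNIV)) | i::nat. 1 \<le> n}"

definition hecke_ideal ::
    "'k::field \<Rightarrow> ('m::{finite,linorder} \<Rightarrow> 'k) \<Rightarrow> nat \<Rightarrow> 'k free_elt set" where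
  "hecke_ideal q v n = Idl\<^bsub>free_algebra (hecke_gens n)\<^esub> (hecke_rels q v n)"

definition hecke ::
    "'k::field \<Rightarrow> ('m::{finite,linorder} \<Rightarrow> 'k) \<Rightarrow> nat \<Rightarrow> 'k free_elt set ring" where
  "hecke q v n = free_algebra (hecke_gens n) Quot hecke_ideal q v n"

definition hecke_class ::
    "'k::field \<Rightarrow> ('m::{finite,linorder} \<Rightarrow> 'k) \<Rightarrow> nat \<Rightarrow> 'k free_elt \<Rightarrow> 'k free_elt set" where
  "hecke_class q v n x = hecke_ideal q v n +>\<^bsub>free_algebra (hecke_gens n)\<^esub> x"

text \<open>The structure map of \<^term>\<open>hecke q v n\<close> as a \<open>K\<close>-algebra.\<close>

definition hecke_scalar ::
    "'k::field \<Rightarrow> ('m::{finite,linorder} \<Rightarrow> 'k) \<Rightarrow> nat \<Rightarrow> 'k \<Rightarrow> 'k free_elt set" where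
  "hecke_scalar q v n c = hecke_class q v n (const c)"

text \<open>
  The canonical homomorphism from \<^term>\<open>hecke q v (n - 1)\<close> to \<^term>\<open>hecke q v n\<close>, sending the
  class of \<open>x\<close> to the class of \<open>x\<close> (see \<open>hecke_incl_class\<close> below). Its image is the subalgebra
  generated by the generators of \<^term>\<open>hecke q v (n - 1)\<close>.
\<close>

definition hecke_incl ::
    "'k::field \<Rightarrow> ('m::{finite,linorder} \<Rightarrow> 'k) \<Rightarrow> nat \<Rightarrow> 'k free_elt set \<Rightarrow> 'k free_elt set" where
  "hecke_incl q v n X = hecke_ideal q v n <+>\<^bsub>free_algebra (hecke_gens n)\<^esub> X"

text \<open>
  \<open>A\<close> is an algebra over \<^typ>\<open>'k\<close> with structure map \<open>\<eta>\<close>; \<open>scale\<close> is the scalar multiplication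
  on the representation space \<^typ>\<open>'v\<close>.
\<close>

definition representation ::
    "('a, 'b) ring_scheme \<Rightarrow> ('k::field \<Rightarrow> 'a) \<Rightarrow> ('k \<Rightarrow> 'v::ab_group_add \<Rightarrow> 'v) \<Rightarrow>
     ('a \<Rightarrow> 'v \<Rightarrow> 'v) \<Rightarrow> bool" where
  "representation A \<eta> scale \<rho> \<longleftrightarrow>
     vector_space scale
   \<and> (\<forall>a \<in> carrier A. Vector_Spaces.linear scale scale (\<rho> a))
   \<and> (\<forall>a \<in> carrier A. \<forall>b \<in> carrier A. \<rho> (a \<oplus>\<^bsub>A\<^esub> b) = (\<lambda>x. \<rho> a x + \<rho> b x))
   \<and> (\<forall>a \<in> carrier A. \<forall>b \<in> carrier A. \<rho> (a \<otimes>\<^bsub>A\<^esub> b) = \<rho> a \<circ> \<rho> b)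
   \<and> \<rho> \<one>\<^bsub>A\<^esub> = id
   \<and> (\<forall>c. \<rho> (\<eta> c) = scale c)"

definition subrepresentation ::
    "('a, 'b) ring_scheme \<Rightarrow> ('k::field \<Rightarrow> 'v::ab_group_add \<Rightarrow> 'v) \<Rightarrow>
     ('a \<Rightarrow> 'v \<Rightarrow> 'v) \<Rightarrow> 'v set \<Rightarrow> bool" where
  "subrepresentation A scale \<rho> W \<longleftrightarrow>
     module.subspace scale W \<and> (\<forall>a \<in> carrier A. \<rho> a ` W \<subseteq> W)"

definition irreducible_sub ::
    "('a, 'b) ring_scheme \<Rightarrow> ('k::field \<Rightarrow> 'v::ab_group_add \<Rightarrow> 'v) \<Rightarrow>
     ('a \<Rightarrow> 'v \<Rightarrow> 'v) \<Rightarrow> 'v set \<Rightarrow> bool" where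
  "irreducible_sub A scale \<rho> W \<longleftrightarrow>
     subrepresentation A scale \<rho> W \<and> W \<noteq> {0}
   \<and> (\<forall>U. subrepresentation A scale \<rho> U \<and> U \<subseteq> W \<longrightarrow> U = {0} \<or> U = W)"

definition irreducible_rep ::
    "('a, 'b) ring_scheme \<Rightarrow> ('k::field \<Rightarrow> 'a) \<Rightarrow> ('k \<Rightarrow> 'v::ab_group_add \<Rightarrow> 'v) \<Rightarrow>
     ('a \<Rightarrow> 'v \<Rightarrow> 'v) \<Rightarrow> bool" where
  "irreducible_rep A \<eta> scale \<rho> \<longleftrightarrow>
     representation A \<eta> scale \<rho> \<and> irreducible_sub A scale \<rho> UNIV"

text \<open>Isomorphism between the subrepresentation \<open>W\<close> of \<open>\<rho>\<close> and the representation \<open>\<pi>\<close>.\<close>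

definition iso_sub_rep ::
    "('a, 'b) ring_scheme \<Rightarrow>
     ('k::field \<Rightarrow> 'v::ab_group_add \<Rightarrow> 'v) \<Rightarrow> ('a \<Rightarrow> 'v \<Rightarrow> 'v) \<Rightarrow> 'v set \<Rightarrow>
     ('k \<Rightarrow> 'u::ab_group_add \<Rightarrow> 'u) \<Rightarrow> ('a \<Rightarrow> 'u \<Rightarrow> 'u) \<Rightarrow> bool" where
  "iso_sub_rep A scale \<rho> W scale' \<pi> \<longleftrightarrow>
     (\<exists>f. bij_betw f W UNIV
        \<and> (\<forall>x \<in> W. \<forall>y \<in> W. f (x + y) = f x + f y)
        \<and> (\<forall>c. \<forall>x \<in> W. f (scale c x) = scale' c (f x))
        \<and> (\<forall>a \<in> carrier A. \<forall>x \<in> W. f (\<rho> a x) = \<pi> a (f x)))"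

text \<open>
  \<open>\<W>\<close> is the set of summands of an internal direct sum decomposition of the whole space.
  Summands are non-zero, hence distinct as subspaces even when they are isomorphic.
\<close>

definition irreducible_decomposition ::
    "('a, 'b) ring_scheme \<Rightarrow> ('k::field \<Rightarrow> 'v::ab_group_add \<Rightarrow> 'v) \<Rightarrow>
     ('a \<Rightarrow> 'v \<Rightarrow> 'v) \<Rightarrow> 'v set set \<Rightarrow> bool" where
  "irreducible_decomposition A scale \<rho> \<W> \<longleftrightarrow>
     finite \<W>
   \<and> (\<forall>W \<in> \<W>. irreducible_sub A scale \<rho> W)
   \<and> (\<forall>x. \<exists>!f. f \<in> (\<Pi>\<^sub>E W \<in> \<W>. W) \<and> x = (\<Sum>W \<in> \<W>. f W))"

definition multiplicity_in ::
    "('a, 'b) ring_scheme \<Rightarrow>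
     ('k::field \<Rightarrow> 'v::ab_group_add \<Rightarrow> 'v) \<Rightarrow> ('a \<Rightarrow> 'v \<Rightarrow> 'v) \<Rightarrow> 'v set set \<Rightarrow>
     ('k \<Rightarrow> 'u::ab_group_add \<Rightarrow> 'u) \<Rightarrow> ('a \<Rightarrow> 'u \<Rightarrow> 'u) \<Rightarrow> nat" where
  "multiplicity_in A scale \<rho> \<W> scale' \<pi> = card {W \<in> \<W>. iso_sub_rep A scale \<rho> W scale' \<pi>}"

text \<open>
  The two type arguments are the carriers of the representations of the algebras for \<open>n\<close>
  and \<open>n - 1\<close>, respectively; they serve to quantify over representations on arbitrary
  vector spaces.
\<close>

definition multiplicity_free_branching ::
    "'v::ab_group_add itself \<Rightarrow> 'u::ab_group_add itself \<Rightarrow>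
     'k::field \<Rightarrow> ('m::{finite,linorder} \<Rightarrow> 'k) \<Rightarrow> nat \<Rightarrow> bool" where
  "multiplicity_free_branching (_ :: 'v itself) (_ :: 'u itself) q v n \<longleftrightarrow>
     (\<forall>(scale :: 'k \<Rightarrow> 'v \<Rightarrow> 'v) \<rho>.
        irreducible_rep (hecke q v n) (hecke_scalar q v n) scale \<rho> \<longrightarrow>
        (let B = hecke q v (n - 1); res = \<rho> \<circ> hecke_incl q v n in
           (\<exists>\<W>. irreducible_decomposition B scale res \<W>)
         \<and> (\<forall>\<W>. irreducible_decomposition B scale res \<W> \<longrightarrow>
              (\<forall>(scale' :: 'k \<Rightarrow> 'u \<Rightarrow> 'u) \<pi>.
                 irreducible_rep B (hecke_scalar q v (n - 1)) scale' \<pi> \<longrightarrow>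
                 multiplicity_in B scale res \<W> scale' \<pi> \<in> {0, 1}))))"

text \<open>
  The field of rational functions over the complex numbers in the indeterminates indexed by
  \<^typ>\<open>'m option\<close>: the index \<^const>\<open>None\<close> is that of \<open>q\<close>, and \<open>Some j\<close> that of \<open>v\<^sub>j\<close>.
  The linear order on indices only serves the type class instances of the library and fixes
  the order of the (commuting) factors in \<open>hecke_rels\<close>.
\<close>

type_synonym 'm ratfun = "(('m option \<Rightarrow>\<^sub>0 nat) \<Rightarrow>\<^sub>0 complex) fract"

definition indet :: "'m option \<Rightarrow> 'm::{finite,linorder} ratfun" where
  "indet i = Fract (Poly_Mapping.single (Poly_Mapping.single i 1) 1) 1"

definition q_indet :: "'m::{finite,linorder} ratfun" where
  "q_indet = indet None"

definition v_indet :: "'m::{finite,linorder} \<Rightarrow> 'm ratfun" where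
  "v_indet j = indet (Some j)"

definition admissible_params :: "complex \<Rightarrow> ('m \<Rightarrow> complex) \<Rightarrow> nat \<Rightarrow> bool" where
  "admissible_params q v n \<longleftrightarrow>
     q \<noteq> 0
   \<and> (\<forall>N < n. (\<Sum>k = 0..N. q ^ (2 * k)) \<noteq> 0)
   \<and> (\<forall>i j k. j \<noteq> k \<and> - int n < i \<and> i < int n \<longrightarrow> q powi (2 * i) * v j - v k \<noteq> 0)
   \<and> (\<forall>j. v j \<noteq> 0)"

lemma keys_letters_mult:
  assumes "\<forall>w \<in> Poly_Mapping.keys p. set (letters w) \<subseteq> G"
    and "\<forall>w \<in> Poly_Mapping.keys r. set (letters w) \<subseteq> G"
    and "w \<in> Poly_Mapping.keys (p * r)"
  shows "set (letters w) \<subseteq> G"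
proof -
  obtain a b where "a \<in> Poly_Mapping.keys p" "b \<in> Poly_Mapping.keys r" "w = a + b"
    using keys_mult[of p r] assms(3) by auto
  then show ?thesis using assms by (auto simp: plus_words_def)
qed

lemma ring_free_algebra: "ring (free_algebra G :: ('g words \<Rightarrow>\<^sub>0 'k::field) ring)"
proof (rule ringI)
  show "abelian_group (free_algebra G :: ('g words \<Rightarrow>\<^sub>0 'k) ring)"
  proof (rule abelian_groupI)
    fix x :: "'g words \<Rightarrow>\<^sub>0 'k" assume x: "x \<in> carrier (free_algebra G)"
    have "- x \<in> carrier (free_algebra G)"
      using x by (simp add: free_algebra_def)
    then show "\<exists>y \<in> carrier (free_algebra G). y \<oplus>\<^bsub>free_algebra G\<^esub> x = \<zero>\<^bsub>free_algebra G\<^esub>"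
      by (intro bexI[of _ "- x"]) (simp_all add: free_algebra_def)
  qed (use Poly_Mapping.keys_add in \<open>fastforce simp: free_algebra_def ac_simps\<close>)+
  show "monoid (free_algebra G :: ('g words \<Rightarrow>\<^sub>0 'k) ring)"
  proof (rule monoidI)
    show "\<one>\<^bsub>free_algebra G\<^esub> \<in> carrier (free_algebra G :: ('g words \<Rightarrow>\<^sub>0 'k) ring)"
      by (auto simp: free_algebra_def zero_words_def simp flip: single_one)
  qed (auto simp: free_algebra_def mult.assoc dest: keys_letters_mult)
qed (simp_all add: free_algebra_def distrib_left distrib_right)

lemma free_algebra_closed:
  "letter g \<in> carrier (free_algebra G) \<longleftrightarrow> g \<in> G"
  "const c \<in> carrier (free_algebra G)"
  "1 \<in> carrier (free_algebra G)"
  "x \<in> carrier (free_algebra G) \<Longrightarrow> y \<in> carrier (free_algebra G) \<Longrightarrow> x + y \<in> carrier (free_algebra G)"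
  "x \<in> carrier (free_algebra G) \<Longrightarrow> y \<in> carrier (free_algebra G) \<Longrightarrow> x - y \<in> carrier (free_algebra G)"
  "x \<in> carrier (free_algebra G) \<Longrightarrow> y \<in> carrier (free_algebra G) \<Longrightarrow> x * y \<in> carrier (free_algebra G)"
proof -
  interpret ring "free_algebra G" by (rule ring_free_algebra)
  show "letter g \<in> carrier (free_algebra G) \<longleftrightarrow> g \<in> G"
    by (simp add: free_algebra_def letter_def)
  show "const c \<in> carrier (free_algebra G)"
    by (simp add: free_algebra_def const_def zero_words_def)
  show "1 \<in> carrier (free_algebra G)"
    using one_closed by (simp add: free_algebra_def)
  show "x + y \<in> carrier (free_algebra G)"
    if "x \<in> carrier (free_algebra G)" "y \<in> carrier (free_algebra G)" for x y
    using add.m_closed[OF that] by (simp add: free_algebra_def)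
  show "x - y \<in> carrier (free_algebra G)"
    if "x \<in> carrier (free_algebra G)" "y \<in> carrier (free_algebra G)" for x y
    using that keys_diff[of x y] by (auto simp: free_algebra_def)
  show "x * y \<in> carrier (free_algebra G)"
    if "x \<in> carrier (free_algebra G)" "y \<in> carrier (free_algebra G)" for x y
    using m_closed[OF that] by (simp add: free_algebra_def)
qed

lemma hecke_rels_subset: "hecke_rels q v n \<subseteq> carrier (free_algebra (hecke_gens n))"
proof -
  have s: "\<sigma> i \<in> carrier (free_algebra (hecke_gens n))" if "1 \<le> i" "i < n" for i
    using that by (auto simp: free_algebra_closed hecke_gens_def)
  have t: "\<tau> \<in> carrier (free_algebra (hecke_gens n))" if "1 \<le> n"
    using that by (auto simp: free_algebra_closed hecke_gens_def)
  have p: "prod_list (map (\<lambda>j. \<tau> - const (v j)) xs) \<in> carrier (free_algebra (hecke_gens n))"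
    if "1 \<le> n" for xs
    by (induction xs) (auto intro!: free_algebra_closed(2-) t that)
  show ?thesis
    unfolding hecke_rels_def by (auto intro!: free_algebra_closed(2-) s t p[unfolded One_nat_def])
qed

lemma ideal_hecke: "ideal (hecke_ideal q v n) (free_algebra (hecke_gens n))"
  unfolding hecke_ideal_def
  by (rule ring.genideal_ideal[OF ring_free_algebra hecke_rels_subset])

lemma hecke_ideal_closed:
  "0 \<in> hecke_ideal q v n"
  "a \<in> hecke_ideal q v n \<Longrightarrow> b \<in> hecke_ideal q v n \<Longrightarrow> a + b \<in> hecke_ideal q v n"
proof -
  note add_sub = ideal.axioms(1)[OF ideal_hecke]
  show "0 \<in> hecke_ideal q v n"
    using additive_subgroup.zero_closed[OF add_sub] by (simp add: free_algebra_def)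
  show "a \<in> hecke_ideal q v n \<Longrightarrow> b \<in> hecke_ideal q v n \<Longrightarrow> a + b \<in> hecke_ideal q v n"
    using additive_subgroup.a_closed[OF add_sub] by (fastforce simp: free_algebra_def)
qed

lemma ring_hecke: "ring (hecke q v n)"
  unfolding hecke_def by (rule ideal.quotient_is_ring[OF ideal_hecke])

lemma hecke_class_hom:
  "hecke_class q v n \<in> ring_hom (free_algebra (hecke_gens n)) (hecke q v n)"
  unfolding hecke_def using ideal.rcos_ring_hom[OF ideal_hecke]
  by (simp add: hecke_class_def[abs_def])

lemma hecke_ideal_mono:
  fixes q :: "'k::field" and v :: "'m::{finite,linorder} \<Rightarrow> 'k"
  shows "hecke_ideal q v (n - 1) \<subseteq> hecke_ideal q v n"
proof -
  let ?F = "free_algebra (hecke_gens (n - 1)) :: 'k free_elt ring"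
  let ?F' = "free_algebra (hecke_gens n) :: 'k free_elt ring"
  interpret F: ring ?F by (rule ring_free_algebra)
  interpret I: ideal "hecke_ideal q v n" ?F' by (rule ideal_hecke)
  have sub: "carrier ?F \<subseteq> carrier ?F'"
    by (fastforce simp: free_algebra_def hecke_gens_def split: if_splits)
  have ops: "mult ?F = mult ?F'" "add ?F = add ?F'" "zero ?F = zero ?F'"
    by (simp_all add: free_algebra_def)
  have inv: "a_inv ?F x = - x" if "x \<in> carrier ?F" for x
    by (rule F.minus_equality) (use that in \<open>simp_all add: free_algebra_def\<close>)
  have inv': "a_inv ?F' x = - x" if "x \<in> carrier ?F'" for x
    by (rule abelian_group.minus_equality[OF ring.is_abelian_group[OF ring_free_algebra]])
      (use that in \<open>simp_all add: free_algebra_def\<close>)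
  have "ideal (hecke_ideal q v n \<inter> carrier ?F) ?F"
  proof (rule idealI[OF ring_free_algebra])
    show "subgroup (hecke_ideal q v n \<inter> carrier ?F) (add_monoid ?F)"
    proof (rule group.subgroupI)
      show "group (add_monoid ?F)" by (rule F.a_group)
      have "0 \<in> carrier ?F" by (simp add: free_algebra_def)
      then show "hecke_ideal q v n \<inter> carrier ?F \<noteq> {}"
        using hecke_ideal_closed(1) by blast
      fix a assume a: "a \<in> hecke_ideal q v n \<inter> carrier ?F"
      have "a_inv ?F' a \<in> hecke_ideal q v n" using a by simp
      then have "a_inv ?F a \<in> hecke_ideal q v n"
        using a inv inv' sub by auto
      then show "inv\<^bsub>add_monoid ?F\<^esub> a \<in> hecke_ideal q v n \<inter> carrier ?F"
        using a F.a_inv_closed by (simp add: a_inv_def)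
      fix b assume b: "b \<in> hecke_ideal q v n \<inter> carrier ?F"
      show "a \<otimes>\<^bsub>add_monoid ?F\<^esub> b \<in> hecke_ideal q v n \<inter> carrier ?F"
        using a b hecke_ideal_closed(2)[where q = q and v = v and n = n] F.a_closed[of a b]
        by (simp add: free_algebra_def)
    qed simp
  next
    fix a x assume a: "a \<in> hecke_ideal q v n \<inter> carrier ?F" and x: "x \<in> carrier ?F"
    have "x \<otimes>\<^bsub>?F'\<^esub> a \<in> hecke_ideal q v n" "a \<otimes>\<^bsub>?F'\<^esub> x \<in> hecke_ideal q v n"
      using a x sub I.I_l_closed[of a x] I.I_r_closed[of a x] by blast+
    then show "x \<otimes>\<^bsub>?F\<^esub> a \<in> hecke_ideal q v n \<inter> carrier ?F"
      and "a \<otimes>\<^bsub>?F\<^esub> x \<in> hecke_ideal q v n \<inter> carrier ?F"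
      using a x F.m_closed[of a x] F.m_closed[of x a] unfolding ops(1) by blast+
  qed
  moreover have "hecke_rels q v (n - 1) \<subseteq> hecke_rels q v n"
    unfolding hecke_rels_def by (intro Un_mono) force+
  then have "hecke_rels q v (n - 1) \<subseteq> hecke_ideal q v n"
    using ring.genideal_self[OF ring_free_algebra hecke_rels_subset[of q v n]]
    unfolding hecke_ideal_def by blast
  ultimately show ?thesis
    using F.genideal_minimal[of _ "hecke_rels q v (n - 1)"] hecke_rels_subset[of q v "n - 1"]
    by (metis Int_subset_iff hecke_ideal_def)
qed

lemma hecke_incl_class:
  assumes "x \<in> carrier (free_algebra (hecke_gens (n - 1)))"
  shows "hecke_incl q v n (hecke_class q v (n - 1) x) = hecke_class q v n x"
proof -
  have "a + b \<in> hecke_ideal q v n"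
    if "a \<in> hecke_ideal q v n" "b \<in> hecke_ideal q v (n - 1)" for a b
    using that hecke_ideal_mono[of q v n] hecke_ideal_closed(2) by blast
  moreover have "\<exists>a \<in> hecke_ideal q v n. \<exists>b \<in> hecke_ideal q v (n - 1). h = a + b"
    if "h \<in> hecke_ideal q v n" for h
    using that hecke_ideal_closed(1)[of q v "n - 1"] by (metis add.right_neutral)
  ultimately show ?thesis
    unfolding hecke_incl_def hecke_class_def
    by (auto simp: set_add_defs a_r_coset_defs free_algebra_def simp flip: add.assoc)
qed

lemma hecke_incl_hom:
  fixes q :: "'k::field" and v :: "'m::{finite,linorder} \<Rightarrow> 'k"
  shows "hecke_incl q v n \<in> ring_hom (hecke q v (n - 1)) (hecke q v n)"
proof -
  let ?F = "free_algebra (hecke_gens (n - 1)) :: 'k free_elt ring"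
  let ?F' = "free_algebra (hecke_gens n) :: 'k free_elt ring"
  interpret F: ring ?F by (rule ring_free_algebra)
  note h = ring_hom_memE[OF hecke_class_hom[of q v "n - 1"]]
    and h' = ring_hom_memE[OF hecke_class_hom[of q v n]]
  have sub: "carrier ?F \<subseteq> carrier ?F'"
    by (fastforce simp: free_algebra_def hecke_gens_def split: if_splits)
  have ops: "mult ?F = mult ?F'" "add ?F = add ?F'" "one ?F = one ?F'"
    by (simp_all add: free_algebra_def)
  have surj: "\<exists>x \<in> carrier ?F. X = hecke_class q v (n - 1) x"
    if "X \<in> carrier (hecke q v (n - 1))" for X
    using that by (auto simp: hecke_def FactRing_def A_RCOSETS_def' hecke_class_def)
  show ?thesis
  proof (rule ring_hom_memI)
    show "hecke_incl q v n \<one>\<^bsub>hecke q v (n - 1)\<^esub> = \<one>\<^bsub>hecke q v n\<^esub>"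
      using hecke_incl_class[OF F.one_closed, of q v] h(4) h'(4) ops by simp
  next
    fix X assume "X \<in> carrier (hecke q v (n - 1))"
    then obtain x where x: "x \<in> carrier ?F" "X = hecke_class q v (n - 1) x"
      using surj by blast
    show "hecke_incl q v n X \<in> carrier (hecke q v n)"
      using x h'(1) sub by (auto simp: hecke_incl_class simp del: One_nat_def)
    fix Y assume "Y \<in> carrier (hecke q v (n - 1))"
    then obtain y where y: "y \<in> carrier ?F" "Y = hecke_class q v (n - 1) y"
      using surj by blast
    show "hecke_incl q v n (X \<otimes>\<^bsub>hecke q v (n - 1)\<^esub> Y)
        = hecke_incl q v n X \<otimes>\<^bsub>hecke q v n\<^esub> hecke_incl q v n Y"
      using x y sub h'(2)[of x y] hecke_incl_class[OF F.m_closed[OF x(1) y(1)], of q v]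
      by (auto simp: hecke_incl_class h(2)[symmetric] ops simp del: One_nat_def)
    show "hecke_incl q v n (X \<oplus>\<^bsub>hecke q v (n - 1)\<^esub> Y)
        = hecke_incl q v n X \<oplus>\<^bsub>hecke q v n\<^esub> hecke_incl q v n Y"
      using x y sub h'(3)[of x y] hecke_incl_class[OF F.a_closed[OF x(1) y(1)], of q v]
      by (auto simp: hecke_incl_class h(3)[symmetric] ops simp del: One_nat_def)
  qed
qed

end

theory Submission
  imports Defs "HOL-Library.Multiset"
begin

text \<open>
  The Jucys--Murphy elements act diagonalisably on every module of \<open>H(m,1,n)\<close>, with joint weights
  given by the contents of standard \<open>m\<close>-tableaux. This is shown by induction on \<open>n\<close>: the
  intertwiner of two consecutive Jucys--Murphy elements restricts the eigenvalues of the last one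
  to the addable boxes and to the two neighbours of the box added before, and the braid relation
  excludes those neighbours that are not addable.
  Normalised generators exchange adjacent non-neighbouring labels and satisfy the braid relations,
  so that a weight vector spans, along all admissible paths, an irreducible submodule whose weight
  spaces are lines and whose weights are permutations of each other. If two different summands of
  the restriction of an irreducible module were isomorphic, they would contain linearly independent
  vectors of the same weight for \<open>H(m,1,n-1)\<close>; the label of the last box being determined by the
  others, these would have the same weight for \<open>H(m,1,n)\<close>, a contradiction.

  The parameters may satisfy \<open>q\<^sup>2 = 1\<close>. The algebra is then that of a wreath product, where the
  multiplicative Jucys--Murphy elements no longer separate the weights and are replaced by the
  additive ones together with the idempotents of \<open>\<tau>\<close> and of its conjugates.
\<close>

section \<open>Contents of standard tableaux\<close>

text \<open>The representation space is arbitrary, so eigenvectors cannot be drawn from finite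
  dimension or from a count of tableaux. Everything starts from the split relation for
  \<open>T\<close>; that an irreducible module is finite-dimensional only emerges at the end, its
  weights being rearrangements of one list. The neighbours of a box arise as roots: the square of
  the intertwiner of two consecutive Jucys--Murphy elements is, on an eigenspace of the first, a
  quadratic polynomial in the second whose roots are the two neighbouring contents. Equal
  consecutive labels are excluded because they would create a Jordan block. The conditions on the
  parameters are used to their limits: contents addable to a shape with fewer than \<open>n\<close>
  boxes differ by just so much that their eigenvalues are still distinct. Permutations appear as
  words, since each relation between transpositions has to be followed by the intertwiners; only the
  deletion of a square then costs a scalar. That a closed path of exchanges acts by a nonzero scalar
  is what makes cyclic submodules have one-dimensional weight spaces.\<close>

text \<open>
  The label \<open>(j, k)\<close> stands for the content \<open>v\<^sub>j q\<^sup>2\<^sup>k\<close>. A standard tableau is recorded by the list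
  of the contents of its boxes, and its shape by the Maya diagrams of its components: adding a
  box of content \<open>c\<close> moves the bead at \<open>c\<close> to the empty place \<open>up c\<close>.
\<close>

type_synonym 'm label = "'m \<times> int"

definition up :: "'m label \<Rightarrow> 'm label" where "up c = (fst c, snd c + 1)"
definition dn :: "'m label \<Rightarrow> 'm label" where "dn c = (fst c, snd c - 1)"

lemma up_dn [simp]: "up (dn c) = c" "dn (up c) = c"
  by (simp_all add: up_def dn_def)

lemma up_inj [simp]: "up c = up d \<longleftrightarrow> c = d"
  by (metis up_dn(2))

lemma up_neq [simp]: "up c \<noteq> c" "c \<noteq> up c" "dn c \<noteq> c" "c \<noteq> dn c"
  "up (up c) \<noteq> c" "c \<noteq> up (up c)" "dn c \<noteq> up c" "up c \<noteq> dn c"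
  by (auto simp: up_def dn_def prod_eq_iff)

lemma up_eq_iff: "up c = d \<longleftrightarrow> c = dn d"
  by (metis up_dn)

definition adj :: "'m label \<Rightarrow> 'm label \<Rightarrow> bool" where
  "adj c d \<longleftrightarrow> d = up c \<or> d = dn c"

lemma adj_sym: "adj c d \<longleftrightarrow> adj d c"
  by (auto simp: adj_def)

text \<open>The initial diagram has its beads at the places \<open>\<le> 0\<close>, so that the only
  move open to an empty component has content 0.\<close>

definition beads :: "'m label list \<Rightarrow> 'm label set" where
  "beads p = foldl (\<lambda>B c. insert (up c) (B - {c})) {c. snd c \<le> 0} p"

lemma beads_simps [simp]:
  "beads [] = {c. snd c \<le> 0}" "beads (p @ [c]) = insert (up c) (beads p - {c})"
  by (simp_all add: beads_def)

definition addable :: "'m label list \<Rightarrow> 'm label \<Rightarrow> bool" where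
  "addable p c \<longleftrightarrow> c \<in> beads p \<and> up c \<notin> beads p"

definition removable :: "'m label list \<Rightarrow> 'm label \<Rightarrow> bool" where
  "removable p c \<longleftrightarrow> c \<notin> beads p \<and> up c \<in> beads p"

inductive std :: "'m label list \<Rightarrow> bool" where
  std_Nil [simp, intro]: "std []"
| std_snoc: "std p \<Longrightarrow> addable p c \<Longrightarrow> std (p @ [c])"

lemma std_snoc_iff [simp]: "std (p @ [c]) \<longleftrightarrow> std p \<and> addable p c"
  by (auto intro: std_snoc elim: std.cases)

lemma std_append: "std (p @ r) \<Longrightarrow> std p"
  by (induction r rule: rev_induct) (simp_all flip: append_assoc)

lemma addable_Nil [simp]: "addable [] c \<longleftrightarrow> snd c = 0"
  by (auto simp: addable_def up_def)

lemma addable_not_adj: "addable p c \<Longrightarrow> addable p d \<Longrightarrow> \<not> adj c d"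
  by (auto simp: addable_def adj_def)

text \<open>The move at \<open>c\<close> alters only the places \<open>c\<close> and
  \<open>up c\<close>, so a newly addable box has a content next to \<open>c\<close>;
  \<open>c\<close> itself is blocked because its place is now empty.\<close>

lemma addable_snocD:
  assumes "addable p c" "addable (p @ [c]) d"
  shows "d \<noteq> c" "addable p d \<or> adj c d"
  using assms by (auto simp: addable_def adj_def up_eq_iff)

lemma addable_snocI:
  assumes "addable p c" "addable p d" "d \<noteq> c"
  shows "addable (p @ [c]) d"
  using assms by (auto simp: addable_def)

text \<open>Adding \<open>c\<close> fulfils one of the two conditions for a neighbour
  \<open>d\<close>: a bead at \<open>up c\<close> or a hole at \<open>c\<close>. If the other one
  fails, \<open>d\<close> was removable before, which is the situation treated by
  \<open>braid_exclusion\<close>.\<close>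

lemma not_addable_snoc_adj:
  assumes "addable p c" "adj c d" "\<not> addable (p @ [c]) d"
  shows "removable p d"
  using assms by (auto simp: addable_def adj_def removable_def)

text \<open>A move at a neighbour of \<open>d\<close> would empty \<open>up d\<close> or fill
  \<open>d\<close>; a move anywhere else except at \<open>d\<close> leaves both places
  alone.\<close>

lemma removable_snocD:
  assumes "addable p e" "removable (p @ [e]) d" "e \<noteq> d"
  shows "removable p d" "\<not> adj e d"
  using assms by (auto simp: addable_def adj_def removable_def up_eq_iff)

lemma not_removable_Nil: "\<not> removable [] d"
  by (auto simp: removable_def up_def)

lemma beads_swap:
  assumes "c \<noteq> d" "\<not> adj c d"
  shows "beads (p @ [c, d]) = beads (p @ [d, c])"
proof -
  have "beads ((p @ [c]) @ [d]) = beads ((p @ [d]) @ [c])"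
    using assms unfolding beads_simps by (auto simp: adj_def up_eq_iff)
  then show ?thesis by simp
qed

lemma beads_append: "beads p = beads p' \<Longrightarrow> beads (p @ r) = beads (p' @ r)"
  by (simp add: beads_def)

text \<open>Moves at distinct non-adjacent contents commute and give the same bead set, so the tail
  \<open>r\<close> is added to the same shape in both orders.\<close>

lemma std_swap:
  assumes "std (p @ [c, d] @ r)" "\<not> adj c d"
  shows "std (p @ [d, c] @ r)"
  using assms
proof (induction r rule: rev_induct)
  case Nil
  have "std ((p @ [c]) @ [d])" using Nil by simp
  then have "addable p c" "addable (p @ [c]) d" "std p" unfolding std_snoc_iff by blast+
  then have "std ((p @ [d]) @ [c])"
    unfolding std_snoc_iff using addable_snocD[of p c d] addable_snocI[of p d c] Nil by auto
  then show ?case by simp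
next
  case (snoc e r)
  have 1: "std (p @ [c, d] @ r)" "addable (p @ [c, d] @ r) e"
    using snoc.prems(1) std_snoc_iff[of "p @ [c, d] @ r" e] by simp_all
  have "std ((p @ [c]) @ [d])" using 1(1) std_append[of "p @ [c,d]" r] by simp
  then have "d \<noteq> c"
    unfolding std_snoc_iff using addable_snocD(1)[of p c d] by blast
  then have "beads (p @ [c, d] @ r) = beads (p @ [d, c] @ r)"
    using beads_append[OF beads_swap[of c d p], of r] snoc.prems(2) by simp
  then have "addable (p @ [d, c] @ r) e" using 1(2) by (simp add: addable_def)
  then have "std ((p @ [d, c] @ r) @ [e])"
    using snoc.IH[OF 1(1) snoc.prems(2)] std_snoc_iff by blast
  then show ?case by simp
qed

section \<open>Bounds on the contents of addable boxes\<close>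

definition content_count :: "'m \<Rightarrow> 'm label list \<Rightarrow> nat" where
  "content_count j p = length (filter (\<lambda>c. fst c = j) p)"

lemma content_count_simps [simp]:
  "content_count j [] = 0"
  "content_count j (p @ [c]) = content_count j p + (if fst c = j then 1 else 0)"
  by (simp_all add: content_count_def)

lemma content_count_le: "content_count j p \<le> length p"
  by (simp add: content_count_def)

lemma content_count_add_le: "j \<noteq> j' \<Longrightarrow> content_count j p + content_count j' p \<le> length p"
  by (induction p rule: rev_induct) auto

text \<open>A bead at \<open>b\<close> beyond a hole at \<open>h\<close> is a hook of length
  \<open>b - h\<close>, at most the number of boxes of component \<open>j\<close>. In the induction
  the new bead \<open>k + 1\<close> and the new hole \<open>k\<close> are measured against the old
  bead \<open>k\<close> and the old hole \<open>k + 1\<close>.\<close>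

lemma beads_bounds:
  assumes "std p"
  shows "(j, b) \<in> beads p \<Longrightarrow> b \<le> int (content_count j p)"
    and "(j, h) \<notin> beads p \<Longrightarrow> 1 - int (content_count j p) \<le> h"
    and "(j, b) \<in> beads p \<Longrightarrow> (j, h) \<notin> beads p \<Longrightarrow> b - h \<le> int (content_count j p)"
proof -
  have "((j, b) \<in> beads p \<longrightarrow> b \<le> int (content_count j p)) \<and>
    ((j, h) \<notin> beads p \<longrightarrow> 1 - int (content_count j p) \<le> h) \<and>
    ((j, b) \<in> beads p \<longrightarrow> (j, h) \<notin> beads p \<longrightarrow> b - h \<le> int (content_count j p))" for b h
    using assms
  proof (induction arbitrary: b h)
    case std_Nil
    then show ?case by auto
  next
    case (std_snoc p c)
    obtain i k where c: "c = (i, k)" by force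
    have k: "(i, k) \<in> beads p" "(i, k + 1) \<notin> beads p"
      using std_snoc.hyps by (auto simp: c addable_def up_def)
    show ?case
    proof (cases "i = j")
      case True
      show ?thesis
        using std_snoc.IH[of k "k + 1"] std_snoc.IH[of b "k + 1"] std_snoc.IH[of k h]
          std_snoc.IH[of b h] k
        by (auto simp: c up_def True split: if_splits)
    qed (use std_snoc.IH[of b h] in \<open>auto simp: c up_def\<close>)
  qed
  then show "(j, b) \<in> beads p \<Longrightarrow> b \<le> int (content_count j p)"
    and "(j, h) \<notin> beads p \<Longrightarrow> 1 - int (content_count j p) \<le> h"
    and "(j, b) \<in> beads p \<Longrightarrow> (j, h) \<notin> beads p \<Longrightarrow> b - h \<le> int (content_count j p)"
    by blast+
qed

text \<open>The hook is formed by the bead \<open>k\<close> and the hole \<open>l + 1\<close>,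
  whence the extra 1. For \<open>length p < n\<close> the bound is at most \<open>n\<close>, the
  last exponent for which \<open>q ^ (2 * i) \<noteq> 1\<close> is available.\<close>

lemma addable_same_bound:
  assumes "std p" "addable p (j, k)" "addable p (j, l)"
  shows "\<bar>k - l\<bar> \<le> int (length p) + 1"
  using beads_bounds(3)[OF assms(1), of j k "l + 1"] beads_bounds(3)[OF assms(1), of j l "k + 1"]
    content_count_le[of j p] assms(2,3)
  by (auto simp: addable_def up_def)

lemma addable_bound:
  assumes "std p" "addable p (j, k)"
  shows "\<bar>k\<bar> \<le> int (content_count j p)"
  using beads_bounds(1)[OF assms(1), of j k] beads_bounds(2)[OF assms(1), of j "k + 1"] assms(2)
  by (auto simp: addable_def up_def)

text \<open>Two components share the boxes of \<open>p\<close>, so there is no extra 1; for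
  \<open>length p < n\<close> the difference stays strictly inside the window
  \<open>- n < e < n\<close> of the parameters.\<close>

lemma addable_diff_bound:
  assumes "std p" "addable p (j, k)" "addable p (j', l)" "j \<noteq> j'"
  shows "\<bar>k - l\<bar> \<le> int (length p)"
  using addable_bound[OF assms(1,2)] addable_bound[OF assms(1,3)]
    content_count_add_le[OF assms(4), of p] by linarith

lemma finite_addable: "std p \<Longrightarrow> finite {c :: 'm::finite label. addable p c}"
proof -
  assume p: "std p"
  have "{c. addable p c} \<subseteq> UNIV \<times> {- int (length p)..int (length p)}"
  proof
    fix c assume "c \<in> {c. addable p c}"
    then show "c \<in> UNIV \<times> {- int (length p)..int (length p)}"
      using addable_bound[OF p, of "fst c" "snd c"] content_count_le[of "fst c" p]
      by (auto simp: mem_Times_iff)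
  qed
  then show ?thesis by (rule finite_subset) simp
qed

section \<open>Words in adjacent transpositions\<close>

definition swp :: "nat \<Rightarrow> 'a list \<Rightarrow> 'a list" where
  "swp i xs = xs[i := xs ! Suc i, Suc i := xs ! i]"

lemma length_swp [simp]: "length (swp i xs) = length xs"
  by (simp add: swp_def)

lemma nth_swp:
  "Suc i < length xs \<Longrightarrow> swp i xs ! k = (if k = i then xs ! Suc i else if k = Suc i then xs ! i else xs ! k)"
  by (auto simp: swp_def nth_list_update)

lemma swp_split: "swp (length p) (p @ [c, d] @ r) = p @ [d, c] @ r"
  by (simp add: swp_def list_update_append nth_append)

lemma split_at:
  assumes "Suc i < length xs"
  obtains p c d r where "xs = p @ [c, d] @ r" "length p = i" "c = xs ! i" "d = xs ! Suc i"
proof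
  show "xs = take i xs @ [xs ! i, xs ! Suc i] @ drop (Suc (Suc i)) xs"
    using assms by (simp add: Cons_nth_drop_Suc)
qed (use assms in auto)

lemma swp_swp [simp]: "Suc i < length xs \<Longrightarrow> swp i (swp i xs) = xs"
  by (rule nth_equalityI) (auto simp: nth_swp)

lemma swp_commute:
  "Suc i < length xs \<Longrightarrow> Suc j < length xs \<Longrightarrow> Suc i < j \<or> Suc j < i \<Longrightarrow>
    swp i (swp j xs) = swp j (swp i xs)"
  by (rule nth_equalityI) (auto simp: nth_swp)

lemma swp_braid:
  "Suc i < length xs \<Longrightarrow> Suc j < length xs \<Longrightarrow> j = Suc i \<or> i = Suc j \<Longrightarrow>
    swp i (swp j (swp i xs)) = swp j (swp i (swp j xs))"
  by (rule nth_equalityI) (auto simp: nth_swp)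

lemma mset_swp [simp]: "Suc i < length xs \<Longrightarrow> mset (swp i xs) = mset xs"
  unfolding swp_def by (rule mset_swap) auto

definition swps :: "nat list \<Rightarrow> 'a list \<Rightarrow> 'a list" where
  "swps w xs = foldl (\<lambda>xs i. swp i xs) xs w"

lemma swps_simps [simp]:
  "swps [] xs = xs" "swps (i # w) xs = swps w (swp i xs)" "swps (u @ w) xs = swps w (swps u xs)"
  by (simp_all add: swps_def)

lemma length_swps [simp]: "length (swps w xs) = length xs"
  by (induction w arbitrary: xs) simp_all

text \<open>Squares are only deleted, never inserted: an inserted pair of letters could exchange
  labels that must not be exchanged, against \<open>allowed_rew\<close>.\<close>

inductive rew :: "nat list \<Rightarrow> nat list \<Rightarrow> bool" where
  rew_square: "rew (u @ [i, i] @ w) (u @ w)"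
| rew_commute: "Suc i < j \<or> Suc j < i \<Longrightarrow> rew (u @ [i, j] @ w) (u @ [j, i] @ w)"
| rew_braid: "j = Suc i \<or> i = Suc j \<Longrightarrow> rew (u @ [i, j, i] @ w) (u @ [j, i, j] @ w)"

lemma rew_context: "rew w w' \<Longrightarrow> rew (u @ w @ r) (u @ w' @ r)"
proof (induction rule: rew.induct)
  case (rew_square u' i w)
  show ?case using rew.rew_square[of "u @ u'" i "w @ r"] by simp
next
  case (rew_commute i j u' w)
  then show ?case using rew.rew_commute[of i j "u @ u'" "w @ r"] by simp
next
  case (rew_braid j i u' w)
  then show ?case using rew.rew_braid[of j i "u @ u'" "w @ r"] by simp
qed

lemma rews_context: "rew\<^sup>*\<^sup>* w w' \<Longrightarrow> rew\<^sup>*\<^sup>* (u @ w @ r) (u @ w' @ r)"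
  by (induction rule: rtranclp_induct) (auto intro: rtranclp.rtrancl_into_rtrancl rew_context)

lemma rews_pass:
  "\<forall>x \<in> set z. Suc i < x \<or> Suc x < i \<Longrightarrow> rew\<^sup>*\<^sup>* (i # z) (z @ [i])"
proof (induction z)
  case (Cons x z)
  have "rew ([] @ [i, x] @ z) ([] @ [x, i] @ z)"
    using Cons.prems by (intro rew_commute) auto
  moreover have "rew\<^sup>*\<^sup>* ([x] @ (i # z) @ []) ([x] @ (z @ [i]) @ [])"
    using Cons by (intro rews_context) auto
  ultimately show ?case by (auto intro: converse_rtranclp_into_rtranclp)
qed simp

text \<open>The coset decomposition of \<open>S\<^sub>N\<^sub>+\<^sub>1\<close> modulo \<open>S\<^sub>N\<close>, on the level of words.\<close>

lemma rews_coset_form: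
  "set w \<subseteq> {..<N} \<Longrightarrow>
    \<exists>k w'. k \<le> N \<and> set w' \<subseteq> {..<N - 1} \<and> rew\<^sup>*\<^sup>* w ([k..<N] @ w')"
proof (induction w)
  case Nil
  show ?case by (intro exI[of _ N] exI[of _ "[]"]) simp
next
  case (Cons i w)
  then obtain k w' where k: "k \<le> N" "set w' \<subseteq> {..<N - 1}" "rew\<^sup>*\<^sup>* w ([k..<N] @ w')"
    by auto
  have i: "i < N" using Cons.prems by simp
  have start: "rew\<^sup>*\<^sup>* (i # w) (i # [k..<N] @ w')"
    using rews_context[OF k(3), of "[i]" "[]"] by simp
  consider "Suc i < k" | "Suc i = k" | "i = k" | "k < i" by linarith
  then show ?case
  proof cases
    case 1
    have "rew\<^sup>*\<^sup>* ([] @ (i # [k..<N]) @ w') ([] @ ([k..<N] @ [i]) @ w')"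
      by (intro rews_context rews_pass) (use 1 in auto)
    then have "rew\<^sup>*\<^sup>* (i # w) ([k..<N] @ i # w')" using start by simp
    then show ?thesis using k 1 by (intro exI[of _ k] exI[of _ "i # w'"]) auto
  next
    case 2
    then have "i # [k..<N] = [i..<N]" using i by (simp add: upt_conv_Cons)
    then show ?thesis using start k i
      by (intro exI[of _ i] exI[of _ w']) (metis append_Cons less_imp_le_nat)
  next
    case 3
    have "rew ([] @ [k, k] @ [Suc k..<N] @ w') ([] @ [Suc k..<N] @ w')"
      by (rule rew_square)
    then have "rew (i # [k..<N] @ w') ([Suc k..<N] @ w')"
      using 3 i by (simp add: upt_conv_Cons)
    then show ?thesis using start k i 3
      by (intro exI[of _ "Suc k"] exI[of _ w']) (auto intro: rtranclp.rtrancl_into_rtrancl)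
  next
    case 4
    \<comment> \<open>The letter \<open>i\<close> crosses the run as \<open>i - 1\<close>: it
      commutes up to \<open>j = i - 1\<close>, takes part in one braid relation, and the remaining
      \<open>j\<close> commutes to the right end.\<close>
    then obtain j where j: "i = Suc j" "k \<le> j" by (cases i) auto
    define A where "A = [k..<j]"
    define B where "B = [Suc (Suc j)..<N]"
    have split: "[k..<N] = A @ [j, Suc j] @ B"
    proof -
      have "[k..<N] = [k..<j] @ [j..<N]" using upt_add_eq_append[of k j "N - j"] j i by simp
      also have "[j..<N] = [j, Suc j] @ [Suc (Suc j)..<N]"
        using i j by (simp add: upt_conv_Cons)
      finally show ?thesis by (simp add: A_def B_def)
    qed
    have 1: "rew\<^sup>*\<^sup>* ([] @ (i # A) @ ([j, Suc j] @ B @ w')) ([] @ (A @ [i]) @ ([j, Suc j] @ B @ w'))"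
      by (intro rews_context rews_pass) (use j in \<open>auto simp: A_def\<close>)
    have 2: "rew (A @ [Suc j, j, Suc j] @ B @ w') (A @ [j, Suc j, j] @ B @ w')"
      by (rule rew_braid) simp
    have 3: "rew\<^sup>*\<^sup>* ((A @ [j, Suc j]) @ (j # B) @ w') ((A @ [j, Suc j]) @ (B @ [j]) @ w')"
      by (intro rews_context rews_pass) (auto simp: B_def)
    have "rew\<^sup>*\<^sup>* (i # [k..<N] @ w') (A @ [Suc j, j, Suc j] @ B @ w')"
      using 1 by (simp add: split j)
    also have "rew\<^sup>*\<^sup>* \<dots> ([k..<N] @ j # w')"
      using 2 3 by (auto simp: split intro: converse_rtranclp_into_rtranclp)
    finally have "rew\<^sup>*\<^sup>* (i # w) ([k..<N] @ j # w')" using start by simp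
    then show ?thesis using k i j by (intro exI[of _ k] exI[of _ "j # w'"]) auto
  qed
qed

lemma rew_set: "rew w w' \<Longrightarrow> set w' \<subseteq> set w"
  by (induction rule: rew.induct) auto

lemma rew_swps:
  assumes "rew w w'" "\<forall>i \<in> set w. Suc i < length xs"
  shows "swps w' xs = swps w xs"
  using assms
proof (induction rule: rew.induct)
  case (rew_commute i j u w)
  then show ?case by (simp add: swp_commute[of i _ j])
next
  case (rew_braid j i u w)
  then show ?case by (simp add: swp_braid[of i _ j])
qed simp_all

lemma rews_swps:
  assumes "rew\<^sup>*\<^sup>* w w'" "\<forall>i \<in> set w. Suc i < length xs"
  shows "swps w' xs = swps w xs"
  using assms
proof (induction rule: converse_rtranclp_induct)
  case (step w w2)
  then show ?case using rew_swps[of w w2 xs] rew_set[of w w2] by auto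
qed simp

lemma swps_upt_nth: "k \<le> N \<Longrightarrow> N < length xs \<Longrightarrow> swps [k..<N] xs ! N = xs ! k"
  by (induction N) (auto simp: le_Suc_eq nth_swp)

lemma swps_nth_above:
  "set w \<subseteq> {..<N} \<Longrightarrow> N < length xs \<Longrightarrow> N < k \<Longrightarrow> swps w xs ! k = xs ! k"
  by (induction w arbitrary: xs) (auto simp: nth_swp)

text \<open>The Coxeter relations suffice: by \<open>rews_coset_form\<close> the word becomes a run
  \<open>[k..<Suc N]\<close> followed by letters below \<open>N\<close>. The run brings the entry
  \<open>k\<close> to the place \<open>Suc N\<close>, which the other letters do not touch, so
  distinctness forces the run to be empty.\<close>

lemma rews_Nil:
  "set w \<subseteq> {..<N} \<Longrightarrow> N < length xs \<Longrightarrow> distinct xs \<Longrightarrow> swps w xs = xs \<Longrightarrow> rew\<^sup>*\<^sup>* w []"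
proof (induction N arbitrary: w)
  case (Suc N)
  obtain k w' where k: "k \<le> Suc N" "set w' \<subseteq> {..<N}" "rew\<^sup>*\<^sup>* w ([k..<Suc N] @ w')"
    using rews_coset_form[OF Suc.prems(1)] by auto
  have valid: "\<forall>i \<in> set w. Suc i < length xs"
    using Suc.prems(1,2) by auto
  have eq: "swps w' (swps [k..<Suc N] xs) = xs"
    using rews_swps[OF k(3) valid] Suc.prems(4) by simp
  have "xs ! Suc N = swps [k..<Suc N] xs ! Suc N"
    using swps_nth_above[OF k(2), of "swps [k..<Suc N] xs" "Suc N"] Suc.prems(2) unfolding eq by simp
  also have "\<dots> = xs ! k"
    by (rule swps_upt_nth) (use k Suc.prems in auto)
  finally have "k = Suc N"
    using Suc.prems(2,3) k(1) by (simp add: nth_eq_iff_index_eq)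
  then have "rew\<^sup>*\<^sup>* w w'" "swps w' xs = xs" using k(3) eq by auto
  moreover have "rew\<^sup>*\<^sup>* w' []"
    using Suc.IH[OF k(2)] Suc.prems(2,3) \<open>swps w' xs = xs\<close> by simp
  ultimately show ?case by simp
qed simp

section \<open>Paths that exchange only permitted pairs\<close>

fun allowed :: "('a \<Rightarrow> 'a \<Rightarrow> bool) \<Rightarrow> nat list \<Rightarrow> 'a list \<Rightarrow> bool" where
  "allowed R [] xs \<longleftrightarrow> True"
| "allowed R (i # w) xs \<longleftrightarrow>
    Suc i < length xs \<and> R (xs ! i) (xs ! Suc i) \<and> allowed R w (swp i xs)"

lemma allowed_append: "allowed R (u @ w) xs \<longleftrightarrow> allowed R u xs \<and> allowed R w (swps u xs)"
  by (induction u arbitrary: xs) auto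

lemma allowed_set: "allowed R w xs \<Longrightarrow> \<forall>i \<in> set w. Suc i < length xs"
  by (induction w arbitrary: xs) fastforce+

text \<open>Both sides of a braid or commutation relation exchange the same pairs of entries, each
  in the same orientation.\<close>

lemma allowed_rew:
  assumes "rew w w'" "allowed R w xs"
  shows "allowed R w' xs"
  using assms
proof (induction rule: rew.induct)
  case (rew_square u i w)
  then show ?case by (auto simp: allowed_append)
next
  case (rew_commute i j u w)
  have "swp i (swp j (swps u xs)) = swp j (swp i (swps u xs))"
    if "Suc i < length xs" "Suc j < length xs"
    using that rew_commute(1) by (intro swp_commute) auto
  then show ?case using rew_commute by (auto simp: allowed_append nth_swp)
next
  case (rew_braid j i u w)
  have "swp i (swp j (swp i (swps u xs))) = swp j (swp i (swp j (swps u xs)))"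
    if "Suc i < length xs" "Suc j < length xs"
    using that rew_braid(1) by (intro swp_braid) auto
  then show ?case using rew_braid by (auto simp: allowed_append nth_swp)
qed

lemma allowed_rev:
  assumes "allowed R w xs" "\<And>c d. R c d \<Longrightarrow> R d c"
  shows "allowed R (rev w) (swps w xs) \<and> swps (rev w) (swps w xs) = xs"
  using assms(1) by (induction w arbitrary: xs) (auto simp: allowed_append nth_swp assms(2))

lemma mset_swps: "allowed R w xs \<Longrightarrow> mset (swps w xs) = mset xs"
  by (induction w arbitrary: xs) auto

text \<open>Meant for labels paired with positions: the sequence of labels together with the order
  of the positions under each label determines the list.\<close>

lemma list_eq_filter:
  "map fst xs = map fst ys \<Longrightarrow>
    (\<And>c. filter (\<lambda>x. fst x = c) xs = filter (\<lambda>x. fst x = c) ys) \<Longrightarrow> xs = ys"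
proof (induction xs arbitrary: ys)
  case (Cons x xs)
  obtain y ys' where y: "ys = y # ys'" using Cons.prems(1) by (cases ys) auto
  have fy: "fst y = fst x" using Cons.prems(1) y by simp
  have "y = x" using Cons.prems(2)[of "fst x"] y fy by simp
  moreover have "filter (\<lambda>x. fst x = c) xs = filter (\<lambda>x. fst x = c) ys'" for c
    using Cons.prems(2)[of c] y \<open>y = x\<close> by (simp split: if_splits)
  then have "xs = ys'" using Cons.IH[of ys'] Cons.prems(1) y by simp
  ultimately show ?case using y by simp
qed simp

lemma map_swp: "Suc i < length xs \<Longrightarrow> map f (swp i xs) = swp i (map f xs)"
  by (simp add: swp_def map_update)

lemma map_swps: "\<forall>i \<in> set w. Suc i < length xs \<Longrightarrow> map f (swps w xs) = swps w (map f xs)"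
  by (induction w arbitrary: xs) (auto simp: map_swp)

lemma filter_swp:
  assumes "Suc i < length xs" "\<not> (P (xs ! i) \<and> P (xs ! Suc i))"
  shows "filter P (swp i xs) = filter P xs"
  using assms(1)
proof (rule split_at)
  fix p c d r assume *: "xs = p @ [c, d] @ r" "length p = i" "c = xs ! i" "d = xs ! Suc i"
  have "swp i xs = p @ [d, c] @ r" using * swp_split[of p c d r] by metis
  then have "filter P (swp i xs) = filter P (p @ [d, c] @ r)" by simp
  also have "\<not> (P c \<and> P d)" using assms(2) *(3,4) by blast
  then have "filter P (p @ [d, c] @ r) = filter P (p @ [c, d] @ r)" by auto
  finally show ?thesis unfolding *(1)[symmetric] .
qed

text \<open>By irreflexivity of \<open>R\<close>, entries with equal labels are never exchanged and
  keep their order among themselves.\<close>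

lemma filter_swps:
  assumes "allowed R w (map fst xs)" "\<And>c. \<not> R c c"
  shows "filter (\<lambda>x. fst x = c) (swps w xs) = filter (\<lambda>x. fst x = c) xs"
  using assms(1)
proof (induction w arbitrary: xs)
  case (Cons i w)
  have i: "Suc i < length xs" "R (fst (xs ! i)) (fst (xs ! Suc i))"
    using Cons.prems by auto
  have "filter (\<lambda>x. fst x = c) (swps w (swp i xs)) = filter (\<lambda>x. fst x = c) (swp i xs)"
    using Cons.prems by (intro Cons.IH) (simp add: map_swp)
  also have "\<dots> = filter (\<lambda>x. fst x = c) xs"
    using i assms(2) by (intro filter_swp) auto
  finally show ?case by simp
qed simp

text \<open>Labels are never exchanged with equal ones, so that a closed path induces the
  identity permutation of the positions.\<close>

lemma closed_path_rews_Nil: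
  assumes "allowed R w xs" "\<And>c. \<not> R c c" "swps w xs = xs"
  shows "rew\<^sup>*\<^sup>* w []"
proof (cases "xs = []")
  case False
  \<comment> \<open>Tagging the labels with their positions makes the entries distinct, as
    \<open>rews_Nil\<close> requires.\<close>
  define ys where "ys = zip xs [0..<length xs]"
  have fst: "map fst ys = xs" by (simp add: ys_def)
  have len: "length ys = length xs" by (simp add: ys_def)
  note valid = allowed_set[OF assms(1)]
  have "swps w ys = ys"
  proof (rule list_eq_filter)
    show "map fst (swps w ys) = map fst ys"
      using map_swps[of w ys fst] valid assms(3) by (simp add: fst len)
    show "filter (\<lambda>x. fst x = c) (swps w ys) = filter (\<lambda>x. fst x = c) ys" for c
      using assms(1,2) by (intro filter_swps[where R = R]) (simp_all add: fst)
  qed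
  moreover have "distinct ys" by (simp add: ys_def distinct_zipI2)
  ultimately show ?thesis
    using valid False by (intro rews_Nil[of w "length xs - 1" ys]) (force simp: len)+
next
  case True
  then show ?thesis using allowed_set[OF assms(1)] by (cases w) auto
qed

section \<open>Eigenvectors of commuting operators\<close>

text \<open>Declarations made in \<^locale>\<open>vector_space\<close> itself would be shadowed by those of its
  interpretation for real vector spaces.\<close>

locale vspace = vector_space scale
  for scale :: "'a::field \<Rightarrow> 'b::ab_group_add \<Rightarrow> 'b" (infixr "*s" 75)
begin

abbreviation lin :: "('b \<Rightarrow> 'b) \<Rightarrow> bool" where
  "lin \<equiv> Vector_Spaces.linear scale scale"

lemma lin_iff: "lin f \<longleftrightarrow> (\<forall>x y. f (x + y) = f x + f y) \<and> (\<forall>c x. f (c *s x) = c *s f x)"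
  using vector_space_axioms by (auto simp: Vector_Spaces.linear_iff)

lemma lin_add: "lin f \<Longrightarrow> f (x + y) = f x + f y"
  by (simp add: lin_iff)

lemma lin_scale: "lin f \<Longrightarrow> f (c *s x) = c *s f x"
  by (simp_all add: lin_iff)

lemma lin_zero: "lin f \<Longrightarrow> f 0 = 0"
  by (metis lin_scale scale_zero_left)

lemma lin_minus: "lin f \<Longrightarrow> f (- x) = - f x"
  using lin_scale[of f "- 1" x] by simp

lemma lin_diff: "lin f \<Longrightarrow> f (x - y) = f x - f y"
  by (metis lin_add lin_minus uminus_add_conv_diff add.commute)

lemma lin_sum: "lin f \<Longrightarrow> f (sum g A) = (\<Sum>a\<in>A. f (g a))"
  by (induction A rule: infinite_finite_induct) (simp_all add: lin_add lin_zero)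

lemmas lin_simps = lin_add lin_scale lin_zero lin_minus lin_diff lin_sum

lemma lin_id: "lin (\<lambda>x. x)"
  and lin_const_zero: "lin (\<lambda>x. 0)"
  and lin_plus: "lin f \<Longrightarrow> lin g \<Longrightarrow> lin (\<lambda>x. f x + g x)"
  and lin_subtract: "lin f \<Longrightarrow> lin g \<Longrightarrow> lin (\<lambda>x. f x - g x)"
  and lin_smult: "lin f \<Longrightarrow> lin (\<lambda>x. c *s f x)"
  and lin_comp: "lin f \<Longrightarrow> lin g \<Longrightarrow> lin (\<lambda>x. f (g x))"
  by (simp_all add: lin_iff scale_right_distrib scale_right_diff_distrib scale_left_commute)

lemma lin_sums: "(\<And>a. lin (f a)) \<Longrightarrow> lin (\<lambda>x. \<Sum>a\<in>A. f a x)"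
  by (simp add: lin_iff sum.distrib scale_sum_right)

lemma subspace_eigen: "lin f \<Longrightarrow> subspace {x. f x = c *s x}"
  by (simp add: subspace_def lin_simps scale_right_distrib scale_left_commute)

lemma subspace_Collect_conj: "subspace {x. P x} \<Longrightarrow> subspace {x. Q x} \<Longrightarrow> subspace {x. P x \<and> Q x}"
  by (simp add: subspace_def)

lemma subspace_Collect_all: "(\<And>i. subspace {x. P i x}) \<Longrightarrow> subspace {x. \<forall>i. P i x}"
  by (simp add: subspace_def)

lemma subspace_Collect_imp: "(P \<Longrightarrow> subspace {x. Q x}) \<Longrightarrow> subspace {x. P \<longrightarrow> Q x}"
  by (simp add: subspace_def)

lemma span_UN_sumE:
  assumes "x \<in> span (\<Union>a\<in>A. Z a)" "\<And>a. a \<in> A \<Longrightarrow> subspace (Z a)"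
  obtains D f where "finite D" "D \<subseteq> A" "\<And>a. a \<in> D \<Longrightarrow> f a \<in> Z a" "x = (\<Sum>a\<in>D. f a)"
proof -
  have "\<exists>D f. finite D \<and> D \<subseteq> A \<and> (\<forall>a. a \<in> D \<longrightarrow> f a \<in> Z a) \<and> (\<forall>a. a \<notin> D \<longrightarrow> f a = 0) \<and> x = (\<Sum>a\<in>D. f a)"
    using assms(1)
  proof (induction rule: span_induct_alt)
    case base
    show ?case by (intro exI[of _ "{}"] exI[of _ "\<lambda>_. 0"]) simp
  next
    case (step c x y)
    then obtain a D f where a: "a \<in> A" "x \<in> Z a" and
      D: "finite D" "D \<subseteq> A" "\<forall>a. a \<in> D \<longrightarrow> f a \<in> Z a" "\<forall>a. a \<notin> D \<longrightarrow> f a = 0" "y = (\<Sum>a\<in>D. f a)"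
      by auto
    define g where "g b = (if b = a then c *s x else 0) + f b" for b
    have "f b \<in> Z b" if "b \<in> A" for b
      using D(3,4) subspace_0[OF assms(2)[OF that]] by metis
    then have "g b \<in> Z b" if "b \<in> insert a D" for b
      using a D(2) that assms(2)[of b]
      by (auto simp: g_def intro!: subspace_add subspace_scale subspace_0)
    moreover have "sum f (insert a D) = sum f D"
      using D(1,4) by (cases "a \<in> D") (simp_all add: insert_absorb)
    then have "c *s x + y = sum g (insert a D)"
      using D(1,5) by (simp add: g_def sum.distrib sum.delta)
    moreover have "g b = 0" if "b \<notin> insert a D" for b
      using that D(4) by (simp add: g_def)
    ultimately show ?case
      using D(1,2) a(1) by (intro exI[of _ "insert a D"] exI[of _ g]) auto
  qed
  then show ?thesis using that by blast
qed

text \<open>If \<open>i\<close> separates \<open>a\<close> from \<open>b\<close>, then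
  \<open>h i - m i b\<close> kills the component at \<open>b\<close> and scales the one at
  \<open>a\<close> by a nonzero factor, so that the induction on \<open>D\<close> applies to the
  images. For \<open>U = {0}\<close> this is the independence of joint eigenvectors.\<close>

lemma joint_eigenvectors:
  assumes "finite D" "subspace U"
    and "\<And>i. i \<in> I \<Longrightarrow> lin (h i)"
    and "\<And>i x. i \<in> I \<Longrightarrow> x \<in> U \<Longrightarrow> h i x \<in> U"
    and "\<And>i a. i \<in> I \<Longrightarrow> a \<in> D \<Longrightarrow> h i (f a) = m i a *s f a"
    and "\<And>a b. a \<in> D \<Longrightarrow> b \<in> D \<Longrightarrow> a \<noteq> b \<Longrightarrow> \<exists>i\<in>I. m i a \<noteq> m i b"
    and "(\<Sum>a\<in>D. f a) \<in> U" "a \<in> D"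
  shows "f a \<in> U"
  using assms(1,5-)
proof (induction D arbitrary: f a rule: finite_induct)
  case (insert b D)
  have *: "f a \<in> U" if a: "a \<in> D" for a
  proof -
    obtain i where i: "i \<in> I" "m i a \<noteq> m i b"
      using insert.prems(2)[of a b] insert.hyps(2) a by auto
    define g where "g a = (m i a - m i b) *s f a" for a
    have "h i (sum f (insert b D)) - m i b *s sum f (insert b D) = (\<Sum>a\<in>insert b D. g a)"
      unfolding lin_sum[OF assms(3)[OF i(1)]] scale_sum_right sum_subtractf[symmetric] g_def
      by (intro sum.cong refl) (simp add: insert.prems(1) i(1) scale_left_diff_distrib)
    also have "\<dots> = sum g D" using insert.hyps by (simp add: g_def)
    finally have "sum g D \<in> U"
      using assms(2) assms(4)[of i] i(1) insert.prems(3)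
      by (metis subspace_diff subspace_scale)
    moreover have "h l (g a) = m l a *s g a" if "l \<in> I" "a \<in> D" for l a
      using that insert.prems(1)[of l a] assms(3)[of l]
        by (simp add: g_def lin_scale scale_left_commute)
    ultimately have "g a \<in> U"
      using insert.IH[where f = g and a = a] insert.prems(2) a by blast
    then have "inverse (m i a - m i b) *s g a \<in> U" by (rule subspace_scale[OF assms(2)])
    then show ?thesis using i(2) by (simp add: g_def)
  qed
  have "f b = sum f (insert b D) - sum f D" using insert.hyps by simp
  then have "f b \<in> U"
    using insert.prems(3) subspace_diff[OF assms(2)] subspace_sum[OF assms(2), of D f] * by metis
  then show ?case using * insert.prems(4) by auto
qed simp

lemma span_UN_mem: "a \<in> A \<Longrightarrow> x \<in> Z a \<Longrightarrow> x \<in> span (\<Union>a\<in>A. Z a)"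
  by (rule span_base) auto

text \<open>\<open>y\<close> and \<open>y'\<close> are two consecutive Jucys--Murphy elements, exchanged by the intertwiner
  \<open>u\<close> built from the generator \<open>s\<close>.\<close>

lemma rank_two:
  assumes lin: "lin y" "lin y'" "lin u"
    and X: "subspace X" "\<And>x. x \<in> X \<Longrightarrow> y x \<in> X" "\<And>x. x \<in> X \<Longrightarrow> y' x \<in> X"
      "\<And>x. x \<in> X \<Longrightarrow> u x \<in> X" "\<And>x. x \<in> X \<Longrightarrow> s x \<in> X"
    and comm: "\<And>x. x \<in> X \<Longrightarrow> y (y' x) = y' (y x)"
      "\<And>x. x \<in> X \<Longrightarrow> y' (u x) = u (y x)" "\<And>x. x \<in> X \<Longrightarrow> y (u x) = u (y' x)"
    and square: "\<And>x. x \<in> X \<Longrightarrow> y x = \<alpha> *s x \<Longrightarrow>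
      u (u x) = c *s (y' (y' x) - (a + b) *s y' x + (a * b) *s x)"
    and scalars: "c \<noteq> 0" "a \<noteq> b" "finite D" "\<And>d. d \<in> D - {\<alpha>} \<Longrightarrow> d \<noteq> a \<and> d \<noteq> b"
    and jordan: "\<omega> \<noteq> 0" "\<And>x. x \<in> X \<Longrightarrow> y x = \<alpha> *s x \<Longrightarrow> y' x = \<alpha> *s x \<Longrightarrow>
      y (s x) = \<alpha> *s s x - \<omega> *s x"
    and diag: "X \<subseteq> span (\<Union>d\<in>D. {x \<in> X. y x = d *s x})"
    and v: "v \<in> X" "y v = \<alpha> *s v"
  shows "v \<in> span (\<Union>d\<in>(D - {\<alpha>}) \<union> {a, b}. {x \<in> X. y x = \<alpha> *s x \<and> y' x = d *s x})"
    (is "_ \<in> span (\<Union>d\<in>_. ?Z d)")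
proof -
  let ?E = "\<Union>d\<in>D. {x \<in> X. y x = d *s x}"
  let ?G = "\<Union>d\<in>(D - {\<alpha>}) \<union> {a, b}. ?Z d"
  have eig: "subspace {x \<in> X. y x = d *s x}" for d
    using subspace_Collect_conj[of "\<lambda>x. x \<in> X"] X(1) subspace_eigen[OF lin(1)] by simp
  \<comment> \<open>By \<open>jordan\<close>, \<open>s x\<close> would complete a Jordan block of
    \<open>y\<close>, while \<open>X\<close> is spanned by eigenvectors of \<open>y\<close>. The
    family \<open>f\<close> below collects the eigencomponents of
    \<open>y (s x) - \<alpha> *s s x + \<omega> *s x = 0\<close>.\<close>
  have excl: "x = 0" if x: "x \<in> X" "y x = \<alpha> *s x" "y' x = \<alpha> *s x" for x
  proof -
    have "s x \<in> span ?E" using X(5) x(1) diag by blast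
    then obtain D' w where D': "finite D'" "D' \<subseteq> D" "s x = (\<Sum>d\<in>D'. w d)"
      and w: "\<And>d. d \<in> D' \<Longrightarrow> w d \<in> {x \<in> X. y x = d *s x}"
      by (rule span_UN_sumE[OF _ eig]) blast
    define f where "f d = (if d \<in> D' then (d - \<alpha>) *s w d else 0) + (if d = \<alpha> then \<omega> *s x else 0)" for d
    have "(\<Sum>d\<in>insert \<alpha> D'. f d) = (\<Sum>d\<in>D'. (d - \<alpha>) *s w d) + \<omega> *s x"
    proof -
      have "(\<Sum>d\<in>insert \<alpha> D'. if d \<in> D' then (d - \<alpha>) *s w d else 0) = (\<Sum>d\<in>D'. (d - \<alpha>) *s w d)"
        by (rule sum.mono_neutral_cong_right) (use D'(1) in auto)
      then show ?thesis using D'(1) by (simp add: f_def sum.distrib)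
    qed
    also have "(\<Sum>d\<in>D'. (d - \<alpha>) *s w d) = y (s x) - \<alpha> *s s x"
      unfolding D'(3) lin_sum[OF lin(1)] scale_sum_right sum_subtractf[symmetric]
      by (intro sum.cong refl) (use w in \<open>simp add: scale_left_diff_distrib\<close>)
    finally have sum0: "(\<Sum>d\<in>insert \<alpha> D'. f d) = 0"
      using jordan(2)[OF x] by simp
    have f_eig: "y (f d) = d *s f d" for d
      using w[of d] x(2) unfolding f_def
      by (cases "d = \<alpha>"; cases "d \<in> D'")
        (simp_all add: lin_simps[OF lin(1)] scale_right_distrib scale_left_commute[of \<omega>]
          scale_left_commute[of "d - \<alpha>"])
    have "f \<alpha> \<in> {0}"
    proof (rule joint_eigenvectors[where D = "insert \<alpha> D'" and I = "{()}" and h = "\<lambda>_. y"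
          and m = "\<lambda>_ d. d" and f = f])
      show "sum f (insert \<alpha> D') \<in> {0}" using sum0 by simp
    qed (use D'(1) lin f_eig in \<open>auto simp: lin_zero[OF lin(1)]\<close>)
    then show ?thesis using jordan(1) by (simp add: f_def split: if_splits)
  qed
  \<comment> \<open>This is \<open>(y' - a) (y' - b)\<close>, to which \<open>square\<close> reduces
    \<open>u \<circ> u\<close> on the \<open>\<alpha>\<close>-eigenvectors of
    \<open>y\<close>.\<close>
  define L where "L x = y' (y' x) - (a + b) *s y' x + (a * b) *s x" for x
  have linL: "lin L"
    unfolding L_def by (intro lin_plus lin_subtract lin_smult lin_comp[OF lin(2)] lin lin_id)
  have "u v \<in> span ?E" using X(4) v(1) diag by blast
  then obtain D' w where D'': "finite D'" "D' \<subseteq> D" "u v = (\<Sum>d\<in>D'. w d)"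
    "\<And>d. d \<in> D' \<Longrightarrow> w d \<in> {x \<in> X. y x = d *s x}"
    by (rule span_UN_sumE[OF _ eig]) blast
  have D': "finite D'" "D' \<subseteq> D" "\<And>d. d \<in> D' \<Longrightarrow> w d \<in> X"
    "\<And>d. d \<in> D' \<Longrightarrow> y (w d) = d *s w d" "u v = (\<Sum>d\<in>D'. w d)"
    using D'' by auto
  have w: "w d \<in> {x \<in> X. y' x = \<alpha> *s x}" if d: "d \<in> D'" for d
  proof (rule joint_eigenvectors[where D = D' and I = "{()}" and h = "\<lambda>_. y" and m = "\<lambda>_ d. d" and f = w])
    show "subspace {x \<in> X. y' x = \<alpha> *s x}"
      using subspace_Collect_conj[of "\<lambda>x. x \<in> X"] X(1) subspace_eigen[OF lin(2)] by simp
    show "y x \<in> {x \<in> X. y' x = \<alpha> *s x}" if "x \<in> {x \<in> X. y' x = \<alpha> *s x}" for x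
      using that X(2) comm(1)[of x, symmetric] by (simp add: lin_scale[OF lin(1)])
    have "y' (u v) = \<alpha> *s u v" using comm(2)[OF v(1)] v(2) by (simp add: lin_scale[OF lin(3)])
    then show "sum w D' \<in> {x \<in> X. y' x = \<alpha> *s x}" using X(4)[OF v(1)] by (simp flip: D'(5))
  qed (use D' lin d in auto)
  have z: "u (w d) \<in> ?Z d" if "d \<in> D'" for d
    using w[OF that] D'(3,4)[OF that] X(4) comm(2,3)[of "w d"] by (simp add: lin_scale[OF lin(3)])
  \<comment> \<open>Chosen to solve \<open>c *s L (g d) = u (w d)\<close>: since \<open>y'\<close>
    acts on \<open>u (w d)\<close> by \<open>d\<close>, \<open>L\<close> acts by
    \<open>(d - a) * (d - b)\<close>. For \<open>d = \<alpha>\<close> the vector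
    \<open>u (w d)\<close> is 0 by \<open>excl\<close>, hence the default value.\<close>
  define g where "g d = (if d = \<alpha> then 0 else inverse (c * ((d - a) * (d - b))) *s u (w d))" for d
  have g: "g d \<in> ?Z d" if "d \<in> D'" for d
    using z[OF that] X(1)
      by (simp add: g_def subspace_0 subspace_scale lin_simps[OF lin(1)] lin_simps[OF lin(2)] scale_left_commute)
  have Lg: "c *s L (g d) = u (w d)" if d: "d \<in> D'" for d
  proof (cases "d = \<alpha>")
    case True
    then show ?thesis using excl[of "u (w d)"] z[OF d] by (simp add: g_def lin_zero[OF linL])
  next
    case False
    have "L (u (w d)) = ((d - a) * (d - b)) *s u (w d)"
      using z[OF d] by (simp add: L_def lin_simps[OF lin(2)] algebra_simps)
    moreover have "c * (inverse (c * ((d - a) * (d - b))) * ((d - a) * (d - b))) = 1"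
    proof -
      have "c * ((d - a) * (d - b)) \<noteq> 0"
        using False scalars(1) scalars(4)[of d] D'(2) d by auto
      then show ?thesis by (simp only: mult.assoc[symmetric] mult.commute[of c] left_inverse)
         (simp add: field_simps)
    qed
    ultimately show ?thesis
      using False by (simp only: g_def lin_scale[OF linL] scale_scale if_False scale_one)
  qed
  \<comment> \<open>The rest is killed by \<open>L\<close> and splits into eigenvectors of
    \<open>y'\<close> for the two distinct roots \<open>a\<close> and \<open>b\<close>.\<close>
  define v' where "v' = v - (\<Sum>d\<in>D'. g d)"
  have "c *s L v' = u (u v) - (\<Sum>d\<in>D'. c *s L (g d))"
    using square[OF v, folded L_def]
    by (simp add: v'_def lin_diff[OF linL] lin_sum[OF linL] scale_right_diff_distrib scale_sum_right)
  also have "\<dots> = 0"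
    using Lg by (simp add: D'(5) lin_sum[OF lin(3)])
  finally have L0: "L v' = 0" using scalars(1) by simp
  have v': "v' \<in> X" "y v' = \<alpha> *s v'"
  proof -
    have "g d \<in> X" "y (g d) = \<alpha> *s g d" if "d \<in> D'" for d using g[OF that] by auto
    then show "v' \<in> X" "y v' = \<alpha> *s v'"
      using v X(1) unfolding v'_def
      by (auto simp: lin_simps[OF lin(1)] scale_right_diff_distrib scale_sum_right
          intro!: subspace_diff subspace_sum)
  qed
  have split: "v' = inverse (a - b) *s (y' v' - b *s v') - inverse (a - b) *s (y' v' - a *s v')"
  proof -
    have "inverse (a - b) *s (y' v' - b *s v') - inverse (a - b) *s (y' v' - a *s v')
        = inverse (a - b) *s ((a - b) *s v')"
      unfolding scale_right_diff_distrib[symmetric] by (simp add: algebra_simps)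
    then show ?thesis using scalars(2) by simp
  qed
  have yy: "y' (y' v') = (a + b) *s y' v' - (a * b) *s v'"
    using L0 by (simp add: L_def algebra_simps)
  have za: "y' v' - b *s v' \<in> ?Z a" and zb: "y' v' - a *s v' \<in> ?Z b"
    using v' X yy comm(1)[OF v'(1)]
    by (auto simp: lin_simps[OF lin(1)] lin_simps[OF lin(2)] algebra_simps intro!: subspace_diff subspace_scale)
  have "v = (\<Sum>d\<in>D'. g d) + v'" by (simp add: v'_def)
  also have "\<dots> \<in> span ?G"
  proof (rule span_add)
    show "(\<Sum>d\<in>D'. g d) \<in> span ?G"
    proof (rule span_sum)
      fix d assume "d \<in> D'"
      show "g d \<in> span ?G"
      proof (cases "d = \<alpha>")
        case False
        then show ?thesis using g \<open>d \<in> D'\<close> D'(2) by (intro span_UN_mem[of d]) auto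
      qed (simp add: g_def span_zero)
    qed
    show "v' \<in> span ?G"
      by (subst split) (intro span_diff span_scale span_UN_mem[where Z = ?Z and a = a, OF _ za]
        span_UN_mem[where Z = ?Z and a = b, OF _ zb], auto)
  qed
  finally show ?thesis .
qed

fun poly_op :: "('b \<Rightarrow> 'b) \<Rightarrow> ('j \<Rightarrow> 'a) \<Rightarrow> 'j list \<Rightarrow> 'b \<Rightarrow> 'b" where
  "poly_op h r [] x = x"
| "poly_op h r (j # js) x = h (poly_op h r js x) - r j *s poly_op h r js x"

lemma lin_poly_op: "lin h \<Longrightarrow> lin (poly_op h r js)"
  by (induction js) (auto simp: lin_iff scale_right_distrib scale_right_diff_distrib scale_left_commute)

lemma poly_op_eigen: "lin h \<Longrightarrow> h x = c *s x \<Longrightarrow> poly_op h r js x = (\<Prod>j\<leftarrow>js. c - r j) *s x"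
  by (induction js) (simp_all add: lin_scale scale_left_diff_distrib left_diff_distrib mult.commute)

text \<open>The image of \<open>x\<close> under all factors but the one for \<open>j\<close> is an
  eigenvector for \<open>r j\<close>; a suitable multiple of it, subtracted from \<open>x\<close>,
  leaves a vector that the remaining factors kill.\<close>

lemma poly_op_zero_diag:
  assumes "lin h" "inj r"
  shows "distinct js \<Longrightarrow> poly_op h r js x = 0 \<Longrightarrow> x \<in> span (\<Union>j\<in>set js. {x. h x = r j *s x})"
proof (induction js arbitrary: x)
  case (Cons j js)
  let ?u = "poly_op h r js x" and ?c = "\<Prod>l\<leftarrow>js. r j - r l"
  have u: "h ?u = r j *s ?u" using Cons.prems(2) by simp
  have c: "?c \<noteq> 0"
    using Cons.prems(1) inj_eq[OF assms(2)] by (induction js) auto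
  have "poly_op h r js (x - inverse ?c *s ?u) = 0"
    using c poly_op_eigen[OF assms(1) u, of r js]
    by (simp add: lin_diff[OF lin_poly_op[OF assms(1)]] lin_scale[OF lin_poly_op[OF assms(1)]])
  then have "x - inverse ?c *s ?u \<in> span (\<Union>j\<in>set js. {x. h x = r j *s x})"
    using Cons by simp
  then have 1: "x - inverse ?c *s ?u \<in> span (\<Union>j\<in>set (j # js). {x. h x = r j *s x})"
    using span_mono[of "\<Union>j\<in>set js. {x. h x = r j *s x}" "\<Union>j\<in>set (j # js). {x. h x = r j *s x}"] by auto
  have "?u \<in> span (\<Union>j\<in>set (j # js). {x. h x = r j *s x})"
    using u by (intro span_UN_mem[of j]) auto
  from span_add[OF 1 span_scale[OF this, of "inverse ?c"]] show ?case by simp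
qed (simp add: span_zero)

text \<open>Greedy choice: a further irreducible \<open>V\<close> meets the span reached so far
  either in 0, and is added, or in all of \<open>V\<close>, and is dropped. \<open>St\<close> stands
  for being a submodule.\<close>

lemma direct_subfamily:
  assumes "finite F" "\<And>W. W \<in> F \<Longrightarrow> St W \<and> W \<noteq> {0} \<and> (\<forall>U. St U \<and> U \<subseteq> W \<longrightarrow> U = {0} \<or> U = W)"
    and St: "\<And>A. St A \<Longrightarrow> subspace A" "\<And>A B. St A \<Longrightarrow> St B \<Longrightarrow> St (A \<inter> B)"
      "\<And>\<A>. (\<And>A. A \<in> \<A> \<Longrightarrow> St A) \<Longrightarrow> St (span (\<Union>\<A>))"
  shows "\<exists>\<W>. \<W> \<subseteq> F \<and> span (\<Union>\<W>) = span (\<Union>F) \<and>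
    (\<forall>f. (\<forall>W\<in>\<W>. f W \<in> W) \<longrightarrow> (\<Sum>W\<in>\<W>. f W) = 0 \<longrightarrow> (\<forall>W\<in>\<W>. f W = 0))"
  using assms(1,2)
proof (induction F rule: finite_induct)
  case empty
  show ?case by simp
next
  case (insert V F)
  then obtain \<W> where W: "\<W> \<subseteq> F" "span (\<Union>\<W>) = span (\<Union>F)"
    and dir: "\<forall>f. (\<forall>W\<in>\<W>. f W \<in> W) \<longrightarrow> (\<Sum>W\<in>\<W>. f W) = 0 \<longrightarrow> (\<forall>W\<in>\<W>. f W = 0)"
    by auto
  have fin: "finite \<W>" using W(1) insert.hyps(1) finite_subset by blast
  have StV: "St V" and irr: "\<And>U. St U \<Longrightarrow> U \<subseteq> V \<Longrightarrow> U = {0} \<or> U = V"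
    using insert.prems[of V] by auto
  have StF: "St W" if "W \<in> F" for W using insert.prems[of W] that by auto
  have un: "span (\<Union>(insert V F)) = span (V \<union> span (\<Union>F))"
    by (simp add: span_Un span_span)
  have "V \<inter> span (\<Union>\<W>) = {0} \<or> V \<inter> span (\<Union>\<W>) = V"
    using W(1) StF by (intro irr St(2) St(3) StV) auto
  then show ?case
  proof
    assume "V \<inter> span (\<Union>\<W>) = V"
    then have "V \<subseteq> span (\<Union>F)" using W(2) by auto
    then have "span (\<Union>\<W>) = span (\<Union>(insert V F))"
      unfolding un W(2) by (simp add: Un_absorb1 span_span)
    then show ?thesis using W(1) dir by (intro exI[of _ \<W>]) auto
  next
    assume V0: "V \<inter> span (\<Union>\<W>) = {0}"
    have dir': "f W = 0" if f: "\<forall>W\<in>insert V \<W>. f W \<in> W" "(\<Sum>W\<in>insert V \<W>. f W) = 0"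
      and "W \<in> insert V \<W>" for f W
    proof -
      have "V \<notin> \<W>" using W(1) insert.hyps(2) by auto
      then have "f V = - (\<Sum>W\<in>\<W>. f W)" using f(2) fin by (simp add: eq_neg_iff_add_eq_0)
      moreover have "(\<Sum>W\<in>\<W>. f W) \<in> span (\<Union>\<W>)"
        using f(1) by (intro span_sum span_base) auto
      ultimately have "f V \<in> V \<inter> span (\<Union>\<W>)" using f(1) by (auto intro: span_neg)
      then have "f V = 0" using V0 by auto
      then show ?thesis using \<open>f V = - _\<close> dir f(1) that(3) by auto
    qed
    have "span (\<Union>(insert V \<W>)) = span (V \<union> span (\<Union>F))"
      unfolding W(2)[symmetric] by (simp add: span_Un span_span)
    then show ?thesis using W(1) dir' un by (intro exI[of _ "insert V \<W>"]) auto
  qed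
qed

end

section \<open>Weights of Jucys--Murphy elements\<close>

text \<open>Kept apart from \<open>gt_module\<close> because the assumptions of the latter are
  stated with \<open>wsp\<close>, \<open>stable\<close>, \<open>children\<close> and
  \<open>grandchildren\<close>.\<close>

locale gt_base = vspace scale
  for scale :: "'k::field \<Rightarrow> 'v::ab_group_add \<Rightarrow> 'v" (infixr "*s" 75) +
  fixes n :: nat and t :: 'k and T :: "'v \<Rightarrow> 'v" and S :: "nat \<Rightarrow> 'v \<Rightarrow> 'v"
    and Y :: "'i \<Rightarrow> nat \<Rightarrow> 'v \<Rightarrow> 'v" and val :: "'i \<Rightarrow> 'm label \<Rightarrow> 'k"
  assumes lin_T: "lin T" and lin_S: "lin (S i)" and lin_Y: "lin (Y \<kappa> i)"
    and S_square: "Suc i < n \<Longrightarrow> S i (S i x) = t *s S i x + x"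
    and S_commute: "Suc i < j \<Longrightarrow> Suc j < n \<Longrightarrow> S i (S j x) = S j (S i x)"
    and S_braid: "Suc (Suc i) < n \<Longrightarrow> S i (S (Suc i) (S i x)) = S (Suc i) (S i (S (Suc i) x))"
    and Y_commute: "i < n \<Longrightarrow> j < n \<Longrightarrow> Y \<kappa> i (Y \<kappa>' j x) = Y \<kappa>' j (Y \<kappa> i x)"
    and Y_S_commute: "i < n \<Longrightarrow> Suc j < n \<Longrightarrow> i \<noteq> j \<Longrightarrow> i \<noteq> Suc j \<Longrightarrow> Y \<kappa> i (S j x) = S j (Y \<kappa> i x)"
begin

text \<open>The list may be shorter than \<open>n\<close>; it is then a weight for a smaller algebra
  of the chain, and extending the list refines the space.\<close>

definition wsp :: "'m label list \<Rightarrow> 'v set" where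
  "wsp a = {x. \<forall>i. i < length a \<longrightarrow> (\<forall>\<kappa>. Y \<kappa> i x = val \<kappa> (a ! i) *s x)}"

definition stable :: "nat \<Rightarrow> 'v set \<Rightarrow> bool" where
  "stable m U \<longleftrightarrow> subspace U \<and> (0 < m \<longrightarrow> (\<forall>x\<in>U. T x \<in> U)) \<and> (\<forall>i. Suc i < m \<longrightarrow> (\<forall>x\<in>U. S i x \<in> U))"

abbreviation irred :: "nat \<Rightarrow> 'v set \<Rightarrow> bool" where
  "irred m W \<equiv> stable m W \<and> W \<noteq> {0} \<and> (\<forall>U. stable m U \<and> U \<subseteq> W \<longrightarrow> U = {0} \<or> U = W)"

abbreviation children :: "'m label list \<Rightarrow> 'v set" where
  "children p \<equiv> \<Union>d\<in>{d. addable p d}. wsp (p @ [d])"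

abbreviation grandchildren :: "'m label list \<Rightarrow> 'm label \<Rightarrow> 'v set" where
  "grandchildren p c \<equiv> \<Union>d\<in>{d. addable p d \<and> d \<noteq> c \<or> adj c d}. wsp (p @ [c, d])"

lemma subspace_wsp: "subspace (wsp a)"
  unfolding wsp_def by (intro subspace_Collect_all subspace_Collect_imp subspace_eigen lin_Y)

lemma wsp_Nil [simp]: "wsp [] = UNIV"
  by (simp add: wsp_def)

lemma wsp_append: "x \<in> wsp (a @ b) \<Longrightarrow> x \<in> wsp a"
  by (force simp: wsp_def nth_append)

lemma wsp_snoc: "x \<in> wsp (a @ [c]) \<longleftrightarrow> x \<in> wsp a \<and> (\<forall>\<kappa>. Y \<kappa> (length a) x = val \<kappa> c *s x)"
  by (auto simp: wsp_def nth_append less_Suc_eq)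

lemma wsp_Y: "x \<in> wsp a \<Longrightarrow> length a \<le> n \<Longrightarrow> i < n \<Longrightarrow> Y \<kappa> i x \<in> wsp a"
  using Y_commute[of _ i] by (simp add: wsp_def lin_scale[OF lin_Y])

lemma wsp_S: "x \<in> wsp a \<Longrightarrow> length a \<le> i \<Longrightarrow> Suc i < n \<Longrightarrow> S i x \<in> wsp a"
  using Y_S_commute[of _ i] by (simp add: wsp_def lin_scale[OF lin_S])

lemma stable_subspace: "stable m U \<Longrightarrow> subspace U"
  by (simp add: stable_def)

lemma stable_Int: "stable m U \<Longrightarrow> stable m U' \<Longrightarrow> stable m (U \<inter> U')"
  by (simp add: stable_def subspace_inter)

lemma lin_span_closed:
  assumes "lin f" "\<And>x. x \<in> B \<Longrightarrow> f x \<in> span B" "x \<in> span B"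
  shows "f x \<in> span B"
  using assms(3)
  by (induction rule: span_induct_alt)
    (auto simp: lin_simps[OF assms(1)] intro!: span_add span_scale assms(2) span_zero)

lemma stable_span:
  assumes "0 < m \<Longrightarrow> (\<And>x. x \<in> B \<Longrightarrow> T x \<in> span B)" "\<And>i x. Suc i < m \<Longrightarrow> x \<in> B \<Longrightarrow> S i x \<in> span B"
  shows "stable m (span B)"
  using lin_span_closed[OF lin_T] lin_span_closed[OF lin_S] assms by (auto simp: stable_def)

lemma stable_span_Union: "(\<And>A. A \<in> \<A> \<Longrightarrow> stable m A) \<Longrightarrow> stable m (span (\<Union>\<A>))"
proof (rule stable_span)
  assume *: "\<And>A. A \<in> \<A> \<Longrightarrow> stable m A"
  show "T x \<in> span (\<Union>\<A>)" if "0 < m" "x \<in> \<Union>\<A>" for x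
    using * that by (auto simp: stable_def intro!: span_base)
  show "S i x \<in> span (\<Union>\<A>)" if i: "Suc i < m" and x: "x \<in> \<Union>\<A>" for i x
  proof -
    obtain A where "A \<in> \<A>" "x \<in> A" using x by blast
    moreover have "S i x \<in> A" using *[OF \<open>A \<in> \<A>\<close>] i \<open>x \<in> A\<close> by (simp add: stable_def)
    ultimately show ?thesis by (intro span_base) blast
  qed
qed

lemma wsp_components:
  assumes "finite D" "subspace U" "m \<le> n" "\<And>\<kappa> i x. i < m \<Longrightarrow> x \<in> U \<Longrightarrow> Y \<kappa> i x \<in> U"
    and "\<And>a. a \<in> D \<Longrightarrow> length a = m \<and> f a \<in> wsp a"
    and "\<And>a b. a \<in> D \<Longrightarrow> b \<in> D \<Longrightarrow> a \<noteq> b \<Longrightarrow> \<exists>i<m. \<exists>\<kappa>. val \<kappa> (a ! i) \<noteq> val \<kappa> (b ! i)"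
    and "(\<Sum>a\<in>D. f a) \<in> U" "a \<in> D"
  shows "f a \<in> U"
proof (rule joint_eigenvectors[where D = D and I = "UNIV \<times> {..<m}" and f = f
    and h = "\<lambda>(\<kappa>, i). Y \<kappa> i" and m = "\<lambda>(\<kappa>, i) a. val \<kappa> (a ! i)"])
  show "\<exists>i\<in>UNIV \<times> {..<m}. (case i of (\<kappa>, i) \<Rightarrow> \<lambda>a. val \<kappa> (a ! i)) a \<noteq> (case i of (\<kappa>, i) \<Rightarrow> \<lambda>a. val \<kappa> (a ! i)) b"
    if "a \<in> D" "b \<in> D" "a \<noteq> b" for a b using assms(6)[OF that] by fastforce
qed (use assms in \<open>auto simp: lin_Y wsp_def\<close>)

end

definition free :: "'m label \<Rightarrow> 'm label \<Rightarrow> bool" where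
  "free c d \<longleftrightarrow> c \<noteq> d \<and> \<not> adj c d"

lemma free_sym: "free c d \<Longrightarrow> free d c" and free_irrefl: "\<not> free c c"
  by (auto simp: free_def adj_sym)

lemma std_free_swps: "std a \<Longrightarrow> allowed free w a \<Longrightarrow> std (swps w a)"
proof (induction w arbitrary: a)
  case (Cons i w)
  then have i: "Suc i < length a" "free (a ! i) (a ! Suc i)" by auto
  obtain p c d r where *: "a = p @ [c, d] @ r" "length p = i" "c = a ! i" "d = a ! Suc i"
    using split_at[OF i(1)] .
  have "swp i a = p @ [d, c] @ r" using * swp_split[of p c d r] by metis
  moreover have "std (p @ [d, c] @ r)"
    using std_swap[of p c d r] Cons.prems(1) i(2) * by (metis free_def)
  ultimately show ?case using Cons by simp
qed simp

text \<open>
  \<open>Y \<kappa> i\<close> are the Jucys--Murphy elements and \<open>val \<kappa> c\<close> their eigenvalues on weight vectors with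
  \<open>i\<close>-th label \<open>c\<close>; \<open>\<kappa>\<close> ranges over one family for \<open>q\<^sup>2 \<noteq> 1\<close> and over several for \<open>q\<^sup>2 = 1\<close>.
  \<open>dd c d\<close> is the diagonal coefficient of the generator that exchanges the labels \<open>c\<close> and \<open>d\<close> in the
  seminormal form, and \<open>sep c d\<close> says that the eigenvalues for \<open>c\<close> and \<open>d\<close> differ. Positions start
  at 0, so that \<open>S i\<close> is \<open>\<sigma> (i + 1)\<close>.
\<close>

locale gt_module = gt_base scale n t T S Y val
  for scale :: "'k::field \<Rightarrow> 'v::ab_group_add \<Rightarrow> 'v" (infixr "*s" 75) and n t T S
    and Y :: "'i \<Rightarrow> nat \<Rightarrow> 'v \<Rightarrow> 'v" and val :: "'i \<Rightarrow> 'm label \<Rightarrow> 'k" +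
  fixes dd :: "'m label \<Rightarrow> 'm label \<Rightarrow> 'k" and sep :: "'m label \<Rightarrow> 'm label \<Rightarrow> bool"
  assumes Y_stable: "m \<le> n \<Longrightarrow> stable m U \<Longrightarrow> i < m \<Longrightarrow> x \<in> U \<Longrightarrow> Y \<kappa> i x \<in> U"
    and T_eigen: "0 < n \<Longrightarrow> x \<in> wsp [c] \<Longrightarrow> \<exists>b. T x = b *s x"
    and init: "0 < n \<Longrightarrow> x \<in> span (\<Union>c\<in>{c. snd c = 0}. wsp [c])"
    and sep_val: "sep c d \<Longrightarrow> \<exists>\<kappa>. val \<kappa> c \<noteq> val \<kappa> d"
    and sep_sym: "sep c d \<Longrightarrow> sep d c"
    and sep_addable: "std p \<Longrightarrow> length p < n \<Longrightarrow> addable p c \<Longrightarrow> addable p d \<Longrightarrow> c \<noteq> d \<Longrightarrow> sep c d"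
    and sep_adj: "std p \<Longrightarrow> Suc (length p) < n \<Longrightarrow> addable p c \<Longrightarrow> addable p d \<Longrightarrow> adj c e \<Longrightarrow> sep e d"
    and dd_sum: "sep c d \<Longrightarrow> dd c d + dd d c = t"
    and dd_braid: "sep a b \<Longrightarrow> sep b c \<Longrightarrow> sep a c \<Longrightarrow> dd a c * (dd a b + dd b c - t) = dd a b * dd b c"
    and dd_free: "std p \<Longrightarrow> Suc (length p) < n \<Longrightarrow> addable p c \<Longrightarrow> addable p d \<Longrightarrow> c \<noteq> d \<Longrightarrow>
      dd c d * dd d c \<noteq> - 1"
    and dd_adj: "1 < n \<Longrightarrow> adj c d \<Longrightarrow> dd c d * dd d c = - 1"
      "1 < n \<Longrightarrow> adj c d \<Longrightarrow> dd c d \<noteq> dd d c"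
    and intertwine: "Suc i < n \<Longrightarrow> sep c d \<Longrightarrow> \<forall>\<kappa>. Y \<kappa> i x = val \<kappa> c *s x \<Longrightarrow>
      \<forall>\<kappa>. Y \<kappa> (Suc i) x = val \<kappa> d *s x \<Longrightarrow>
      Y \<kappa> i (S i x - dd c d *s x) = val \<kappa> d *s (S i x - dd c d *s x) \<and>
      Y \<kappa> (Suc i) (S i x - dd c d *s x) = val \<kappa> c *s (S i x - dd c d *s x)"
    and rank_two_branching: "std p \<Longrightarrow> Suc (length p) < n \<Longrightarrow> addable p c \<Longrightarrow>
      wsp p \<subseteq> span (children p) \<Longrightarrow>
      wsp (p @ [c]) \<subseteq> span (grandchildren p c)"
begin

text \<open>The coefficient is taken from the list \<open>a\<close>, not from \<open>x\<close>, so
  that the map is linear on the whole space; on vectors of weight \<open>a\<close> it is the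
  intertwiner exchanging two labels.\<close>

definition step :: "nat \<Rightarrow> 'm label list \<Rightarrow> 'v \<Rightarrow> 'v" where
  "step i a x = S i x - dd (a ! i) (a ! Suc i) *s x"

lemma lin_step: "lin (step i a)"
  unfolding step_def[abs_def] by (intro lin_subtract lin_S lin_smult lin_id)

lemma step_wsp:
  assumes "x \<in> wsp a" "Suc i < length a" "length a \<le> n" "sep (a ! i) (a ! Suc i)"
  shows "step i a x \<in> wsp (swp i a)"
proof -
  have "Y \<kappa> k (step i a x) = val \<kappa> (swp i a ! k) *s step i a x" if "k < length a" for \<kappa> k
  proof (cases "k = i \<or> k = Suc i")
    case True
    then show ?thesis
      using intertwine[of i "a ! i" "a ! Suc i" x \<kappa>] assms by (auto simp: wsp_def step_def nth_swp)
  next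
    case False
    then show ?thesis
      using assms that Y_S_commute[of k i]
      by (simp add: wsp_def step_def nth_swp lin_simps[OF lin_Y] lin_simps[OF lin_S]
          scale_right_diff_distrib scale_left_commute)
  qed
  then show ?thesis by (simp add: wsp_def)
qed

text \<open>This is the quadratic relation. By \<open>dd_adj\<close> the scalar is 0 for adjacent
  labels, while \<open>dd_free\<close> makes it nonzero where labels can be exchanged, so that
  \<open>step\<close> is invertible there.\<close>

lemma step_step:
  assumes "Suc i < length a" "length a \<le> n" "sep (a ! i) (a ! Suc i)"
  shows "step i (swp i a) (step i a x) = (1 + dd (a ! i) (a ! Suc i) * dd (a ! Suc i) (a ! i)) *s x"
proof -
  define c where "c = dd (a ! i) (a ! Suc i)"
  define d where "d = dd (a ! Suc i) (a ! i)"
  have t: "t = c + d" using dd_sum[OF assms(3)] by (simp add: c_def d_def)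
  have "step i (swp i a) (step i a x) = S i (S i x) - c *s S i x - d *s S i x + (d * c) *s x"
    using assms(1) by (simp add: step_def nth_swp lin_simps[OF lin_S] scale_right_diff_distrib c_def d_def)
  also have "\<dots> = (1 + c * d) *s x"
    using assms S_square[of i x] by (simp add: t scale_left_distrib mult.commute)
  finally show ?thesis by (simp add: c_def d_def)
qed

section \<open>Branching of weight spaces\<close>

definition branches :: "'m label list \<Rightarrow> bool" where
  "branches p \<longleftrightarrow> wsp p \<subseteq> span (children p)"

lemma branches_sumE:
  assumes "branches p" "x \<in> wsp p"
  obtains D f where "finite D" "\<And>d. d \<in> D \<Longrightarrow> addable p d \<and> f d \<in> wsp (p @ [d])" "x = (\<Sum>d\<in>D. f d)"
proof -
  have "x \<in> span (children p)" using assms by (auto simp: branches_def)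
  then obtain D f where "finite D" "D \<subseteq> {d. addable p d}" "\<And>d. d \<in> D \<Longrightarrow> f d \<in> wsp (p @ [d])"
    "x = (\<Sum>d\<in>D. f d)"
    by (rule span_UN_sumE) (auto intro: subspace_wsp)
  then show ?thesis using that by blast
qed

text \<open>The components of \<open>x\<close> along the addable labels inherit the eigenvalues
  belonging to \<open>e\<close>, but also have those of their own label, and some of these
  differ.\<close>

lemma wsp_vanish:
  assumes "std p" "length p < n" "branches p" "\<And>d. addable p d \<Longrightarrow> sep e d" "x \<in> wsp (p @ [e])"
  shows "x = 0"
proof -
  have x: "x \<in> wsp p" using assms(5) wsp_append by blast
  obtain D f where D: "finite D" "\<And>d. d \<in> D \<Longrightarrow> addable p d \<and> f d \<in> wsp (p @ [d])" "x = (\<Sum>d\<in>D. f d)"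
    by (rule branches_sumE[OF assms(3) x]) blast
  define U where "U = {y. \<forall>\<kappa>. Y \<kappa> (length p) y = val \<kappa> e *s y}"
  have U: "subspace U"
    unfolding U_def by (intro subspace_Collect_all subspace_eigen lin_Y)
  have "f d = 0" if d: "d \<in> D" for d
  proof -
    have "f d \<in> U"
    proof (rule joint_eigenvectors[where D = D and I = UNIV and f = f
          and h = "\<lambda>\<kappa>. Y \<kappa> (length p)" and m = val])
      show "Y \<kappa> (length p) y \<in> U" if "y \<in> U" for \<kappa> y
        using that assms(2) Y_commute[of "length p" "length p"]
          by (auto simp: U_def lin_scale[OF lin_Y])
      show "\<exists>i\<in>UNIV. val i a \<noteq> val i b" if "a \<in> D" "b \<in> D" "a \<noteq> b" for a b
        using that D(2) sep_val sep_addable[OF assms(1,2)] by blast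
      show "sum f D \<in> U" using assms(5) D(3) by (simp add: wsp_snoc U_def)
    qed (use D U d lin_Y in \<open>auto simp: wsp_snoc\<close>)
    moreover obtain \<kappa> where "val \<kappa> e \<noteq> val \<kappa> d" using assms(4) D(2)[OF d] sep_val by blast
    moreover have "Y \<kappa> (length p) (f d) = val \<kappa> d *s f d" using D(2)[OF d] by (simp add: wsp_snoc)
    ultimately show ?thesis by (auto simp: U_def)
  qed
  then show ?thesis using D(3) by simp
qed

text \<open>The last box of content \<open>d\<close> in \<open>q\<close> is moved to the end of
  \<open>q\<close>: the boxes added after it are neither \<open>d\<close> nor adjacent to
  \<open>d\<close>, as otherwise \<open>d\<close> would not have stayed removable. The intertwiners
  used are invertible, so the vector stays nonzero.\<close>

lemma move_to_end:
  assumes "std (q @ r)" "removable q d" "x \<in> wsp (q @ r @ [d])" "x \<noteq> 0" "length (q @ r @ [d]) \<le> n"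
  shows "\<exists>q' x'. std (q' @ [d] @ r) \<and> x' \<noteq> 0 \<and> x' \<in> wsp (q' @ [d] @ r @ [d]) \<and> Suc (length q') = length q"
  using assms
proof (induction q arbitrary: r rule: rev_induct)
  case Nil
  then show ?case using not_removable_Nil by blast
next
  case (snoc e q)
  show ?case
  proof (cases "e = d")
    case True
    then show ?thesis using snoc.prems by (intro exI[of _ q] exI[of _ x]) simp
  next
    case False
    have "std (q @ [e])" using snoc.prems(1) std_append[of "q @ [e]" r] by simp
    then have e: "addable q e" unfolding std_snoc_iff by blast
    have rem: "removable q d" "\<not> adj e d"
      using removable_snocD[OF e snoc.prems(2) False] by auto
    obtain q' x' where q': "std (q' @ [d] @ e # r)" "x' \<noteq> 0" "x' \<in> wsp (q' @ [d] @ (e # r) @ [d])"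
      "Suc (length q') = length q"
      using snoc.IH[of "e # r"] snoc.prems rem by auto
    let ?a = "q' @ [d, e] @ r @ [d]"
    have "std (q' @ [d, e])" using q'(1) std_append[of "q' @ [d, e]" r] by simp
    then have "std ((q' @ [d]) @ [e])" by simp
    then have std': "std q'" "addable q' d" "addable (q' @ [d]) e"
      unfolding std_snoc_iff by blast+
    then have "addable q' e" using addable_snocD(2) rem(2) adj_sym by blast
    moreover have len: "length ?a \<le> n" "Suc (length q') < n" using snoc.prems(5) q'(4) by auto
    ultimately have sep: "sep d e" and prod: "dd d e * dd e d \<noteq> - 1"
      using sep_addable[of q' d e] dd_free[of q' d e] std' False by auto
    have nth: "?a ! length q' = d" "?a ! Suc (length q') = e" by (simp_all add: nth_append)
    have "step (length q') ?a x' \<in> wsp (swp (length q') ?a)"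
      using q'(3) len sep by (intro step_wsp) (simp_all add: nth_append)
    then have "step (length q') ?a x' \<in> wsp ((q' @ [e]) @ [d] @ r @ [d])"
      using swp_split[of q' d e "r @ [d]"] by simp
    moreover have "step (length q') ?a x' \<noteq> 0"
    proof
      assume "step (length q') ?a x' = 0"
      then have "(1 + dd d e * dd e d) *s x' = 0"
        using step_step[of "length q'" ?a x'] len sep lin_zero[OF lin_step]
          by (simp add: nth_append)
      then show False using q'(2) prod by (simp add: eq_neg_iff_add_eq_0 add.commute)
    qed
    moreover have "std (q' @ [e, d] @ r)"
      using std_swap[of q' d e r] q'(1) rem(2) adj_sym[of d e] by simp
    ultimately show ?thesis using q'(4) by (intro exI[of _ "q' @ [e]"]) auto
  qed
qed

text \<open>On a vector whose weight ends in \<open>d, c, d\<close> with adjacent \<open>c\<close> and \<open>d\<close>, two consecutive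
  generators would act by distinct scalars, against the braid relation.\<close>

lemma braid_exclusion:
  assumes "std p" "Suc (length p) < n" "\<And>p'. std p' \<Longrightarrow> length p' \<le> length p \<Longrightarrow> branches p'"
    and "addable p c" "adj c d" "removable p d" "x \<in> wsp (p @ [c, d])"
  shows "x = 0"
proof (rule ccontr)
  assume "x \<noteq> 0"
  have "std (p @ [c])" using assms(1,4) std_snoc_iff by blast
  \<comment> \<open>With \<open>r = [c]\<close>, the box of content \<open>d\<close> in
    \<open>p\<close> is brought directly in front of \<open>c\<close>.\<close>
  then obtain q y where q: "std (q @ [d] @ [c])" "y \<noteq> 0" "y \<in> wsp (q @ [d] @ [c] @ [d])"
    "Suc (length q) = length p"
    using move_to_end[of p "[c]" d x] assms \<open>x \<noteq> 0\<close> by auto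
  have "std ((q @ [d]) @ [c])" using q(1) by simp
  then have std': "std (q @ [d])" "std q" "addable q d" "addable (q @ [d]) c"
    unfolding std_snoc_iff by blast+
  have adj: "adj d c" using assms(5) adj_sym by blast
  let ?i = "length q"
  let ?a = "q @ [d, c] @ [d]"
  have y: "y \<in> wsp ?a" using q(3) by simp
  have len: "length ?a \<le> n" "Suc ?i < n" "?i < n" "Suc (Suc ?i) < n" "1 < n"
    using q(4) assms(2) by auto
  have sepcd: "sep c d" using sep_adj[OF std'(2) len(2) std'(3,3) adj] .
  have nth: "?a ! ?i = d" "?a ! Suc ?i = c" "?a ! Suc (Suc ?i) = d" by (simp_all add: nth_append)
  \<comment> \<open>The exchanged weight starts with \<open>q @ [c]\<close>, and \<open>c\<close>,
    as a neighbour of the addable \<open>d\<close>, is separated from all labels addable to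
    \<open>q\<close>; so the step vanishes.\<close>
  have "step ?i ?a y \<in> wsp (swp ?i ?a)"
    by (intro step_wsp) (use y len sepcd sep_sym in \<open>simp_all add: nth_append\<close>)
  then have "step ?i ?a y \<in> wsp ((q @ [c]) @ [d] @ [d])"
    using swp_split[of q d c "[d]"] by simp
  then have "step ?i ?a y \<in> wsp (q @ [c])" by (rule wsp_append)
  moreover have "branches q" using assms(3)[OF std'(2)] q(4) by simp
  ultimately have "step ?i ?a y = 0"
    using wsp_vanish[OF std'(2) len(3) _ sep_adj[OF std'(2) len(2) std'(3) _ adj]] by blast
  then have S1: "S ?i y = dd d c *s y" by (simp add: step_def nth_append)
  \<comment> \<open>Likewise for \<open>q @ [d, d]\<close>: every label addable to
    \<open>q @ [d]\<close> is separated from \<open>d\<close>.\<close>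
  have "step (Suc ?i) ?a y \<in> wsp (swp (Suc ?i) ?a)"
    by (intro step_wsp) (use y len sepcd in \<open>simp_all add: nth_append\<close>)
  then have "step (Suc ?i) ?a y \<in> wsp (((q @ [d]) @ [d]) @ [c])"
    using swp_split[of "q @ [d]" c d "[]"] by simp
  then have "step (Suc ?i) ?a y \<in> wsp ((q @ [d]) @ [d])" by (rule wsp_append)
  moreover have "sep d e" if "addable (q @ [d]) e" for e
    using addable_snocD[OF std'(3) that] sep_addable[OF std'(2) len(3) std'(3)]
      sep_adj[OF std'(2) len(2) std'(3,3)] sep_sym by blast
  moreover have "branches (q @ [d])" "length (q @ [d]) < n"
    using assms(3)[OF std'(1)] q(4) len by auto
  ultimately have "step (Suc ?i) ?a y = 0"
    using wsp_vanish[OF std'(1)] by blast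
  then have S2: "S (Suc ?i) y = dd c d *s y" by (simp add: step_def nth_append)
  \<comment> \<open>The two scalars have product \<open>- 1\<close>, so the braid relation on
    \<open>y\<close> forces them to be equal.\<close>
  have "(dd d c * dd c d * dd d c) *s y = (dd c d * dd d c * dd c d) *s y"
    using S_braid[OF len(4), of y] by (simp add: S1 S2 lin_simps[OF lin_S] mult.assoc)
  then have "dd d c * dd c d * dd d c = dd c d * dd d c * dd c d"
    using q(2) scale_right_imp_eq by blast
  then show False using dd_adj[OF len(5) adj] by (simp add: mult.commute[of "dd c d"])
qed

text \<open>\<open>rank_two_branching\<close> needs the shape before the last box, but
  \<open>braid_exclusion\<close> rearranges boxes and needs all shapes up to that size; hence the
  induction over all shorter lists.\<close>

lemma all_branches: "std p \<Longrightarrow> length p < n \<Longrightarrow> branches p"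
proof (induction "length p" arbitrary: p rule: less_induct)
  case less
  show ?case
  proof (cases p rule: rev_cases)
    case Nil
    then show ?thesis using init less.prems by (auto simp: branches_def)
  next
    case (snoc p0 c)
    have p0: "std p0" "addable p0 c" using less.prems(1) snoc std_snoc_iff by blast+
    have IH: "branches p'" if "std p'" "length p' \<le> length p0" for p'
      using less.hyps[of p'] that less.prems snoc by simp
    have len: "Suc (length p0) < n" using less.prems snoc by simp
    have "wsp p \<subseteq> span (grandchildren p0 c)"
      unfolding snoc by (rule rank_two_branching) (use p0 len IH[OF p0(1)] in \<open>simp_all add: branches_def\<close>)
    also have "\<dots> \<subseteq> span (children p)"
    proof (rule span_minimal, rule UN_least, rule subsetI)
      fix d x assume d: "d \<in> {d. addable p0 d \<and> d \<noteq> c \<or> adj c d}" and x: "x \<in> wsp (p0 @ [c, d])"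
      show "x \<in> span (children p)"
      proof (cases "addable p d")
        case True
        then show ?thesis using x snoc by (intro span_UN_mem[of d]) auto
      next
        case False
        then have "adj c d" "removable p0 d"
          using d addable_snocI[OF p0(2), of d] not_addable_snoc_adj[OF p0(2), of d] snoc by auto
        then have "x = 0" using braid_exclusion[OF p0(1) len IH p0(2)] x by blast
        then show ?thesis by (simp add: span_zero)
      qed
    qed (rule subspace_span)
    finally show ?thesis by (simp add: branches_def)
  qed
qed

lemma weight_decomposition: "m \<le> n \<Longrightarrow> x \<in> span (\<Union>a\<in>{a. std a \<and> length a = m}. wsp a)"
proof (induction m arbitrary: x)
  case 0
  have "{a :: 'm label list. std a \<and> length a = 0} = {[]}" by auto
  then show ?case by (simp add: span_UNIV)
next
  case (Suc m)
  have "UNIV \<subseteq> span (\<Union>a\<in>{a. std a \<and> length a = m}. wsp a)" using Suc by auto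
  also have "\<dots> \<subseteq> span (\<Union>a\<in>{a. std a \<and> length a = Suc m}. wsp a)"
  proof (rule span_minimal, rule UN_least)
    fix a :: "'m label list" assume "a \<in> {a. std a \<and> length a = m}"
    then have a: "std a" "length a = m" by auto
    have "wsp a \<subseteq> span (children a)"
      using all_branches[OF a(1)] a(2) Suc.prems by (auto simp: branches_def)
    also have "\<dots> \<subseteq> span (\<Union>a\<in>{a. std a \<and> length a = Suc m}. wsp a)"
    proof (rule span_mono, rule UN_least)
      fix d assume "d \<in> {d. addable a d}"
      then have "a @ [d] \<in> {a. std a \<and> length a = Suc m}" using a by simp
      then show "wsp (a @ [d]) \<subseteq> (\<Union>a\<in>{a. std a \<and> length a = Suc m}. wsp a)" by blast
    qed
    finally show "wsp a \<subseteq> span (\<Union>a\<in>{a. std a \<and> length a = Suc m}. wsp a)" .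
  qed (rule subspace_span)
  finally show ?case by auto
qed

text \<open>At the first place where the lists differ, both labels are addable to the same shape,
  and \<open>sep_addable\<close> applies.\<close>

lemma std_separated:
  assumes "std a" "std b" "length a = length b" "length a \<le> n" "a \<noteq> b"
  shows "\<exists>i<length a. sep (a ! i) (b ! i)"
  using assms
proof (induction a arbitrary: b rule: rev_induct)
  case (snoc c a)
  obtain d b' where b: "b = b' @ [d]" using snoc.prems(3) by (cases b rule: rev_cases) auto
  show ?case
  proof (cases "a = b'")
    case True
    then have "sep c d" using snoc.prems b sep_addable[of a c d] std_snoc_iff by auto
    then show ?thesis using True b by (intro exI[of _ "length a"]) simp
  next
    case False
    then obtain i where "i < length a" "sep (a ! i) (b' ! i)"
      using snoc.IH[of b'] snoc.prems b std_snoc_iff by auto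
    then show ?thesis using b snoc.prems(3) by (intro exI[of _ i]) (simp add: nth_append)
  qed
qed simp

lemma std_wsp_components:
  assumes "finite D" "m \<le> n" "subspace U" "\<And>\<kappa> i x. i < m \<Longrightarrow> x \<in> U \<Longrightarrow> Y \<kappa> i x \<in> U"
    and "\<And>a. a \<in> D \<Longrightarrow> std a \<and> length a = m \<and> f a \<in> wsp a" "(\<Sum>a\<in>D. f a) \<in> U" "a \<in> D"
  shows "f a \<in> U"
proof (rule wsp_components[where D = D and m = m and f = f])
  show "\<exists>i<m. \<exists>\<kappa>. val \<kappa> (a ! i) \<noteq> val \<kappa> (b ! i)" if "a \<in> D" "b \<in> D" "a \<noteq> b" for a b
    using std_separated[of a b] assms(2,5) that sep_val by metis
qed (use assms in auto)

lemma stable_weight_vector: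
  assumes "stable m U" "m \<le> n" "U \<noteq> {0}"
  obtains a x where "std a" "length a = m" "x \<in> wsp a" "x \<in> U" "x \<noteq> 0"
proof -
  obtain z where z: "z \<in> U" "z \<noteq> 0" using assms(1,3) subspace_0 by (auto simp: stable_def)
  obtain D f where D: "finite D" "D \<subseteq> {a. std a \<and> length a = m}" "\<And>a. a \<in> D \<Longrightarrow> f a \<in> wsp a"
    "z = (\<Sum>a\<in>D. f a)"
    using span_UN_sumE[OF weight_decomposition[OF assms(2), of z] subspace_wsp] by blast
  obtain a where a: "a \<in> D" "f a \<noteq> 0" using z(2) D(4) by (metis sum.neutral)
  have "f a \<in> U"
  proof (rule std_wsp_components[OF D(1) assms(2) stable_subspace[OF assms(1)]])
    show "sum f D \<in> U" using z(1) D(4) by simp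
  qed (use D(2,3) a(1) Y_stable[OF assms(2,1)] in blast)+
  then show ?thesis using that a D by blast
qed

text \<open>Of two consecutive labels \<open>c\<close>, \<open>d\<close>, either both are addable to
  the shape before \<open>c\<close>, or they are adjacent. In the second case \<open>d\<close> is
  not addable there, the exchanged weight does not occur, and the vanishing \<open>step\<close>
  makes the generator a scalar.\<close>

lemma std_consecutive:
  assumes "std a" "Suc i < length a" "length a \<le> n"
  shows "sep (a ! i) (a ! Suc i)"
    and "free (a ! i) (a ! Suc i) \<Longrightarrow> 1 + dd (a ! i) (a ! Suc i) * dd (a ! Suc i) (a ! i) \<noteq> 0"
    and "\<not> free (a ! i) (a ! Suc i) \<Longrightarrow> x \<in> wsp a \<Longrightarrow> S i x = dd (a ! i) (a ! Suc i) *s x"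
proof -
  obtain p c d r where *: "a = p @ [c, d] @ r" "length p = i" "c = a ! i" "d = a ! Suc i"
    using split_at[OF assms(2)] .
  have "std ((p @ [c]) @ [d])" using assms(1) *(1) std_append[of "p @ [c, d]" r] by simp
  then have p: "std p" "addable p c" "addable (p @ [c]) d" unfolding std_snoc_iff by blast+
  have len: "Suc (length p) < n" using assms(2,3) *(2) by simp
  have cd: "d \<noteq> c" "addable p d \<or> adj c d" using addable_snocD[OF p(2,3)] by auto
  show sep: "sep (a ! i) (a ! Suc i)"
    using cd sep_addable[OF p(1) _ p(2), of d] sep_adj[OF p(1) len p(2,2), of d] sep_sym[of d c] len *(3,4) by auto
  show "1 + dd (a ! i) (a ! Suc i) * dd (a ! Suc i) (a ! i) \<noteq> 0" if "free (a ! i) (a ! Suc i)"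
    using dd_free[OF p(1) len p(2), of d] cd that *(3,4)
    by (auto simp: free_def eq_neg_iff_add_eq_0 add.commute)
  show "S i x = dd (a ! i) (a ! Suc i) *s x" if "\<not> free (a ! i) (a ! Suc i)" "x \<in> wsp a"
  proof -
    have "adj c d" using that(1) cd *(3,4) by (auto simp: free_def)
    have "step i a x \<in> wsp (swp i a)" using that(2) assms(2,3) sep by (rule step_wsp)
    moreover have "swp i a = (p @ [d]) @ c # r"
      using *(1,2) swp_split[of p c d r] by auto
    ultimately have "step i a x \<in> wsp (p @ [d])" using wsp_append by metis
    moreover have "length p < n" using len by simp
    ultimately have "step i a x = 0"
      using wsp_vanish[OF p(1) _ all_branches[OF p(1)] sep_adj[OF p(1) len p(2) _ \<open>adj c d\<close>]] by blast
    then show ?thesis by (simp add: step_def)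
  qed
qed

section \<open>Products of intertwiners along paths\<close>

fun run :: "nat list \<Rightarrow> 'm label list \<Rightarrow> 'v \<Rightarrow> 'v" where
  "run [] a x = x"
| "run (i # w) a x = run w (swp i a) (step i a x)"

lemma run_append: "run (u @ w) a x = run w (swps u a) (run u a x)"
  by (induction u arbitrary: a x) simp_all

lemma run_scale: "run w a (c *s x) = c *s run w a x"
  by (induction w arbitrary: a x) (simp_all add: lin_scale[OF lin_step])

lemma run_wsp:
  "std a \<Longrightarrow> length a \<le> n \<Longrightarrow> allowed free w a \<Longrightarrow> x \<in> wsp a \<Longrightarrow> run w a x \<in> wsp (swps w a)"
proof (induction w arbitrary: a x)
  case (Cons i w)
  have "std (swp i a)" using std_free_swps[of a "[i]"] Cons.prems by simp
  moreover have "step i a x \<in> wsp (swp i a)"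
    using Cons.prems std_consecutive(1)[of a i] by (intro step_wsp) auto
  ultimately show ?case using Cons by simp
qed simp

lemma run_stable:
  assumes "stable m U"
  shows "length a = m \<Longrightarrow> allowed free w a \<Longrightarrow> x \<in> U \<Longrightarrow> run w a x \<in> U"
proof (induction w arbitrary: a x)
  case (Cons i w)
  have "step i a x \<in> U"
    using assms Cons.prems unfolding step_def
      by (auto simp: stable_def intro!: subspace_diff subspace_scale)
  then show ?case using Cons by simp
qed simp

lemma step_commute:
  assumes "Suc i < j" "Suc j < length a" "length a \<le> n"
  shows "step j (swp i a) (step i a x) = step i (swp j a) (step j a x)"
  using assms S_commute[of i j x]
  by (simp add: step_def nth_swp lin_simps[OF lin_S] scale_right_diff_distrib algebra_simps)

text \<open>After expansion both sides agree by the relations of the generators except in the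
  coefficients of \<open>S i x\<close> and \<open>S (Suc i) x\<close>; \<open>dd_braid\<close> is
  the identity that equates these.\<close>

lemma step_braid:
  assumes a: "std a" "length a \<le> n" "Suc (Suc i) < length a" and free: "free (a ! i) (a ! Suc i)"
    "free (a ! i) (a ! Suc (Suc i))" "free (a ! Suc i) (a ! Suc (Suc i))"
  shows "run [i, Suc i, i] a x = run [Suc i, i, Suc i] a x"
proof -
  define p q r where "p = a ! i" and "q = a ! Suc i" and "r = a ! Suc (Suc i)"
  define \<alpha> \<beta> \<gamma> where "\<alpha> = dd p q" and "\<beta> = dd q r" and "\<gamma> = dd p r"
  have 1: "sep p q" "sep q r"
    using std_consecutive(1)[OF a(1), of i] std_consecutive(1)[OF a(1), of "Suc i"] a
    by (simp_all add: p_def q_def r_def)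
  \<comment> \<open>In the exchanged path \<open>p\<close> and \<open>r\<close> are consecutive,
    which yields the third separation.\<close>
  have "std (swp i a)" using std_free_swps[of a "[i]"] a free by simp
  from std_consecutive(1)[OF this, of "Suc i"] have 2: "sep p r"
    using a by (simp add: p_def r_def nth_swp)
  have key: "\<gamma> * (\<alpha> + \<beta> - t) = \<alpha> * \<beta>"
    using dd_braid[OF 1 2] by (simp add: \<alpha>_def \<beta>_def \<gamma>_def)
  have sq: "S i (S i x) = t *s S i x + x" "S (Suc i) (S (Suc i) x) = t *s S (Suc i) x + x"
    using S_square a by simp_all
  let ?x1 = "S i x" and ?x2 = "S (Suc i) x" and ?x12 = "S i (S (Suc i) x)" and ?x21 = "S (Suc i) (S i x)"
  have "run [i, Suc i, i] a x = S i (S (Suc i) (S i x)) - \<alpha> *s ?x12 - \<gamma> *s (t *s ?x1 + x)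
      + (\<alpha> * \<gamma>) *s ?x1 - \<beta> *s ?x21 + (\<alpha> * \<beta>) *s ?x2 + (\<beta> * \<gamma>) *s ?x1 - (\<alpha> * \<beta> * \<gamma>) *s x"
    using a by (simp add: step_def nth_swp lin_simps[OF lin_S] sq scale_right_diff_distrib
      \<alpha>_def \<beta>_def \<gamma>_def p_def q_def r_def algebra_simps)
  also have "\<dots> = S i (S (Suc i) (S i x)) - \<alpha> *s ?x12 - \<beta> *s ?x21 + (\<alpha> * \<beta>) *s ?x2
      + (\<gamma> * (\<alpha> + \<beta> - t)) *s ?x1 - \<gamma> *s x - (\<alpha> * \<beta> * \<gamma>) *s x"
    by (simp add: algebra_simps)
  also have "\<dots> = S (Suc i) (S i (S (Suc i) x)) - \<alpha> *s ?x12 - \<beta> *s ?x21 + (\<alpha> * \<beta>) *s ?x1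
      + (\<gamma> * (\<alpha> + \<beta> - t)) *s ?x2 - \<gamma> *s x - (\<alpha> * \<beta> * \<gamma>) *s x"
    using S_braid[of i x] a unfolding key by (simp add: algebra_simps)
  also have "\<dots> = S (Suc i) (S i (S (Suc i) x)) - \<beta> *s ?x21 - \<gamma> *s (t *s ?x2 + x)
      + (\<beta> * \<gamma>) *s ?x2 - \<alpha> *s ?x12 + (\<alpha> * \<beta>) *s ?x1 + (\<alpha> * \<gamma>) *s ?x2 - (\<alpha> * \<beta> * \<gamma>) *s x"
    by (simp add: algebra_simps)
  also have "\<dots> = run [Suc i, i, Suc i] a x"
    using a by (simp add: step_def nth_swp lin_simps[OF lin_S] sq scale_right_diff_distrib
      \<alpha>_def \<beta>_def \<gamma>_def p_def q_def r_def algebra_simps)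
  finally show ?thesis .
qed

text \<open>Only the deletion of a square contributes a factor, the one of \<open>step_step\<close>;
  the other relations give \<open>c = 1\<close>.\<close>

lemma run_rew:
  assumes "rew w w'" "allowed free w a" "std a" "length a \<le> n"
  shows "\<exists>c. c \<noteq> 0 \<and> run w a x = c *s run w' a x"
  using assms
proof (induction rule: rew.induct)
  case (rew_square u i w)
  define b where "b = swps u a"
  have "allowed free u a" "Suc i < length b" "free (b ! i) (b ! Suc i)"
    using rew_square by (auto simp: allowed_append b_def)
  moreover have b: "std b" "length b \<le> n"
    using rew_square std_free_swps[of a u] by (auto simp: allowed_append b_def)
  ultimately show ?case
    using step_step[of i b "run u a x"] std_consecutive[OF b(1), of i] rew_square
    by (intro exI[of _ "1 + dd (b ! i) (b ! Suc i) * dd (b ! Suc i) (b ! i)"])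
      (auto simp: run_append run_scale b_def)
next
  case (rew_commute i j u w)
  define b where "b = swps u a"
  have b: "Suc i < length b" "Suc j < length b" "length b \<le> n"
    using rew_commute by (auto simp: allowed_append b_def)
  have "step j (swp i b) (step i b (run u a x)) = step i (swp j b) (step j b (run u a x))"
    using rew_commute(1) step_commute[of i j b "run u a x"] step_commute[of j i b "run u a x"] b by auto
  then show ?case
    using swp_commute[OF b(1,2) rew_commute(1)]
    by (intro exI[of _ 1]) (simp add: run_append flip: b_def)
next
  case (rew_braid j i u w)
  define b where "b = swps u a"
  have b: "std b" "length b \<le> n" "allowed free [i, j, i] b" "Suc i < length b" "Suc j < length b"
    using rew_braid std_free_swps[of a u] by (auto simp: allowed_append b_def)
  have "run [i, j, i] b (run u a x) = run [j, i, j] b (run u a x)"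
    using rew_braid(1)
  proof
    assume j: "j = Suc i"
    show ?thesis
      unfolding j by (rule step_braid) (use b j in \<open>auto simp: nth_swp\<close>)
  next
    assume i: "i = Suc j"
    show ?thesis
      unfolding i by (rule step_braid[symmetric]) (use b i in \<open>auto simp: nth_swp\<close>)
  qed
  moreover have "swps [i, j, i] b = swps [j, i, j] b"
    using swp_braid[OF b(4,5) rew_braid(1)] by simp
  ultimately have "run w (swps [i, j, i] b) (run [i, j, i] b (run u a x))
      = run w (swps [j, i, j] b) (run [j, i, j] b (run u a x))" by simp
  then have "run (u @ [i, j, i] @ w) a x = run (u @ [j, i, j] @ w) a x"
    unfolding run_append b_def .
  then show ?case by (intro exI[of _ 1]) simp
qed

lemma run_rews:
  assumes "rew\<^sup>*\<^sup>* w w'" "allowed free w a" "std a" "length a \<le> n"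
  shows "\<exists>c. c \<noteq> 0 \<and> run w a x = c *s run w' a x"
  using assms
proof (induction rule: converse_rtranclp_induct)
  case base
  show ?case by (intro exI[of _ 1]) simp
next
  case (step w w2)
  obtain c where "c \<noteq> 0" "run w a x = c *s run w2 a x"
    using run_rew[OF step.hyps(1) step.prems] by blast
  moreover obtain c' where "c' \<noteq> 0" "run w2 a x = c' *s run w' a x"
    using step.IH[OF allowed_rew[OF step.hyps(1) step.prems(1)] step.prems(2,3)] by blast
  ultimately show ?case by (intro exI[of _ "c * c'"]) simp
qed

lemma run_closed:
  assumes "allowed free w a" "std a" "length a \<le> n" "swps w a = a"
  shows "\<exists>c. c \<noteq> 0 \<and> run w a x = c *s x"
  using run_rews[OF closed_path_rews_Nil[OF assms(1) free_irrefl assms(4)] assms(1-3), of x] by simp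

lemma run_rev:
  assumes "allowed free w a" "std a" "length a \<le> n"
  shows "\<exists>c. c \<noteq> 0 \<and> run (rev w) (swps w a) (run w a x) = c *s x"
  using run_closed[of "w @ rev w" a x] allowed_rev[OF assms(1) free_sym] assms
  by (simp add: allowed_append run_append)

text \<open>Following \<open>w\<close> forwards and \<open>w'\<close> backwards is a closed path,
  which acts by a scalar.\<close>

lemma run_unique:
  assumes "allowed free w a" "allowed free w' a" "std a" "length a \<le> n" "swps w a = swps w' a"
  shows "\<exists>c. run w a x = c *s run w' a x"
proof -
  define b where "b = swps w' a"
  have rev': "allowed free (rev w') b" "swps (rev w') b = a"
    using allowed_rev[OF assms(2) free_sym] by (auto simp: b_def)
  have b: "std b" "length b \<le> n" using std_free_swps[OF assms(3,2)] assms(4)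
    by (simp_all add: b_def)
  obtain c where c: "run (rev w') b (run w a x) = c *s x"
    using run_closed[of "w @ rev w'" a x] assms rev' by (auto simp: allowed_append run_append b_def)
  obtain c' where "c' \<noteq> 0" "run w' a (run (rev w') b (run w a x)) = c' *s run w a x"
    using run_rev[OF rev'(1) b, of "run w a x"] rev'(2) by auto
  then have "run w a x = inverse c' *s (c *s run w' a x)"
    using c by (simp add: run_scale)
  then show ?thesis by (intro exI[of _ "inverse c' * c"]) simp
qed

section \<open>The submodule generated by a weight vector\<close>

definition orbit :: "'m label list \<Rightarrow> 'm label list set" where
  "orbit a = {swps w a | w. allowed free w a}"

text \<open>An arbitrary choice of path; by \<open>run_unique\<close> it affects the resulting
  vectors only up to scalars.\<close>

definition path_to :: "'m label list \<Rightarrow> 'm label list \<Rightarrow> nat list" where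
  "path_to a b = (SOME w. allowed free w a \<and> swps w a = b)"

definition path_vec :: "'m label list \<Rightarrow> 'v \<Rightarrow> 'm label list \<Rightarrow> 'v" where
  "path_vec a x b = run (path_to a b) a x"

definition cyclic :: "'m label list \<Rightarrow> 'v \<Rightarrow> 'v set" where
  "cyclic a x = span (path_vec a x ` orbit a)"

lemma path_to: "b \<in> orbit a \<Longrightarrow> allowed free (path_to a b) a \<and> swps (path_to a b) a = b"
  unfolding path_to_def orbit_def by (rule someI_ex) auto

lemma orbit_mset: "b \<in> orbit a \<Longrightarrow> mset b = mset a"
  using mset_swps by (auto simp: orbit_def)

lemma finite_orbit: "finite (orbit a)"
proof (rule finite_subset)
  show "orbit a \<subseteq> {b. set b \<subseteq> set a \<and> length b = length a}"
    using orbit_mset by (auto dest: mset_eq_setD simp: orbit_def)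
qed (rule finite_lists_length_eq[OF finite_set])

text \<open>The level is left open: \<open>m = n\<close> serves for the module itself,
  \<open>m = n - 1\<close> for the constituents of its restriction.\<close>

context
  fixes a x m
  assumes a: "std a" "length a = m" "m \<le> n" and x: "x \<in> wsp a"
begin

lemma orbit_std: "b \<in> orbit a \<Longrightarrow> std b \<and> length b = m"
  using std_free_swps[OF a(1)] a(2) by (auto simp: orbit_def)

lemma path_vec_wsp: "b \<in> orbit a \<Longrightarrow> path_vec a x b \<in> wsp b"
  using run_wsp[OF a(1), of "path_to a b" x] path_to[of b a] a(2,3) x by (simp add: path_vec_def)

lemma run_in_cyclic:
  assumes "allowed free w a" shows "run w a x \<in> cyclic a x"
proof -
  have b: "swps w a \<in> orbit a" using assms by (auto simp: orbit_def)
  obtain c where "run w a x = c *s path_vec a x (swps w a)"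
    using run_unique[OF assms, of "path_to a (swps w a)"] path_to[OF b] a
      by (auto simp: path_vec_def)
  then show ?thesis using b by (auto simp: cyclic_def intro: span_scale span_base)
qed

lemma generator_in_cyclic: "x \<in> cyclic a x"
  using run_in_cyclic[of "[]"] by simp

text \<open>On a weight vector \<open>T\<close> is a scalar by \<open>T_eigen\<close>;
  \<open>S i\<close> differs by a scalar from a step that prolongs the path, or is itself a scalar
  if the two labels are adjacent.\<close>

lemma cyclic_stable: "stable m (cyclic a x)"
  unfolding cyclic_def
proof (rule stable_span)
  let ?V = "path_vec a x ` orbit a"
  fix y assume m: "0 < m" and y: "y \<in> ?V"
  then obtain b where b: "b \<in> orbit a" "y = path_vec a x b" by auto
  obtain c r where "b = c # r" using m orbit_std[OF b(1)] by (cases b) auto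
  then have "y \<in> wsp [c]" using path_vec_wsp[OF b(1)] b(2) wsp_append[of y "[c]" r] by simp
  then obtain k where "T y = k *s y" using T_eigen m a(3) by (metis less_le_trans)
  then show "T y \<in> span (?V)" using y by (auto intro: span_scale span_base)
next
  let ?V = "path_vec a x ` orbit a"
  fix i y assume i: "Suc i < m" and y: "y \<in> ?V"
  then obtain b where b: "b \<in> orbit a" "y = path_vec a x b" by auto
  note std_b = orbit_std[OF b(1)]
  have ySp: "y \<in> span (?V)" using y by (rule span_base)
  show "S i y \<in> span (?V)"
  proof (cases "free (b ! i) (b ! Suc i)")
    case True
    have "step i b y = run (path_to a b @ [i]) a x"
      using path_to[OF b(1)] by (simp add: run_append b(2) path_vec_def)
    moreover have "allowed free (path_to a b @ [i]) a"
      using path_to[OF b(1)] True i std_b by (simp add: allowed_append)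
    ultimately have "step i b y \<in> span (?V)"
      using run_in_cyclic by (simp add: cyclic_def)
    from span_add[OF this span_scale[OF ySp, of "dd (b ! i) (b ! Suc i)"]]
    show ?thesis by (simp add: step_def)
  next
    case False
    then have "S i y = dd (b ! i) (b ! Suc i) *s y"
      using std_consecutive(3)[of b i y] std_b i a(3) path_vec_wsp[OF b(1)] b(2) by simp
    then show ?thesis using span_scale[OF ySp] by simp
  qed
qed

lemma cyclic_sumE:
  assumes "y \<in> cyclic a x"
  obtains f where "y = (\<Sum>b\<in>orbit a. f b *s path_vec a x b)"
proof -
  have "y \<in> span (\<Union>b\<in>orbit a. span {path_vec a x b})"
  proof -
    have "path_vec a x ` orbit a \<subseteq> (\<Union>b\<in>orbit a. span {path_vec a x b})"
      by (auto intro: span_base)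
    from subsetD[OF span_mono[OF this]] show ?thesis using assms by (simp add: cyclic_def)
  qed
  then obtain D f where D: "finite D" "D \<subseteq> orbit a" "\<And>b. b \<in> D \<Longrightarrow> f b \<in> span {path_vec a x b}"
    "y = (\<Sum>b\<in>D. f b)"
    by (rule span_UN_sumE) auto
  have "\<exists>k. f b = k *s path_vec a x b" if "b \<in> D" for b
    using D(3)[OF that] by (auto simp: span_singleton)
  then obtain k where k: "\<And>b. b \<in> D \<Longrightarrow> f b = k b *s path_vec a x b" by metis
  have "y = (\<Sum>b\<in>orbit a. (if b \<in> D then k b else 0) *s path_vec a x b)"
    unfolding D(4) by (rule sum.mono_neutral_cong_left) (use D(2) k finite_orbit in auto)
  then show ?thesis by (rule that)
qed

text \<open>A nonzero submodule contains a nonzero weight component of one of its vectors, hence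
  some path vector; the reversed path leads back to a nonzero multiple of \<open>x\<close>.\<close>

lemma cyclic_irreducible:
  assumes U: "stable m U" "U \<subseteq> cyclic a x" "U \<noteq> {0}"
  shows "U = cyclic a x"
proof -
  note sub = stable_subspace[OF U(1)]
  obtain y where y: "y \<in> U" "y \<noteq> 0" using U(3) subspace_0[OF sub] by auto
  obtain f where f: "y = (\<Sum>b\<in>orbit a. f b *s path_vec a x b)"
    using cyclic_sumE[of y] U(2) y(1) by auto
  obtain b where b: "b \<in> orbit a" "f b *s path_vec a x b \<noteq> 0"
    using y(2) unfolding f by (meson sum.neutral)
  have "f b *s path_vec a x b \<in> U"
  proof (rule std_wsp_components[OF finite_orbit a(3) sub, where f = "\<lambda>b. f b *s path_vec a x b"])
    show "(\<Sum>b\<in>orbit a. f b *s path_vec a x b) \<in> U" using y(1) f by simp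
    show "std b \<and> length b = m \<and> f b *s path_vec a x b \<in> wsp b" if "b \<in> orbit a" for b
      using orbit_std[OF that] path_vec_wsp[OF that] subspace_scale[OF subspace_wsp] by blast
  qed (use b(1) Y_stable[OF a(3) U(1)] in blast)+
  then have "inverse (f b) *s f b *s path_vec a x b \<in> U" by (rule subspace_scale[OF sub])
  then have "path_vec a x b \<in> U" using b(2) by auto
  then have "run (rev (path_to a b)) b (path_vec a x b) \<in> U"
    using orbit_std[OF b(1)] path_to[OF b(1)] allowed_rev[of free "path_to a b" a] free_sym
    by (intro run_stable[OF U(1)]) auto
  moreover obtain c where c: "c \<noteq> 0" "run (rev (path_to a b)) b (path_vec a x b) = c *s x"
    using run_rev[of "path_to a b" a x] path_to[OF b(1)] a by (auto simp: path_vec_def)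
  ultimately have "inverse c *s c *s x \<in> U" using subspace_scale[OF sub] by metis
  then have "x \<in> U" using c(1) by simp
  then have "path_vec a x ` orbit a \<subseteq> U"
    using run_stable[OF U(1) a(2)] path_to by (auto simp: path_vec_def)
  then have "cyclic a x \<subseteq> U" unfolding cyclic_def using sub by (rule span_minimal)
  then show ?thesis using U(2) by auto
qed

lemma cyclic_weight_space:
  assumes "y \<in> cyclic a x" "y \<in> wsp b" "y \<noteq> 0" "std b" "length b = m"
  shows "b \<in> orbit a" "\<exists>k. y = k *s path_vec a x b"
proof -
  obtain f where f: "y = (\<Sum>b\<in>orbit a. f b *s path_vec a x b)" using cyclic_sumE[OF assms(1)] .
  \<comment> \<open>The weight components of the expansion of \<open>y\<close> minus
    \<open>y\<close> itself, the latter counted at \<open>b\<close>. They add up to 0, so the one at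
    \<open>b\<close> vanishes; the case distinction covers \<open>b\<close> outside the
    orbit.\<close>
  define g where "g c = (if c \<in> orbit a then f c *s path_vec a x c else 0) - (if c = b then y else 0)" for c
  have "(\<Sum>c\<in>insert b (orbit a). if c \<in> orbit a then f c *s path_vec a x c else 0) = y"
    unfolding f by (rule sum.mono_neutral_cong_right) (use finite_orbit in auto)
  then have g0: "sum g (insert b (orbit a)) = 0"
    using finite_orbit by (simp add: g_def sum_subtractf)
  have g_wsp: "g c \<in> wsp c" if "c \<in> insert b (orbit a)" for c
    unfolding g_def using that assms(2) path_vec_wsp subspace_wsp
    by (auto intro!: subspace_diff subspace_neg subspace_scale subspace_0)
  have "g b \<in> {0}"
    by (rule std_wsp_components[where D = "insert b (orbit a)" and m = m])
      (use a(3) g0 g_wsp orbit_std assms(4,5) in \<open>auto simp: finite_orbit lin_zero[OF lin_Y]\<close>)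
  then show "b \<in> orbit a" "\<exists>k. y = k *s path_vec a x b"
    using assms(3) by (auto simp: g_def split: if_splits)
qed

end

section \<open>The restriction of an irreducible module\<close>

context
  assumes n: "0 < n" and nonzero: "\<exists>x::'v. x \<noteq> 0"
    and irreducible: "\<And>U. stable n U \<Longrightarrow> U = {0} \<or> U = UNIV"
begin

lemma whole_space_cyclic:
  obtains a x where "std a" "length a = n" "x \<in> wsp a" "cyclic a x = UNIV"
proof -
  have "stable n UNIV" by (simp add: stable_def)
  moreover have "(UNIV :: 'v set) \<noteq> {0}" using nonzero by auto
  ultimately obtain a x where a: "std a" "length a = n" "x \<in> wsp a" "x \<noteq> 0"
    using stable_weight_vector by blast
  have "cyclic a x = UNIV"
    using irreducible[OF cyclic_stable[OF a(1,2) _ a(3)]] generator_in_cyclic[OF a(1,2) _ a(3)] a(4) by auto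
  then show ?thesis using that a by blast
qed

text \<open>A path vector is also a weight vector for its list without the last label, and if
  nonzero generates an irreducible submodule at level \<open>n - 1\<close>. These submodules need
  not be independent; that is left to \<open>direct_subfamily\<close>.\<close>

lemma restriction_semisimple:
  "\<exists>F. finite F \<and> span (\<Union>F) = UNIV \<and>
    (\<forall>W\<in>F. irred (n - 1) W)"
proof -
  obtain a x where a: "std a" "length a = n" "x \<in> wsp a" "cyclic a x = UNIV"
    by (rule whole_space_cyclic)
  define B where "B = {b \<in> orbit a. path_vec a x b \<noteq> 0}"
  define W where "W b = cyclic (take (n - 1) b) (path_vec a x b)" for b
  have b: "std (take (n - 1) b)" "length (take (n - 1) b) = n - 1" "n - 1 \<le> n"
    "path_vec a x b \<in> wsp (take (n - 1) b)" if "b \<in> orbit a" for b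
    using orbit_std[OF a(1,2) _ a(3) that] path_vec_wsp[OF a(1,2) _ a(3) that]
      std_append[of "take (n - 1) b" "drop (n - 1) b"]
      wsp_append[of _ "take (n - 1) b" "drop (n - 1) b"] by auto
  have W: "stable (n - 1) (W b)" "W b \<noteq> {0}"
    "\<And>U. stable (n - 1) U \<Longrightarrow> U \<subseteq> W b \<Longrightarrow> U = {0} \<or> U = W b" "path_vec a x b \<in> W b" if "b \<in> B" for b
  proof -
    have bo: "b \<in> orbit a" "path_vec a x b \<noteq> 0" using that by (auto simp: B_def)
    show "stable (n - 1) (W b)" "path_vec a x b \<in> W b"
      using cyclic_stable generator_in_cyclic b[OF bo(1)] by (simp_all add: W_def)
    then show "W b \<noteq> {0}" using bo(2) by auto
    show "U = {0} \<or> U = W b" if "stable (n - 1) U" "U \<subseteq> W b" for U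
      using cyclic_irreducible[OF b[OF bo(1)]] that by (auto simp: W_def)
  qed
  have "path_vec a x b \<in> span (\<Union>(W ` B))" if "b \<in> orbit a" for b
    using W(4)[of b] that by (cases "b \<in> B") (auto simp: B_def span_zero intro: span_base)
  then have "cyclic a x \<subseteq> span (\<Union>(W ` B))"
    unfolding cyclic_def by (intro span_minimal) auto
  then have "span (\<Union>(W ` B)) = UNIV" using a(4) by auto
  moreover have "finite (W ` B)" using finite_orbit by (simp add: B_def)
  ultimately show ?thesis using W(1-3) by (intro exI[of _ "W ` B"]) auto
qed

lemma restricted_weight_space:
  assumes "std b" "length b = n - 1" "y \<in> wsp b" "z \<in> wsp b" "y \<noteq> 0" "z \<noteq> 0"
  shows "\<exists>k. y = k *s z"
proof -
  obtain a x where a: "std a" "length a = n" "x \<in> wsp a" "cyclic a x = UNIV"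
    by (rule whole_space_cyclic)
  have last: "\<exists>d. y \<in> wsp (b @ [d]) \<and> b @ [d] \<in> orbit a" if y: "y \<in> wsp b" "y \<noteq> 0" for y
  proof -
    have br: "branches b" using all_branches[OF assms(1)] assms(2) n by simp
    obtain D f where D: "finite D" "\<And>d. d \<in> D \<Longrightarrow> addable b d \<and> f d \<in> wsp (b @ [d])" "y = (\<Sum>d\<in>D. f d)"
      by (rule branches_sumE[OF br y(1)]) blast
    have orb: "b @ [d] \<in> orbit a" if "d \<in> D" "f d \<noteq> 0" for d
      using cyclic_weight_space(1)[OF a(1,2) _ a(3), of "f d" "b @ [d]"] a(4) D(2)[OF that(1)] that(2)
        assms(1,2) n std_snoc by auto
    obtain d where d: "d \<in> D" "f d \<noteq> 0" using y(2) unfolding D(3) by (meson sum.neutral)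
    have "e = d" if "e \<in> D" "f e \<noteq> 0" for e
    proof -
      \<comment> \<open>The multiset of labels is constant on the orbit, and \<open>b\<close>
        accounts for all labels but the last.\<close>
      have "mset (b @ [e]) = mset (b @ [d])"
        using orbit_mset[OF orb[OF that]] orbit_mset[OF orb[OF d]] by simp
      then show ?thesis by simp
    qed
    then have "sum f D = f d"
      using D(1) d(1) by (subst sum.remove[of D d]) (auto intro!: sum.neutral)
    then show ?thesis using D(2)[OF d(1)] D(3) orb[OF d] by (intro exI[of _ d]) simp
  qed
  obtain d where d: "y \<in> wsp (b @ [d])" "b @ [d] \<in> orbit a" using last[OF assms(3,5)] by blast
  obtain e where e: "z \<in> wsp (b @ [e])" "b @ [e] \<in> orbit a" using last[OF assms(4,6)] by blast
  have "mset (b @ [e]) = mset (b @ [d])" using orbit_mset[OF d(2)] orbit_mset[OF e(2)] by simp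
  then have "e = d" by simp
  have std_bd: "std (b @ [d])" "length (b @ [d]) = n"
    using orbit_std[OF a(1,2) _ a(3) d(2)] by auto
  obtain k where k: "y = k *s path_vec a x (b @ [d])"
    using cyclic_weight_space(2)[OF a(1,2) _ a(3), of y "b @ [d]"] a(4) d assms(5) std_bd by auto
  obtain l where l: "z = l *s path_vec a x (b @ [d])"
    using cyclic_weight_space(2)[OF a(1,2) _ a(3), of z "b @ [d]"] a(4) e \<open>e = d\<close> assms(6) std_bd by auto
  have "y = (k / l) *s z" using assms(6) unfolding k l by auto
  then show ?thesis by blast
qed

text \<open>The graph of an isomorphism between two independent summands is again a submodule; a weight
  vector of it has two linearly independent components of the same weight.\<close>

lemma restriction_no_isomorphism:
  assumes W: "stable (n - 1) W" "stable (n - 1) W'" "W \<inter> W' = {0}" "W \<noteq> {0}"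
    and g: "\<And>x. x \<in> W \<Longrightarrow> g x \<in> W'" "\<And>x y. x \<in> W \<Longrightarrow> y \<in> W \<Longrightarrow> g (x + y) = g x + g y"
      "\<And>c x. x \<in> W \<Longrightarrow> g (c *s x) = c *s g x"
      "\<And>x. x \<in> W \<Longrightarrow> g x = 0 \<Longrightarrow> x = 0"
      "\<And>x. 1 < n \<Longrightarrow> x \<in> W \<Longrightarrow> g (T x) = T (g x)"
      "\<And>i x. Suc (Suc i) < n \<Longrightarrow> x \<in> W \<Longrightarrow> g (S i x) = S i (g x)"
  shows False
proof -
  let ?D = "{x + g x | x. x \<in> W}"
  note sub = stable_subspace[OF W(1)] stable_subspace[OF W(2)]
  have g0: "g 0 = 0" using g(3)[of 0 0] subspace_0[OF sub(1)] by simp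
  have "stable (n - 1) ?D"
    unfolding stable_def subspace_def
  proof (intro conjI allI impI ballI)
    show "0 \<in> ?D" using subspace_0[OF sub(1)] g0
      by (intro CollectI exI[of _ "0 :: 'v"] conjI) simp_all
    show "x + y \<in> ?D" if xy: "x \<in> ?D" "y \<in> ?D" for x y
    proof -
      obtain x' y' where "x = x' + g x'" "y = y' + g y'" "x' \<in> W" "y' \<in> W" using xy by auto
      then show ?thesis using subspace_add[OF sub(1)] g(2)
        by (intro CollectI exI[of _ "x' + y'"]) (simp add: algebra_simps)
    qed
    show "c *s x \<in> ?D" if x: "x \<in> ?D" for c x
    proof -
      obtain x' where "x = x' + g x'" "x' \<in> W" using x by auto
      then show ?thesis using subspace_scale[OF sub(1)] g(3)
        by (intro CollectI exI[of _ "c *s x'"]) (simp add: scale_right_distrib)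
    qed
    show "T x \<in> ?D" if m: "0 < n - 1" and x: "x \<in> ?D" for x
    proof -
      obtain x' where "x = x' + g x'" "x' \<in> W" using x by auto
      then show ?thesis using W(1) m g(5)[of x']
        by (intro CollectI exI[of _ "T x'"]) (auto simp: lin_add[OF lin_T] stable_def)
    qed
    show "S i x \<in> ?D" if m: "Suc i < n - 1" and x: "x \<in> ?D" for i x
    proof -
      obtain x' where "x = x' + g x'" "x' \<in> W" using x by auto
      then show ?thesis using W(1) m g(6)[of i x']
        by (intro CollectI exI[of _ "S i x'"]) (auto simp: lin_add[OF lin_S] stable_def)
    qed
  qed
  moreover have D_nonzero: "?D \<noteq> {0}"
  proof
    assume D: "?D = {0}"
    obtain x where x: "x \<in> W" "x \<noteq> 0" using W(4) subspace_0[OF sub(1)] by auto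
    then have "x = - g x" using D by (auto simp: eq_neg_iff_add_eq_0)
    then have "x \<in> W'" using g(1)[OF x(1)] subspace_neg[OF sub(2)] by metis
    then show False using x W(3) by auto
  qed
  ultimately obtain a z where a: "std a" "length a = n - 1" "z \<in> wsp a" "z \<in> ?D" "z \<noteq> 0"
    by (rule stable_weight_vector[OF _ diff_le_self]) (use D_nonzero in blast)+
  obtain x where x: "x \<in> W" "z = x + g x" using a(4) by auto
  have "x \<noteq> 0" using a(5) x(2) g0 by auto
  have "Y \<kappa> i x = val \<kappa> (a ! i) *s x \<and> Y \<kappa> i (g x) = val \<kappa> (a ! i) *s g x" if i: "i < length a" for \<kappa> i
  proof -
    \<comment> \<open>The operator \<open>Y \<kappa> i - val \<kappa> (a ! i)\<close> kills
      \<open>z\<close>, and the parts of the result in \<open>W\<close> and \<open>W'\<close> must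
      vanish separately.\<close>
    let ?u = "Y \<kappa> i x - val \<kappa> (a ! i) *s x" and ?v = "Y \<kappa> i (g x) - val \<kappa> (a ! i) *s g x"
    have "?u \<in> W" "?v \<in> W'"
      using i a(2) x(1) g(1) sub
        Y_stable[OF _ W(1), of i x \<kappa>] Y_stable[OF _ W(2), of i "g x" \<kappa>]
      by (auto intro!: subspace_diff subspace_scale)
    moreover have "?u = - ?v"
      using a(3) i by (simp add: wsp_def x(2) lin_add[OF lin_Y] scale_right_distrib algebra_simps)
    moreover have "- ?v \<in> W'" using \<open>?v \<in> W'\<close> by (rule subspace_neg[OF sub(2)])
    ultimately have "?u \<in> W \<inter> W'" by simp
    then have "?u = 0" using W(3) by auto
    then show ?thesis using \<open>?u = - ?v\<close> by simp
  qed
  then have "x \<in> wsp a" "g x \<in> wsp a" by (simp_all add: wsp_def)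
  moreover have "g x \<noteq> 0" using g(4) x(1) \<open>x \<noteq> 0\<close> by blast
  ultimately obtain k where "x = k *s g x"
    using restricted_weight_space[OF a(1,2)] \<open>x \<noteq> 0\<close> by blast
  then have "x \<in> W'" using g(1)[OF x(1)] subspace_scale[OF sub(2)] by metis
  then show False using x(1) W(3) \<open>x \<noteq> 0\<close> by auto
qed

end

end

section \<open>The case of \<open>q\<^sup>2\<close> not a root of unity of small order\<close>

locale hecke_module = vspace scale
  for scale :: "'k::field \<Rightarrow> 'v::ab_group_add \<Rightarrow> 'v" (infixr "*s" 75) +
  fixes q :: 'k and v :: "'m::{finite,linorder} \<Rightarrow> 'k" and n :: nat
    and T :: "'v \<Rightarrow> 'v" and S :: "nat \<Rightarrow> 'v \<Rightarrow> 'v"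
  assumes lin_T: "lin T" and lin_S: "lin (S i)"
    and S_square: "Suc i < n \<Longrightarrow> S i (S i x) = (q - inverse q) *s S i x + x"
    and S_commute: "Suc i < j \<Longrightarrow> Suc j < n \<Longrightarrow> S i (S j x) = S j (S i x)"
    and S_braid: "Suc (Suc i) < n \<Longrightarrow> S i (S (Suc i) (S i x)) = S (Suc i) (S i (S (Suc i) x))"
    and T_S_braid: "1 < n \<Longrightarrow> T (S 0 (T (S 0 x))) = S 0 (T (S 0 (T x)))"
    and T_S_commute: "0 < i \<Longrightarrow> Suc i < n \<Longrightarrow> T (S i x) = S i (T x)"
    and T_poly: "0 < n \<Longrightarrow> poly_op T v (sorted_list_of_set UNIV) x = 0"
    and inj_v: "inj v"
begin

lemma S_commute': "Suc i < j \<or> Suc j < i \<Longrightarrow> Suc i < n \<Longrightarrow> Suc j < n \<Longrightarrow> S i (S j x) = S j (S i x)"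
  using S_commute[of i j x] S_commute[of j i x] by auto

lemma T_diag: "0 < n \<Longrightarrow> x \<in> span (\<Union>j. {x. T x = v j *s x})"
  using poly_op_zero_diag[OF lin_T inj_v distinct_sorted_list_of_set T_poly, of x] by simp

text \<open>For \<open>A = T\<close> these are the multiplicative Jucys--Murphy elements. The base
  operator is a parameter because the case \<open>q\<^sup>2 = 1\<close> conjugates the idempotents
  of \<open>T\<close> in the same way.\<close>

fun jm :: "('v \<Rightarrow> 'v) \<Rightarrow> nat \<Rightarrow> 'v \<Rightarrow> 'v" where
  "jm A 0 x = A x"
| "jm A (Suc i) x = S i (jm A i (S i x))"

lemma lin_jm: "lin A \<Longrightarrow> lin (jm A i)"
  by (induction i) (auto simp: lin_iff lin_simps[OF lin_S])

lemma jm_closed: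
  "(\<And>x. x \<in> U \<Longrightarrow> A x \<in> U) \<Longrightarrow> (\<And>j x. Suc j < m \<Longrightarrow> x \<in> U \<Longrightarrow> S j x \<in> U) \<Longrightarrow> i < m \<Longrightarrow> x \<in> U \<Longrightarrow>
    jm A i x \<in> U"
  by (induction i arbitrary: x) auto

lemma jm_S_commute:
  assumes "\<And>l x. 0 < l \<Longrightarrow> Suc l < n \<Longrightarrow> A (S l x) = S l (A x)"
    and "i < n" "Suc l < n" "i \<noteq> l" "i \<noteq> Suc l"
  shows "jm A i (S l x) = S l (jm A i x)"
  using assms(2-)
proof (induction i arbitrary: l x rule: less_induct)
  case (less i)
  show ?case
  proof (cases i)
    case 0
    then show ?thesis using assms(1) less.prems by simp
  next
    case (Suc k)
    show ?thesis
    proof (cases "Suc l = k")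
      case False
      then have "Suc k < l \<or> Suc l < k" using less.prems Suc by auto
      then have "S k (S l z) = S l (S k z)" "jm A k (S l z) = S l (jm A k z)" for z
        using less Suc S_commute'[of k l] by auto
      then show ?thesis by (simp add: Suc)
    next
      case True
      \<comment> \<open>Here \<open>i = l + 2\<close>: a braid relation turns the entering
        \<open>S l\<close> into \<open>S (Suc l)\<close>, which commutes with \<open>jm A l\<close>
        and becomes \<open>S l\<close> again on the other side.\<close>
      have A: "jm A l (S (Suc l) z) = S (Suc l) (jm A l z)" for z
        using less Suc True by auto
      have i: "i = Suc (Suc l)" "Suc (Suc l) < n" using Suc True less.prems by auto
      have "jm A i (S l x) = S (Suc l) (S l (jm A l (S l (S (Suc l) (S l x)))))"
        by (simp add: i(1))
      also have "\<dots> = S (Suc l) (S l (S (Suc l) (jm A l (S l (S (Suc l) x)))))"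
        by (simp add: A S_braid[OF i(2)])
      also have "\<dots> = S l (jm A i x)"
        by (simp add: i(1) S_braid[OF i(2), symmetric])
      finally show ?thesis .
    qed
  qed
qed

text \<open>For \<open>i = 0\<close> the hypothesis \<open>AB\<close>, of the form of the type B
  braid relation, propagates along \<open>l\<close>; for larger \<open>i\<close> the generators that
  conjugate \<open>A\<close> commute with \<open>jm B l\<close>.\<close>

lemma jm_jm_commute:
  assumes A: "\<And>l x. 0 < l \<Longrightarrow> Suc l < n \<Longrightarrow> A (S l x) = S l (A x)"
    and B: "\<And>l x. 0 < l \<Longrightarrow> Suc l < n \<Longrightarrow> B (S l x) = S l (B x)"
    and AB: "\<And>x. 1 < n \<Longrightarrow> A (S 0 (B (S 0 x))) = S 0 (B (S 0 (A x)))"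
  shows "i < l \<Longrightarrow> l < n \<Longrightarrow> jm A i (jm B l x) = jm B l (jm A i x)"
proof (induction i arbitrary: l x)
  case 0
  then show ?case
  proof (induction l arbitrary: x)
    case (Suc l)
    then show ?case using AB A by (cases "l = 0") auto
  qed simp
next
  case (Suc i)
  have S: "jm B l (S i x) = S i (jm B l x)" for x
    using jm_S_commute[OF B, of l i x] Suc.prems by simp
  show ?case using Suc.IH[of l] Suc.prems by (simp add: S[symmetric])
qed

end

locale q_module = hecke_module scale q v n T S
  for scale :: "'k::field \<Rightarrow> 'v::ab_group_add \<Rightarrow> 'v" (infixr "*s" 75)
    and q and v :: "'m::{finite,linorder} \<Rightarrow> 'k" and n T S +
  assumes q_nz: "q \<noteq> 0" and v_nz: "v j \<noteq> 0"
    and q_root: "0 < i \<Longrightarrow> i \<le> n \<Longrightarrow> q ^ (2 * i) \<noteq> 1"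
    and q_v: "j \<noteq> j' \<Longrightarrow> - int n < e \<Longrightarrow> e < int n \<Longrightarrow> q powi (2 * e) * v j \<noteq> v j'"
begin

abbreviation "t \<equiv> q - inverse q"

definition cval :: "'m label \<Rightarrow> 'k" where
  "cval c = q powi (2 * snd c) * v (fst c)"

text \<open>The solution \<open>k\<close> of \<open>k * (cval d - cval c) = t * cval d\<close>,
  which is what \<open>jm_exchange\<close> requires for \<open>S i x - k *s x\<close> to have the
  exchanged eigenvalues.\<close>

definition cdd :: "'m label \<Rightarrow> 'm label \<Rightarrow> 'k" where
  "cdd c d = t * cval d / (cval d - cval c)"

definition csep :: "'m label \<Rightarrow> 'm label \<Rightarrow> bool" where
  "csep c d \<longleftrightarrow> cval c \<noteq> cval d"

lemma cval_nz: "cval c \<noteq> 0"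
  by (simp add: cval_def q_nz v_nz)

lemma cval_up: "cval (up c) = q\<^sup>2 * cval c" and cval_dn: "cval c = q\<^sup>2 * cval (dn c)"
proof -
  show *: "cval (up c) = q\<^sup>2 * cval c" for c
    by (simp add: cval_def up_def distrib_left power_int_add q_nz)
  show "cval c = q\<^sup>2 * cval (dn c)" using *[of "dn c"] by simp
qed

lemma q_powi_root: "\<bar>e\<bar> \<le> int n \<Longrightarrow> q powi (2 * e) = 1 \<Longrightarrow> e = 0"
proof (rule ccontr)
  assume e: "\<bar>e\<bar> \<le> int n" "q powi (2 * e) = 1" "e \<noteq> 0"
  have "q ^ (2 * nat \<bar>e\<bar>) = q powi (2 * \<bar>e\<bar>)"
    by (simp add: power_int_def nat_mult_distrib)
  also have "\<dots> = 1"
    using e(2) by (auto simp: abs_if power_int_minus)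
  finally show False using q_root[of "nat \<bar>e\<bar>"] e by auto
qed

lemma cval_eqD:
  assumes "cval c = cval d" "fst c = fst d \<Longrightarrow> \<bar>snd c - snd d\<bar> \<le> int n"
    "fst c \<noteq> fst d \<Longrightarrow> \<bar>snd c - snd d\<bar> < int n"
  shows "c = d"
proof -
  have *: "q powi (2 * (snd c - snd d)) * v (fst c) = v (fst d)"
    using assms(1) q_nz by (simp add: cval_def right_diff_distrib power_int_diff field_simps)
  show ?thesis
  proof (cases "fst c = fst d")
    case True
    then have "snd c - snd d = 0" using * v_nz assms(2) by (intro q_powi_root) auto
    then show ?thesis using True by (simp add: prod_eq_iff)
  next
    case False
    then have "- int n < snd c - snd d" "snd c - snd d < int n" using assms(3) by auto
    then show ?thesis using * q_v[OF False] by blast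
  qed
qed

lemma csep_addable: "std p \<Longrightarrow> length p < n \<Longrightarrow> addable p c \<Longrightarrow> addable p d \<Longrightarrow> c \<noteq> d \<Longrightarrow> csep c d"
  using cval_eqD[of c d] addable_same_bound[of p "fst c" "snd c" "snd d"]
    addable_diff_bound[of p "fst c" "snd c" "fst d" "snd d"]
  by (force simp: csep_def)

text \<open>Passing to a neighbour costs one unit in the bounds on contents, for which
  \<open>Suc (length p) < n\<close> leaves room.\<close>

lemma csep_adj:
  assumes "std p" "Suc (length p) < n" "addable p c" "addable p d" "adj c e"
  shows "csep e d"
proof -
  have "e \<noteq> d" using addable_not_adj assms by blast
  moreover have e: "fst e = fst c" "\<bar>snd e - snd c\<bar> = 1"
    using assms(5) by (auto simp: adj_def up_def dn_def)
  have "fst c = fst d \<Longrightarrow> \<bar>snd c - snd d\<bar> \<le> int (length p) + 1"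
    using addable_same_bound[of p "fst c" "snd c" "snd d"] assms by (cases d) auto
  moreover have "fst c \<noteq> fst d \<Longrightarrow> \<bar>snd c - snd d\<bar> \<le> int (length p)"
    using addable_diff_bound[of p "fst c" "snd c" "fst d" "snd d"] assms by auto
  ultimately have "cval e = cval d \<Longrightarrow> e = d"
    using cval_eqD[of e d] e(2) assms(2) unfolding e(1) by linarith
  then show ?thesis using \<open>e \<noteq> d\<close> by (auto simp: csep_def)
qed

lemma q4: "1 < n \<Longrightarrow> q ^ 4 \<noteq> 1" and q2: "0 < n \<Longrightarrow> q\<^sup>2 \<noteq> 1"
  using q_root[of 2] q_root[of 1] by auto

lemma t_eq: "t = (q\<^sup>2 - 1) / q"
  using q_nz by (simp add: field_simps power2_eq_square)

lemma cdd_sum: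
  assumes "csep c d" shows "cdd c d + cdd d c = t"
proof -
  have "cdd c d + cdd d c = (t * cval d - t * cval c) / (cval d - cval c)"
    using assms by (simp add: cdd_def csep_def diff_divide_distrib divide_minus_right[symmetric] del: divide_minus_right)
  also have "\<dots> = t" using assms by (simp add: csep_def flip: right_diff_distrib)
  finally show ?thesis .
qed

lemma cdd_braid:
  assumes "csep a b" "csep b c" "csep a c"
  shows "cdd a c * (cdd a b + cdd b c - t) = cdd a b * cdd b c"
proof -
  define x y z where "x = cval a" and "y = cval b" and "z = cval c"
  have nz: "y - x \<noteq> 0" "z - y \<noteq> 0" "z - x \<noteq> 0"
    using assms by (auto simp: csep_def x_def y_def z_def)
  have "t * y / (y - x) + t * z / (z - y) - t = t * y * (z - x) / ((y - x) * (z - y))"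
    using nz by (simp add: divide_simps) (simp add: algebra_simps)
  then show ?thesis
    using nz by (simp add: cdd_def power2_eq_square mult_ac flip: x_def y_def z_def)
qed

text \<open>A factor vanishes when one eigenvalue is \<open>q\<^sup>2\<close> times the other, hence
  equals that of a neighbouring label; \<open>cdd_free\<close> excludes this by
  \<open>csep_adj\<close>.\<close>

lemma cdd_prod:
  assumes "csep c d"
  shows "1 + cdd c d * cdd d c = (cval d - q\<^sup>2 * cval c) * (q\<^sup>2 * cval d - cval c) / (q\<^sup>2 * (cval d - cval c)\<^sup>2)"
proof -
  define x y where "x = cval c" and "y = cval d"
  have nz: "y - x \<noteq> 0" "x - y \<noteq> 0" using assms by (auto simp: csep_def x_def y_def)
  have "(t * y / (y - x)) * (t * x / (x - y)) = - (t\<^sup>2 * x * y) / (y - x)\<^sup>2"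
    using nz by (simp add: divide_simps power2_eq_square) (simp add: algebra_simps)
  then have "1 + cdd c d * cdd d c = ((y - x)\<^sup>2 - t\<^sup>2 * x * y) / (y - x)\<^sup>2"
    using nz by (simp add: cdd_def diff_divide_distrib flip: x_def y_def)
  also have "(y - x)\<^sup>2 - t\<^sup>2 * x * y = (y - q\<^sup>2 * x) * (q\<^sup>2 * y - x) / q\<^sup>2"
    using q_nz by (simp add: t_eq divide_simps power2_eq_square) (simp add: algebra_simps)
  finally show ?thesis by (simp add: x_def y_def)
qed

lemma cdd_free:
  assumes "std p" "Suc (length p) < n" "addable p c" "addable p d" "c \<noteq> d"
  shows "cdd c d * cdd d c \<noteq> - 1"
proof
  assume *: "cdd c d * cdd d c = - 1"
  have sep: "csep c d" using csep_addable assms by auto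
  have "cval d = q\<^sup>2 * cval c \<or> q\<^sup>2 * cval d = cval c"
    using cdd_prod[OF sep] sep q_nz by (simp add: * csep_def)
  then have "cval (up c) = cval d \<or> cval (up d) = cval c" by (auto simp: cval_up)
  moreover have "csep (up c) d" "csep (up d) c"
    using csep_adj[OF assms(1-4), of "up c"] csep_adj[OF assms(1,2,4,3), of "up d"]
      by (auto simp: adj_def)
  ultimately show False by (auto simp: csep_def)
qed

lemma cdd_adj:
  assumes "1 < n" "adj c d"
  shows "cdd c d * cdd d c = - 1" "cdd c d \<noteq> cdd d c"
proof -
  \<comment> \<open>The two values are the roots of the quadratic relation of a generator; they
    coincide only for \<open>q\<^sup>2 = - 1\<close>, which \<open>q4\<close> excludes.\<close>
  have *: "cdd c (up c) = q \<and> cdd (up c) c = - inverse q" for c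
  proof -
    have "q\<^sup>2 - 1 \<noteq> 0" using q2 assms(1) by auto
    moreover have "cval (up c) - cval c = (q\<^sup>2 - 1) * cval c" by (simp add: cval_up algebra_simps)
    moreover have "cval c - cval (up c) = - ((q\<^sup>2 - 1) * cval c)"
      by (simp add: cval_up algebra_simps)
    ultimately show ?thesis
      using q_nz cval_nz[of c]
      by (simp add: cdd_def t_eq cval_up power2_eq_square field_simps)
  qed
  have "q \<noteq> - inverse q"
  proof
    assume "q = - inverse q"
    then have "q * q = - 1" using q_nz by (simp add: field_simps)
    then have "q ^ 4 = 1" by (simp add: eval_nat_numeral flip: mult.assoc)
    then show False using q4 assms(1) by simp
  qed
  then show "cdd c d * cdd d c = - 1" "cdd c d \<noteq> cdd d c"
    using assms(2) *[of c] *[of d] q_nz by (auto simp: adj_def up_eq_iff[symmetric])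
qed

lemma jm_T_commute: "i < n \<Longrightarrow> l < n \<Longrightarrow> jm T i (jm T l x) = jm T l (jm T i x)"
  using jm_jm_commute[of T T i l x] jm_jm_commute[of T T l i x] T_S_commute T_S_braid
  by (cases i l rule: linorder_cases) auto

lemma gt_base: "gt_base scale n t T S (\<lambda>_::unit. jm T)"
proof (intro gt_base.intro gt_base_axioms.intro)
  show "jm T i (S j x) = S j (jm T i x)" if "i < n" "Suc j < n" "i \<noteq> j" "i \<noteq> Suc j" for i j x
    using jm_S_commute[of T i j x] T_S_commute that by auto
qed (use vspace_axioms lin_T lin_S lin_jm S_square S_commute S_braid jm_T_commute in auto)

interpretation G: gt_base scale n t T S "\<lambda>_::unit. jm T" "\<lambda>_. cval" by (rule gt_base)

lemma jm_exchange:
  assumes "Suc i < n"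
  shows "jm T i (S i x) = S i (jm T (Suc i) x) - t *s jm T (Suc i) x"
    and "jm T (Suc i) (S i x) = S i (jm T i x) + t *s jm T (Suc i) x"
  using S_square[OF assms] by (simp_all add: lin_simps[OF lin_S] lin_simps[OF lin_jm[OF lin_T]])

declare jm.simps(2) [simp del]

lemma intertwine:
  assumes "Suc i < n" "csep c d" "jm T i x = cval c *s x" "jm T (Suc i) x = cval d *s x"
  shows "jm T i (S i x - cdd c d *s x) = cval d *s (S i x - cdd c d *s x) \<and>
    jm T (Suc i) (S i x - cdd c d *s x) = cval c *s (S i x - cdd c d *s x)"
proof -
  note lin = lin_simps[OF lin_jm[OF lin_T]] lin_simps[OF lin_S]
  define k where "k = cdd c d"
  have k: "k * cval d = t * cval d + k * cval c"
  proof -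
    have "k * (cval d - cval c) = t * cval d" using assms(2) by (simp add: k_def cdd_def csep_def)
    then show ?thesis by (simp add: right_diff_distrib diff_eq_eq)
  qed
  have "jm T i (S i x - k *s x) = cval d *s S i x - (t * cval d + k * cval c) *s x"
    using jm_exchange[OF assms(1), of x] assms(3,4)
    by (simp add: lin scale_left_distrib)
  also have "\<dots> = cval d *s (S i x - k *s x)"
    unfolding k[symmetric] by (simp add: scale_right_diff_distrib mult.commute)
  finally have 1: "jm T i (S i x - k *s x) = cval d *s (S i x - k *s x)" .
  have "jm T (Suc i) (S i x - k *s x) = cval c *s S i x + (t * cval d - k * cval d) *s x"
    using jm_exchange[OF assms(1), of x] assms(3,4)
    by (simp add: lin scale_left_diff_distrib)
  also have "t * cval d - k * cval d = - (cval c * k)" using k by simp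
  also have "cval c *s S i x + (- (cval c * k)) *s x = cval c *s (S i x - k *s x)"
    by (simp add: scale_right_diff_distrib)
  finally show ?thesis using 1 by (simp add: k_def)
qed

text \<open>\<open>rank_two\<close> with the commutator of \<open>S ?i\<close> and
  \<open>jm T ?i\<close> as intertwiner. The roots of its square are
  \<open>q\<^sup>2 * \<alpha>\<close> and \<open>\<alpha> / q\<^sup>2\<close>, the eigenvalues of
  \<open>up c\<close> and \<open>dn c\<close>.\<close>

lemma rank_two_branching:
  assumes p: "std p" "Suc (length p) < n" "addable p c"
    and br: "G.wsp p \<subseteq> span (G.children p)"
  shows "G.wsp (p @ [c]) \<subseteq> span (G.grandchildren p c)"
proof
  fix x assume x: "x \<in> G.wsp (p @ [c])"
  let ?i = "length p"
  let ?y = "jm T ?i" and ?y' = "jm T (Suc ?i)" and ?s = "S ?i"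
  define \<alpha> where "\<alpha> = cval c"
  define u where "u z = ?s (?y z) - ?y (?s z)" for z
  have len: "?i < n" "Suc ?i < n" using p(2) by auto
  note lin = lin_jm[OF lin_T, of ?i] lin_jm[OF lin_T, of "Suc ?i"] lin_S[of ?i]
  note ex = jm_exchange[OF len(2)]
  note simps = ex lin_simps[OF lin(1)] lin_simps[OF lin(2)] lin_simps[OF lin(3)] S_square[OF len(2)]
  have comm: "?y (?y' z) = ?y' (?y z)" for z using jm_T_commute len by blast
  have u: "u z = ?s (?y z) - ?s (?y' z) + t *s ?y' z" for z
    unfolding u_def by (simp add: ex)
  have lin_u: "lin u"
    unfolding u_def[abs_def] by (rule lin_subtract[OF lin_comp[OF lin(3,1)] lin_comp[OF lin(1,3)]])
  have closed: "?y z \<in> G.wsp p" "?y' z \<in> G.wsp p" "?s z \<in> G.wsp p" if "z \<in> G.wsp p" for z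
    using that G.wsp_Y[of z p] G.wsp_S[of z p] len by (auto)
  have u_closed: "u z \<in> G.wsp p" if "z \<in> G.wsp p" for z
    unfolding u_def by (intro subspace_diff G.subspace_wsp closed that)
  have y'u: "?y' (u z) = u (?y z)" and yu: "?y (u z) = u (?y' z)" for z
    unfolding u by (simp_all add: simps comm)
  have uu: "u (u z) = (- 1) *s (?y' (?y' z) - (q\<^sup>2 * \<alpha> + \<alpha> / q\<^sup>2) *s ?y' z + (q\<^sup>2 * \<alpha> * (\<alpha> / q\<^sup>2)) *s z)"
    if "?y z = \<alpha> *s z" for z
  proof -
    \<comment> \<open>This is \<open>q\<^sup>2 + 1 / q\<^sup>2 = t\<^sup>2 + 2\<close>, relating the
      sum of the roots to the coefficient produced by the quadratic relation.\<close>
    have t2: "q\<^sup>2 * \<alpha> + \<alpha> / q\<^sup>2 = \<alpha> + \<alpha> + t * t * \<alpha>"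
      using q_nz by (simp add: t_eq field_simps power2_eq_square)
    have qq: "q * inverse q = 1" "q * (inverse q * r) = r" for r using q_nz by simp_all
    have yy': "?y (?y' z) = \<alpha> *s ?y' z" unfolding comm that by (rule lin_scale[OF lin(2)])
    have "u (u z) = ?s (u (?y' z)) - ?s (u (?y z)) + t *s u (?y z)"
      unfolding u[of "u z"] y'u yu ..
    also have "\<dots> = (\<alpha> + \<alpha> + t * t * \<alpha>) *s ?y' z - ?y' (?y' z) - (\<alpha> * \<alpha>) *s z"
      unfolding u by (simp add:  simps that yy')
        (simp add: algebra_simps qq)
    finally show ?thesis using q_nz unfolding t2
      by (simp add: algebra_simps power2_eq_square)
  qed
  have "x \<in> span (\<Union>d\<in>(cval ` {d. addable p d} - {\<alpha>}) \<union> {q\<^sup>2 * \<alpha>, \<alpha> / q\<^sup>2}.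
    {z \<in> G.wsp p. ?y z = \<alpha> *s z \<and> ?y' z = d *s z})"
  proof (rule rank_two[where u = u and s = ?s and c = "- 1" and \<omega> = "t * \<alpha>"])
    show "q\<^sup>2 * \<alpha> \<noteq> \<alpha> / q\<^sup>2"
    proof
      assume "q\<^sup>2 * \<alpha> = \<alpha> / q\<^sup>2"
      then have "q ^ 4 = 1"
        using q_nz cval_nz[of c] by (simp add: \<alpha>_def field_simps eval_nat_numeral)
      then show False using q4 len by simp
    qed
    show "finite (cval ` {d. addable p d})" using finite_addable[OF p(1)] by simp
    show "d \<noteq> q\<^sup>2 * \<alpha> \<and> d \<noteq> \<alpha> / q\<^sup>2" if d: "d \<in> cval ` {d. addable p d} - {\<alpha>}" for d
    proof -
      obtain e where e: "d = cval e" "addable p e" using d by auto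
      have "csep (up c) e" "csep (dn c) e"
        using csep_adj[OF p(1,2,3) e(2)] by (simp_all add: adj_def)
      then show ?thesis
        using cval_up[of c] cval_dn[of c] q_nz by (auto simp: csep_def e(1) \<alpha>_def field_simps)
    qed
    \<comment> \<open>The off-diagonal entry of the Jordan block. It would vanish for
      \<open>q\<^sup>2 = 1\<close>, where equal labels could no longer be excluded in this
      way.\<close>
    show "t * \<alpha> \<noteq> 0" using q2 q_nz cval_nz[of c] len by (simp add: \<alpha>_def t_eq)
    show "?y (?s z) = \<alpha> *s ?s z - (t * \<alpha>) *s z" if "?y' z = \<alpha> *s z" for z
      by (simp add: simps that)
    have "G.wsp p \<subseteq> span (G.children p)" by (rule br)
    also have "\<dots> \<subseteq> span (\<Union>d\<in>cval ` {d. addable p d}. {x \<in> G.wsp p. ?y x = d *s x})"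
      by (rule span_mono) (force simp: G.wsp_snoc)
    finally show "G.wsp p \<subseteq> \<dots>" .
    show "x \<in> G.wsp p" "?y x = \<alpha> *s x" using x by (simp_all add: G.wsp_snoc \<alpha>_def)
  qed (use lin lin_u closed u_closed y'u yu uu comm G.subspace_wsp in \<open>simp_all\<close>)
  also have "\<dots> \<subseteq> span (G.grandchildren p c)"
  proof (rule span_mono, rule UN_least)
    fix d assume "d \<in> (cval ` {d. addable p d} - {\<alpha>}) \<union> {q\<^sup>2 * \<alpha>, \<alpha> / q\<^sup>2}"
    moreover have "q\<^sup>2 * \<alpha> = cval (up c)" "\<alpha> / q\<^sup>2 = cval (dn c)"
      using cval_up[of c] cval_dn[of c] q_nz by (simp_all add: \<alpha>_def)
    ultimately have "d \<in> cval ` ({e. addable p e \<and> e \<noteq> c} \<union> {up c, dn c})" by (auto simp: \<alpha>_def)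
    then obtain e where e: "addable p e \<and> e \<noteq> c \<or> adj c e" "d = cval e"
      unfolding adj_def by blast
    have "{z \<in> G.wsp p. ?y z = \<alpha> *s z \<and> ?y' z = d *s z} \<subseteq> G.wsp ((p @ [c]) @ [e])"
    proof
      fix z assume "z \<in> {z \<in> G.wsp p. ?y z = \<alpha> *s z \<and> ?y' z = d *s z}"
      then show "z \<in> G.wsp ((p @ [c]) @ [e])"
        unfolding G.wsp_snoc using e(2) by (simp add: \<alpha>_def)
    qed
    then show "{z \<in> G.wsp p. ?y z = \<alpha> *s z \<and> ?y' z = d *s z}
      \<subseteq> (G.grandchildren p c)"
      using e(1) by auto
  qed
  finally show "x \<in> span (G.grandchildren p c)" .
qed

lemma gt_module: "gt_module scale n t T S (\<lambda>_::unit. jm T) (\<lambda>_. cval) cdd csep"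
proof (intro gt_module.intro gt_base gt_module_axioms.intro)
  show "jm T i x \<in> U" if "m \<le> n" "G.stable m U" "i < m" "x \<in> U" for m U i x
    using that by (intro jm_closed[of U T m i x]) (auto simp: G.stable_def)
  show "\<exists>b. T x = b *s x" if "0 < n" "x \<in> G.wsp [c]" for x c
    using that by (auto simp: G.wsp_def)
  show "x \<in> span (\<Union>c\<in>{c. snd c = 0}. G.wsp [c])" if "0 < n" for x
  proof -
    have "{x. T x = v j *s x} = G.wsp [(j, 0)]" for j by (simp add: G.wsp_def cval_def)
    then have "(\<Union>j. {x. T x = v j *s x}) \<subseteq> (\<Union>c\<in>{c. snd c = 0}. G.wsp [c])" by auto
    from subsetD[OF span_mono[OF this]] show ?thesis using T_diag[OF that] by blast
  qed
qed (use csep_addable csep_adj cdd_sum cdd_braid cdd_free cdd_adj intertwine rank_two_branching in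
    \<open>auto simp: csep_def\<close>)

end

section \<open>The case \<open>q\<^sup>2 = 1\<close>\<close>

text \<open>The eigenvalues will be integer contents, which characteristic 0 keeps apart.\<close>

locale deg_module = hecke_module scale q v n T S
  for scale :: "'k::field_char_0 \<Rightarrow> 'v::ab_group_add \<Rightarrow> 'v" (infixr "*s" 75)
    and q and v :: "'m::{finite,linorder} \<Rightarrow> 'k" and n T S +
  assumes q_inverse: "q - inverse q = 0"
begin

lemma S_S: "Suc i < n \<Longrightarrow> S i (S i x) = x"
  using S_square[of i x] by (simp add: q_inverse)

text \<open>Lagrange interpolation: the projection onto the \<open>v j\<close>-eigenspace of
  \<open>T\<close>. As a polynomial in \<open>T\<close> it preserves submodules and commutes with
  whatever commutes with \<open>T\<close>.\<close>

definition prj :: "'m \<Rightarrow> 'v \<Rightarrow> 'v" where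
  "prj j x = inverse (\<Prod>l\<leftarrow>removeAll j (sorted_list_of_set UNIV). v j - v l) *s
     poly_op T v (removeAll j (sorted_list_of_set UNIV)) x"

lemma lin_prj: "lin (prj j)"
  unfolding prj_def[abs_def] by (intro lin_smult lin_poly_op lin_T)

lemma prj_eigen:
  assumes "T x = v l *s x" shows "prj j x = (if j = l then x else 0)"
proof (cases "j = l")
  case True
  have "(\<Prod>l\<leftarrow>removeAll j xs. v j - v l) \<noteq> 0" for xs
    by (induction xs) (auto simp: inj_eq[OF inj_v])
  then show ?thesis
    using True poly_op_eigen[OF lin_T assms, of v] by (simp add: prj_def)
next
  case False
  have "(\<Prod>l'\<leftarrow>removeAll j (sorted_list_of_set UNIV). v l - v l') = 0"
    using False by (simp add: prod_list_zero_iff)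
  then show ?thesis
    using False poly_op_eigen[OF lin_T assms, of v] by (simp add: prj_def)
qed

lemma lin_ext:
  assumes "0 < n" "lin f" "lin g" "\<And>l x. T x = v l *s x \<Longrightarrow> f x = g x"
  shows "f x = g x"
  using T_diag[OF assms(1), of x]
  by (induction rule: span_induct_alt) (use assms(2-4) in \<open>auto simp: lin_simps\<close>)

lemma prj_prj: "0 < n \<Longrightarrow> prj j (prj l x) = (if j = l then prj l x else 0)"
proof (rule lin_ext[where f = "\<lambda>x. prj j (prj l x)" and g = "\<lambda>x. if j = l then prj l x else 0"])
  show "lin (\<lambda>x. prj j (prj l x))" by (rule lin_comp[OF lin_prj lin_prj])
  show "lin (\<lambda>x. if j = l then prj l x else 0)" using lin_prj[of l] lin_const_zero
    by (cases "j = l") simp_all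
  fix i x assume "T x = v i *s x"
  then have "prj a x = (if a = i then x else 0)" for a by (rule prj_eigen)
  then show "prj j (prj l x) = (if j = l then prj l x else 0)" by (auto simp: lin_zero[OF lin_prj])
qed

lemma sum_prj: "0 < n \<Longrightarrow> (\<Sum>j\<in>UNIV. prj j x) = x"
proof (rule lin_ext[where g = "\<lambda>x. x", OF _ lin_sums[OF lin_prj] lin_id])
  fix i x assume "T x = v i *s x"
  then have "prj a x = (if a = i then x else 0)" for a by (rule prj_eigen)
  then show "(\<Sum>j\<in>UNIV. prj j x) = x" by simp
qed

lemma T_prj: "0 < n \<Longrightarrow> T (prj j x) = v j *s prj j x"
proof (rule lin_ext[where f = "\<lambda>x. T (prj j x)", OF _ lin_comp[OF lin_T lin_prj] lin_smult[OF lin_prj]])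
  fix i x assume x: "T x = v i *s x"
  then have "prj a x = (if a = i then x else 0)" for a by (rule prj_eigen)
  then show "T (prj j x) = v j *s prj j x" using x by (simp add: lin_zero[OF lin_T])
qed

lemma prj_commute:
  assumes "lin f" "\<And>x. f (T x) = T (f x)"
  shows "prj j (f x) = f (prj j x)"
proof -
  have "poly_op T v js (f x) = f (poly_op T v js x)" for js
    by (induction js) (simp_all add: assms lin_simps[OF assms(1)])
  then show ?thesis by (simp add: prj_def lin_scale[OF assms(1)])
qed

lemma prj_S: "0 < l \<Longrightarrow> Suc l < n \<Longrightarrow> prj j (S l x) = S l (prj j x)"
  by (intro prj_commute lin_S) (simp add: T_S_commute)

text \<open>\<open>T\<close> commutes with its conjugate by \<open>S 0\<close>; each of the two is
  replaced by an idempotent in turn, with a conjugation by \<open>S 0\<close> in between.\<close>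

lemma prj_S0:
  assumes n: "1 < n"
  shows "prj j (S 0 (prj l (S 0 x))) = S 0 (prj l (S 0 (prj j x)))"
proof -
  have SS: "S 0 (S 0 z) = z" for z using S_S n by simp
  have *: "prj l (S 0 (T (S 0 z))) = S 0 (T (S 0 (prj l z)))" for z
  proof (rule prj_commute)
    show "lin (\<lambda>z. S 0 (T (S 0 z)))" by (intro lin_comp[OF lin_S] lin_comp[OF lin_T] lin_S)
    show "S 0 (T (S 0 (T z))) = T (S 0 (T (S 0 z)))" for z using T_S_braid[OF n, of z] by simp
  qed
  show ?thesis
  proof (rule prj_commute)
    show "lin (\<lambda>x. S 0 (prj l (S 0 x)))" by (intro lin_comp[OF lin_S] lin_comp[OF lin_prj] lin_S)
    show "S 0 (prj l (S 0 (T x))) = T (S 0 (prj l (S 0 x)))" for x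
      using *[of "S 0 x"] by (simp add: SS)
  qed
qed

text \<open>On weight vectors, the projection onto those whose box at position \<open>i\<close> lies
  in component \<open>j\<close>.\<close>

definition e :: "'m \<Rightarrow> nat \<Rightarrow> 'v \<Rightarrow> 'v" where
  "e j = jm (prj j)"

lemma lin_e: "lin (e j i)"
  unfolding e_def by (rule lin_jm[OF lin_prj])

lemma e_0: "e j 0 = prj j"
  by (simp add: e_def fun_eq_iff)

lemma e_S: "i < n \<Longrightarrow> Suc l < n \<Longrightarrow> i \<noteq> l \<Longrightarrow> i \<noteq> Suc l \<Longrightarrow> e j i (S l x) = S l (e j i x)"
  unfolding e_def by (rule jm_S_commute) (auto simp: prj_S)

lemma e_S_self: "Suc i < n \<Longrightarrow> e j i (S i x) = S i (e j (Suc i) x)"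
  and e_Suc_S: "Suc i < n \<Longrightarrow> e j (Suc i) (S i x) = S i (e j i x)"
  by (simp_all add: e_def S_S)

lemma e_e_same: "i < n \<Longrightarrow> e j i (e l i x) = (if j = l then e l i x else 0)"
  by (induction i arbitrary: x) (auto simp: e_def prj_prj S_S lin_zero[OF lin_S])

lemma sum_e: "i < n \<Longrightarrow> (\<Sum>j\<in>UNIV. e j i x) = x"
proof (induction i arbitrary: x)
  case (Suc i)
  have "(\<Sum>j\<in>UNIV. e j (Suc i) x) = S i (\<Sum>j\<in>UNIV. e j i (S i x))"
    by (simp add: e_def lin_sum[OF lin_S])
  then show ?case using Suc by (simp add: S_S)
qed (simp add: e_def sum_prj)

lemma e_commute: "i < n \<Longrightarrow> l < n \<Longrightarrow> e j i (e j' l x) = e j' l (e j i x)"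
  using jm_jm_commute[of "prj j" "prj j'" i l x] jm_jm_commute[of "prj j'" "prj j" l i x]
  by (cases i l rule: linorder_cases) (auto simp: e_def prj_S prj_S0 e_e_same[unfolded e_def])

text \<open>The projection onto the vectors whose boxes at positions \<open>i\<close> and
  \<open>l\<close> lie in the same component. It is the correction by which the transposition terms
  of \<open>xx\<close> differ from those of the symmetric group.\<close>

definition cc :: "nat \<Rightarrow> nat \<Rightarrow> 'v \<Rightarrow> 'v" where
  "cc i l x = (\<Sum>j\<in>UNIV. e j i (e j l x))"

lemma lin_cc: "lin (cc i l)"
  unfolding cc_def[abs_def] by (intro lin_sums lin_comp[OF lin_e] lin_e)

lemma cc_commute: "i < n \<Longrightarrow> l < n \<Longrightarrow> cc i l x = cc l i x"
  unfolding cc_def by (intro sum.cong refl e_commute)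

lemma cc_e: "i < n \<Longrightarrow> l < n \<Longrightarrow> k < n \<Longrightarrow> e j k (cc i l x) = cc i l (e j k x)"
  unfolding cc_def lin_sum[OF lin_e] by (intro sum.cong refl) (simp add: e_commute[of k])

lemma cc_e_same: "i < n \<Longrightarrow> l < n \<Longrightarrow> cc i l (e j i x) = cc i l (e j l x)"
proof -
  assume il: "i < n" "l < n"
  have "cc i l (e j i x) = e j i (e j l x)"
    using il by (simp add: cc_def e_commute[of l i] e_e_same if_distrib[of "e _ l"] lin_zero[OF lin_e] cong: if_cong)
  moreover have "cc i l (e j l x) = e j i (e j l x)"
    using il by (simp add: cc_def e_e_same if_distrib[of "e _ i"] lin_zero[OF lin_e] cong: if_cong)
  ultimately show ?thesis by simp
qed

lemma cc_S: "i < n \<Longrightarrow> l < n \<Longrightarrow> Suc k < n \<Longrightarrow> k \<noteq> i \<Longrightarrow> k \<noteq> l \<Longrightarrow> i \<noteq> Suc k \<Longrightarrow> l \<noteq> Suc k \<Longrightarrow>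
    cc i l (S k x) = S k (cc i l x)"
  unfolding cc_def lin_sum[OF lin_S] by (intro sum.cong refl) (simp add: e_S)

lemma cc_S_self: "Suc i < n \<Longrightarrow> cc i (Suc i) (S i x) = S i (cc i (Suc i) x)"
  unfolding cc_def lin_sum[OF lin_S] by (intro sum.cong refl) (simp add: e_S_self e_Suc_S e_commute)

lemma cc_S_left: "Suc i < n \<Longrightarrow> l < n \<Longrightarrow> l \<noteq> i \<Longrightarrow> l \<noteq> Suc i \<Longrightarrow> cc i l (S i x) = S i (cc (Suc i) l x)"
  unfolding cc_def lin_sum[OF lin_S] by (intro sum.cong refl) (simp add: e_S e_S_self)

lemma cc_Suc_S_left:
  "Suc i < n \<Longrightarrow> l < n \<Longrightarrow> l \<noteq> i \<Longrightarrow> l \<noteq> Suc i \<Longrightarrow> cc (Suc i) l (S i x) = S i (cc i l x)"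
  unfolding cc_def lin_sum[OF lin_S] by (intro sum.cong refl) (simp add: e_S e_Suc_S)

text \<open>The Jucys--Murphy elements of the wreath product. The product form \<open>S i (xx i (S i x))\<close> alone
  does not separate the weights when \<open>q\<^sup>2 = 1\<close>.\<close>

fun xx :: "nat \<Rightarrow> 'v \<Rightarrow> 'v" where
  "xx 0 x = 0"
| "xx (Suc i) x = S i (xx i (S i x)) + cc i (Suc i) (S i x)"

lemma lin_xx: "lin (xx i)"
proof (induction i)
  case 0
  then show ?case by (simp add: lin_iff)
next
  case (Suc i)
  have "lin (\<lambda>x. S i (xx i (S i x)) + cc i (Suc i) (S i x))"
    by (rule lin_plus[OF lin_comp[OF lin_S lin_comp[OF Suc lin_S]] lin_comp[OF lin_cc lin_S]])
  then show ?case by (simp add: lin_iff)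
qed

text \<open>For \<open>i = l + 2\<close>, unfolding the recursion twice gives a conjugate of
  \<open>xx l\<close> and two transposition terms. Moving \<open>S l\<close> across fixes the first
  and interchanges the other two, as equations 1, 2 and 3 show.\<close>

lemma xx_S: "i < n \<Longrightarrow> Suc l < n \<Longrightarrow> i \<noteq> l \<Longrightarrow> i \<noteq> Suc l \<Longrightarrow> xx i (S l x) = S l (xx i x)"
proof (induction i arbitrary: l x rule: less_induct)
  case (less i)
  show ?case
  proof (cases i)
    case 0
    then show ?thesis by (simp add: lin_zero[OF lin_S])
  next
    case (Suc k)
    show ?thesis
    proof (cases "Suc l = k")
      case False
      then have "Suc k < l \<or> Suc l < k" using less.prems Suc by auto
      then have "S k (S l z) = S l (S k z)" "xx k (S l z) = S l (xx k z)"
        "cc k (Suc k) (S l z) = S l (cc k (Suc k) z)" for z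
        using less Suc S_commute'[of k l] cc_S[of k "Suc k" l z] by auto
      then show ?thesis by (simp add: Suc lin_add[OF lin_S])
    next
      case True
      have i: "i = Suc (Suc l)" "Suc (Suc l) < n" "Suc l < n" "l < n"
        using Suc True less.prems by auto
      have A: "xx l (S (Suc l) z) = S (Suc l) (xx l z)" for z
        using less i by auto
      note br = S_braid[OF i(2)] and SS = S_S[OF i(2)] S_S[OF i(3)]
      have p1: "cc l (Suc l) (S l (S (Suc l) z)) = S l (S (Suc l) (cc l (Suc (Suc l)) z))" for z
      proof -
        have "cc l (Suc l) (S l (S (Suc l) z)) = S l (cc (Suc l) l (S (Suc l) z))"
          using cc_S_self[OF i(3)] cc_commute i by simp
        also have "\<dots> = S l (S (Suc l) (cc l (Suc (Suc l)) z))"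
          using cc_S_left[OF i(2), of l] cc_commute[of l "Suc (Suc l)"] i by simp
        finally show ?thesis .
      qed
      have p2: "cc l (Suc (Suc l)) (S l z) = S l (cc (Suc l) (Suc (Suc l)) z)" for z
        using cc_S_left[OF i(3), of "Suc (Suc l)"] i by simp
      have p3: "cc (Suc l) (Suc (Suc l)) (S l z) = S l (cc l (Suc (Suc l)) z)" for z
        using cc_Suc_S_left[OF i(3), of "Suc (Suc l)"] i by simp
      have p4: "cc (Suc l) (Suc (Suc l)) (S (Suc l) z) = S (Suc l) (cc (Suc l) (Suc (Suc l)) z)" for z
        using cc_S_self[OF i(2)] .
      have xi: "xx i z = S (Suc l) (S l (xx l (S l (S (Suc l) z))))
          + S (Suc l) (S l (S (Suc l) (cc l (Suc (Suc l)) z)))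
          + S (Suc l) (cc (Suc l) (Suc (Suc l)) z)" for z
        by (simp add: i(1) p1 p4 lin_add[OF lin_S])
      have 1: "S (Suc l) (S l (xx l (S l (S (Suc l) (S l x)))))
          = S l (S (Suc l) (S l (xx l (S l (S (Suc l) x)))))"
        by (simp add: A br)
      have 2: "S (Suc l) (S l (S (Suc l) (cc l (Suc (Suc l)) (S l x))))
          = S l (S (Suc l) (cc (Suc l) (Suc (Suc l)) x))"
        by (simp add: p2 SS flip: br)
      have 3: "S (Suc l) (cc (Suc l) (Suc (Suc l)) (S l x))
          = S l (S (Suc l) (S l (S (Suc l) (cc l (Suc (Suc l)) x))))"
        by (simp add: p3 SS flip: br)
      show ?thesis
        unfolding xi 1 2 3 by (simp add: lin_add[OF lin_S] algebra_simps)
    qed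
  qed
qed

text \<open>\<open>S k\<close> exchanges \<open>e j k\<close> and \<open>e j (Suc k)\<close>, while
  \<open>cc k (Suc k)\<close> makes them act equally, so the transposition term commutes with
  both.\<close>

lemma xx_e: "i < n \<Longrightarrow> l < n \<Longrightarrow> xx i (e j l x) = e j l (xx i x)"
proof (induction i arbitrary: l x)
  case 0
  then show ?case by (simp add: lin_zero[OF lin_e])
next
  case (Suc k)
  have k: "k < n" "Suc k < n" using Suc.prems by auto
  have pp': "cc k (Suc k) (S k (e j l x)) = e j l (cc k (Suc k) (S k x))"
  proof -
    consider "l = k" | "l = Suc k" | "l \<noteq> k" "l \<noteq> Suc k" by blast
    then show ?thesis
    proof cases
      case 1
      have "cc k (Suc k) (S k (e j k x)) = cc k (Suc k) (e j (Suc k) (S k x))"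
        by (simp add: e_Suc_S[OF k(2)])
      also have "\<dots> = cc k (Suc k) (e j k (S k x))" by (rule cc_e_same[OF k, symmetric])
      finally show ?thesis using cc_e k 1 by simp
    next
      case 2
      have "cc k (Suc k) (S k (e j (Suc k) x)) = cc k (Suc k) (e j k (S k x))"
        by (simp add: e_S_self[OF k(2)])
      also have "\<dots> = cc k (Suc k) (e j (Suc k) (S k x))" by (rule cc_e_same[OF k])
      finally show ?thesis using cc_e k 2 by simp
    next
      case 3
      then show ?thesis using e_S[of l k j x] cc_e[of k "Suc k" l j] k Suc.prems by simp
    qed
  qed
  have "S k (xx k (S k (e j l x))) = e j l (S k (xx k (S k x)))"
  proof -
    consider "l = k" | "l = Suc k" | "l \<noteq> k" "l \<noteq> Suc k" by blast
    then show ?thesis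
    proof cases
      case 1
      then show ?thesis using Suc.IH[of "Suc k" "S k x"] k by (simp add: e_S_self flip: e_Suc_S)
    next
      case 2
      then show ?thesis using Suc.IH[of k "S k x"] k by (simp add: e_Suc_S flip: e_S_self)
    next
      case 3
      then show ?thesis using Suc.IH[of l "S k x"] k Suc.prems by (simp flip: e_S)
    qed
  qed
  then show ?case using pp' by (simp add: lin_add[OF lin_e])
qed

lemma xx_cc: "i < n \<Longrightarrow> l < n \<Longrightarrow> k < n \<Longrightarrow> xx i (cc l k x) = cc l k (xx i x)"
  by (simp add: cc_def lin_sum[OF lin_xx] xx_e)

lemma xx_xx_less: "i < l \<Longrightarrow> l < n \<Longrightarrow> xx i (xx l x) = xx l (xx i x)"
proof (induction l arbitrary: i x)
  case (Suc k)
  have *: "xx i (xx (Suc k) x) = xx (Suc k) (xx i x)" if "i < k" for i x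
  proof -
    have "xx i (S k z) = S k (xx i z)" for z using xx_S[of i k z] that Suc.prems by simp
    then show ?thesis
      using Suc.IH[of i] xx_cc[of i k "Suc k"] that Suc.prems by (simp add: lin_add[OF lin_xx])
  qed
  show ?case
  proof (cases "i < k")
    case False
    then have "i = k" using Suc.prems by simp
    show ?thesis
    proof (cases k)
      case 0
      then show ?thesis using \<open>i = k\<close> lin_zero[OF lin_xx, of "Suc 0"] by simp
    next
      case (Suc h)
      \<comment> \<open>For \<open>i = k\<close> the operator \<open>xx k\<close> is unfolded
        instead: all its constituents have index at most \<open>k\<close> and commute with
        \<open>xx (Suc k)\<close>.\<close>
      have c: "xx (Suc k) (S h z) = S h (xx (Suc k) z)" "xx (Suc k) (xx h z) = xx h (xx (Suc k) z)"
        "xx (Suc k) (cc h k z) = cc h k (xx (Suc k) z)" for z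
        using xx_S[of "Suc k" h z] *[of h z] xx_cc[of "Suc k" h k z] Suc Suc.prems \<open>Suc k < n\<close>
        by (simp_all del: xx.simps)
      have xk: "xx k z = S h (xx h (S h z)) + cc h k (S h z)" for z by (simp add: Suc)
      show ?thesis
        unfolding \<open>i = k\<close> xk by (simp add: c lin_add[OF lin_xx] del: xx.simps)
    qed
  qed (use * in blast)
qed simp

lemma xx_xx: "i < n \<Longrightarrow> l < n \<Longrightarrow> xx i (xx l x) = xx l (xx i x)"
  using xx_xx_less[of i l x] xx_xx_less[of l i x] by (cases i l rule: linorder_cases) auto

declare xx.simps(2) [simp del]

section \<open>Seminormal data for the wreath product\<close>

definition Y :: "'m option \<Rightarrow> nat \<Rightarrow> 'v \<Rightarrow> 'v" where
  "Y \<kappa> i = (case \<kappa> of None \<Rightarrow> xx i | Some j \<Rightarrow> e j i)"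

definition dval :: "'m option \<Rightarrow> 'm label \<Rightarrow> 'k" where
  "dval \<kappa> c = (case \<kappa> of None \<Rightarrow> of_int (snd c) | Some j \<Rightarrow> if j = fst c then 1 else 0)"

text \<open>The inverse axial distance of Young's seminormal form; between different components the
  generator has no diagonal part.\<close>

definition ddd :: "'m label \<Rightarrow> 'm label \<Rightarrow> 'k" where
  "ddd c d = (if fst c = fst d then 1 / of_int (snd d - snd c) else 0)"

lemma Y_simps [simp]: "Y None i = xx i" "Y (Some j) i = e j i"
  and dval_simps [simp]: "dval None c = of_int (snd c)" "dval (Some j) c = (if j = fst c then 1 else 0)"
  by (simp_all add: Y_def dval_def)

lemma dval_separates:
  assumes "c \<noteq> d" shows "\<exists>\<kappa>. dval \<kappa> c \<noteq> dval \<kappa> d"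
proof (cases "fst c = fst d")
  case True
  then show ?thesis using assms by (intro exI[of _ None]) (auto simp: prod_eq_iff)
next
  case False
  then show ?thesis by (intro exI[of _ "Some (fst c)"]) auto
qed

lemma gt_base: "gt_base scale n (q - inverse q) T S Y"
proof (intro gt_base.intro gt_base_axioms.intro)
  show "lin (Y \<kappa> i)" for \<kappa> i by (cases \<kappa>) (simp_all add: lin_e lin_xx)
  show "Y \<kappa> i (Y \<kappa>' j x) = Y \<kappa>' j (Y \<kappa> i x)" if "i < n" "j < n" for \<kappa> \<kappa>' i j x
    using that by (cases \<kappa>; cases \<kappa>') (simp_all add: e_commute xx_e xx_xx)
  show "Y \<kappa> i (S j x) = S j (Y \<kappa> i x)" if "i < n" "Suc j < n" "i \<noteq> j" "i \<noteq> Suc j" for \<kappa> i j x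
    using that by (cases \<kappa>) (simp_all add: e_S xx_S)
qed (use vspace_axioms lin_T lin_S S_square S_commute S_braid in auto)

interpretation G: gt_base scale n "q - inverse q" T S Y dval by (rule gt_base)

lemma Y_eigen_iff:
  assumes "i < n"
  shows "(\<forall>\<kappa>. Y \<kappa> i x = dval \<kappa> c *s x) \<longleftrightarrow> e (fst c) i x = x \<and> xx i x = of_int (snd c) *s x"
proof
  assume *: "\<forall>\<kappa>. Y \<kappa> i x = dval \<kappa> c *s x"
  show "e (fst c) i x = x \<and> xx i x = of_int (snd c) *s x"
    using *[rule_format, of "Some (fst c)"] *[rule_format, of None] by simp
next
  assume *: "e (fst c) i x = x \<and> xx i x = of_int (snd c) *s x"
  have "Y \<kappa> i x = dval \<kappa> c *s x" for \<kappa>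
  proof (cases \<kappa>)
    case (Some j)
    then show ?thesis using * e_e_same[OF assms, of j "fst c" x] by (auto split: if_splits)
  qed (use * in simp)
  then show "\<forall>\<kappa>. Y \<kappa> i x = dval \<kappa> c *s x" by blast
qed

lemma wsp_snoc_iff:
  "length p < n \<Longrightarrow> x \<in> G.wsp (p @ [c]) \<longleftrightarrow>
    x \<in> G.wsp p \<and> e (fst c) (length p) x = x \<and> xx (length p) x = of_int (snd c) *s x"
  unfolding G.wsp_snoc Y_eigen_iff by simp

lemma xx_exchange:
  assumes "Suc i < n"
  shows "xx (Suc i) (S i x) = S i (xx i x) + cc i (Suc i) x"
    and "xx i (S i x) = S i (xx (Suc i) x) - cc i (Suc i) x"
  using S_S[OF assms] cc_S_self[OF assms] by (simp_all add: xx.simps lin_simps[OF lin_S])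

lemma cc_weight:
  assumes "i < n" "l < n" "e j i x = x" "e j' l x = x"
  shows "cc i l x = (if j = j' then x else 0)"
proof -
  have "e a i (e a l x) = (if a = j \<and> a = j' then x else 0)" for a
  proof -
    have "e a l x = (if a = j' then x else 0)"
      using e_e_same[OF assms(2), of a j' x] assms(4) by simp
    moreover have "e a i x = (if a = j then x else 0)"
      using e_e_same[OF assms(1), of a j x] assms(3) by simp
    ultimately show ?thesis by (auto simp: lin_zero[OF lin_e])
  qed
  then show ?thesis by (cases "j = j'") (auto simp: cc_def intro!: sum.neutral)
qed

lemma ddd_swap: "ddd d c = - ddd c d"
proof -
  have "of_int (snd c - snd d) = - (of_int (snd d - snd c) :: 'k)" by simp
  then show ?thesis by (simp add: ddd_def del: of_int_diff)
qed

lemma label_diff_nz: "c \<noteq> d \<Longrightarrow> fst c = fst d \<Longrightarrow> of_int (snd d) - of_int (snd c) \<noteq> (0 :: 'k)"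
  by (auto simp: prod_eq_iff)

lemma ddd_braid:
  assumes "a \<noteq> b" "b \<noteq> c" "a \<noteq> c"
  shows "ddd a c * (ddd a b + ddd b c) = ddd a b * ddd b c"
proof -
  consider "fst a = fst b" "fst b = fst c" | "fst a \<noteq> fst b \<or> fst b \<noteq> fst c" by blast
  then show ?thesis
  proof cases
    case 1
    then show ?thesis
      using label_diff_nz[of a b] label_diff_nz[of b c] label_diff_nz[of a c] assms
      by (simp add: ddd_def divide_simps)
  qed (auto simp: ddd_def)
qed

lemma ddd_free:
  assumes "c \<noteq> d" "\<not> adj c d"
  shows "ddd c d * ddd d c \<noteq> - 1"
proof (cases "fst c = fst d")
  case True
  define k where "k = snd d - snd c"
  have "ddd c d * ddd d c = - (1 / (of_int k * of_int k))"
    using True ddd_swap[of d c] by (simp add: ddd_def k_def del: of_int_diff)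
  moreover have "k \<noteq> 0" "k \<noteq> 1" "k \<noteq> - 1"
    using True assms by (auto simp: k_def adj_def up_def dn_def prod_eq_iff)
  then have "k * k \<noteq> 1" by (metis square_eq_1_iff)
  then have "of_int k * of_int k \<noteq> (1 :: 'k)" by (metis of_int_1 of_int_eq_iff of_int_mult)
  ultimately show ?thesis by (auto simp: divide_simps split: if_splits)
qed (simp add: ddd_def)

lemma ddd_adj: "adj c d \<Longrightarrow> ddd c d * ddd d c = - 1" "adj c d \<Longrightarrow> ddd c d \<noteq> ddd d c"
  by (auto simp: adj_def up_def dn_def ddd_def)

lemma intertwine:
  assumes "Suc i < n" "c \<noteq> d" "\<forall>\<kappa>. Y \<kappa> i x = dval \<kappa> c *s x" "\<forall>\<kappa>. Y \<kappa> (Suc i) x = dval \<kappa> d *s x"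
  shows "Y \<kappa> i (S i x - ddd c d *s x) = dval \<kappa> d *s (S i x - ddd c d *s x) \<and>
    Y \<kappa> (Suc i) (S i x - ddd c d *s x) = dval \<kappa> c *s (S i x - ddd c d *s x)"
proof -
  define k where "k = ddd c d"
  have i: "i < n" using assms(1) by simp
  have x: "e (fst c) i x = x" "xx i x = of_int (snd c) *s x"
    "e (fst d) (Suc i) x = x" "xx (Suc i) x = of_int (snd d) *s x"
    using Y_eigen_iff[OF i] Y_eigen_iff[OF assms(1)] assms(3,4) by blast+
  have cc: "cc i (Suc i) x = (if fst c = fst d then x else 0)"
    by (rule cc_weight[OF i assms(1) x(1,3)])
  have "k = 0 \<or> fst c = fst d" by (auto simp: k_def ddd_def)
  moreover have "e (fst d) i (S i x) = S i x" "e (fst c) (Suc i) (S i x) = S i x"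
    using e_S_self[OF assms(1)] e_Suc_S[OF assms(1)] x by simp_all
  ultimately have e: "e (fst d) i (S i x - k *s x) = S i x - k *s x"
    "e (fst c) (Suc i) (S i x - k *s x) = S i x - k *s x"
    using x by (auto simp: lin_simps[OF lin_e])
  have k: "of_int (snd c) * k = of_int (snd d) * k - (if fst c = fst d then 1 else 0)"
  proof (cases "fst c = fst d")
    case True
    then have "(of_int (snd d) - of_int (snd c)) * k = 1"
      using label_diff_nz[OF assms(2)] by (simp add: k_def ddd_def)
    then show ?thesis using True by (simp add: algebra_simps)
  qed (simp add: k_def ddd_def)
  have "cc i (Suc i) x = (if fst c = fst d then 1 else 0) *s x" by (simp add: cc)
  then have xd: "xx i (S i x - k *s x) = of_int (snd d) *s (S i x - k *s x)"
    "xx (Suc i) (S i x - k *s x) = of_int (snd c) *s (S i x - k *s x)"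
    using xx_exchange[OF assms(1), of x] x(2,4) k
    by (simp_all add: lin_simps[OF lin_xx] lin_simps[OF lin_S] mult.commute[of k] scale_left_diff_distrib
      scale_right_diff_distrib)
  show ?thesis
    using Y_eigen_iff[OF i, of "S i x - k *s x" d] Y_eigen_iff[OF assms(1), of "S i x - k *s x" c] e xd
    unfolding k_def by blast
qed

text \<open>On \<open>X\<close>, where both boxes lie in the component of \<open>c\<close>,
  \<open>cc\<close> is the identity and \<open>xx_exchange\<close> becomes the relation of the
  degenerate affine Hecke algebra. The intertwiner then has roots \<open>\<alpha> + 1\<close> and
  \<open>\<alpha> - 1\<close>, and the Jordan constant is 1.\<close>

lemma rank_two_same_component:
  assumes p: "std p" "Suc (length p) < n" "addable p c"
    and br: "G.wsp p \<subseteq> span (G.children p)"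
    and x: "x \<in> G.wsp (p @ [c])" "e (fst c) (Suc (length p)) x = x"
  shows "x \<in> span (G.grandchildren p c)"
proof -
  let ?i = "length p" and ?j = "fst c"
  let ?y = "xx ?i" and ?y' = "xx (Suc ?i)" and ?s = "S ?i"
  define \<alpha> :: 'k where "\<alpha> = of_int (snd c)"
  define X where "X = {z. z \<in> G.wsp p \<and> e ?j ?i z = z \<and> e ?j (Suc ?i) z = z}"
  define u where "u z = ?s (?y z) - ?y (?s z)" for z
  have len: "?i < n" "Suc ?i < n" using p(2) by auto
  note lin = lin_xx[of ?i] lin_xx[of "Suc ?i"] lin_S[of ?i]
  note ex = xx_exchange[OF len(2)]
  have cc: "cc ?i (Suc ?i) z = z" if "z \<in> X" for z
    using cc_weight[OF len, of ?j z ?j] that by (simp add: X_def)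
  have comm: "?y (?y' z) = ?y' (?y z)" for z using xx_xx len by blast
  have subX: "subspace X"
    unfolding X_def using G.subspace_wsp[of p] subspace_eigen[OF lin_e, of _ _ 1]
    by (intro subspace_Collect_conj) simp_all
  have Y_closed: "Y \<kappa> k z \<in> X" if "z \<in> X" "k < n" for \<kappa> k z
    using that G.wsp_Y[of z p k \<kappa>] G.Y_commute[of ?i k "Some ?j" \<kappa> z]
      G.Y_commute[of "Suc ?i" k "Some ?j" \<kappa> z] len
    by (simp add: X_def)
  have closed: "?y z \<in> X" "?y' z \<in> X" "?s z \<in> X" if "z \<in> X" for z
  proof -
    show "?y z \<in> X" "?y' z \<in> X" using Y_closed[OF that, of _ None] len by simp_all
    show "?s z \<in> X"
      using that G.wsp_S[of z p ?i] len e_S_self[OF len(2), of ?j z] e_Suc_S[OF len(2), of ?j z]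
      by (simp add: X_def)
  qed
  have lin_u: "lin u"
    unfolding u_def[abs_def] by (rule lin_subtract[OF lin_comp[OF lin(3,1)] lin_comp[OF lin(1,3)]])
  have u: "u z = ?s (?y z) - ?s (?y' z) + z" if "z \<in> X" for z
    unfolding u_def by (simp add: ex cc[OF that])
  have u_closed: "u z \<in> X" if "z \<in> X" for z
    unfolding u_def by (intro subspace_diff subX closed that)
  note simps = ex lin_simps[OF lin(1)] lin_simps[OF lin(2)] lin_simps[OF lin(3)] S_S[OF len(2)]
  have y'u: "?y' (u z) = u (?y z)" and yu: "?y (u z) = u (?y' z)" if "z \<in> X" for z
    using that closed cc by (simp_all add: u simps comm)
  have uu: "u (u z) = (- 1) *s (?y' (?y' z) - ((\<alpha> + 1) + (\<alpha> - 1)) *s ?y' z + ((\<alpha> + 1) * (\<alpha> - 1)) *s z)"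
    if z: "z \<in> X" "?y z = \<alpha> *s z" for z
  proof -
    have yy': "?y (?y' z) = \<alpha> *s ?y' z" unfolding comm z(2) by (rule lin_scale[OF lin(2)])
    have "u (u z) = ?s (u (?y' z)) - ?s (u (?y z)) + u z"
      using u[OF u_closed[OF z(1)]] y'u[OF z(1)] yu[OF z(1)] by simp
    also have "\<dots> = \<alpha> *s ?y' z + \<alpha> *s ?y' z - ?y' (?y' z) - (\<alpha> * \<alpha>) *s z + z"
      using z closed[OF z(1)]
      by (simp add: u simps yy' subspace_scale[OF subX])
    finally have "u (u z) = \<alpha> *s ?y' z + \<alpha> *s ?y' z - ?y' (?y' z) - (\<alpha> * \<alpha>) *s z + z" .
    moreover have "((\<alpha> + 1) + (\<alpha> - 1)) *s w = \<alpha> *s w + \<alpha> *s w" for w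
      by (simp flip: scale_left_distrib)
    ultimately show ?thesis by (simp only:) (simp add: algebra_simps)
  qed
  define D where "D = (\<lambda>d. of_int (snd d) :: 'k) ` {d. addable p d \<and> fst d = ?j}"
  have "x \<in> span (\<Union>d\<in>(D - {\<alpha>}) \<union> {\<alpha> + 1, \<alpha> - 1}. {z \<in> X. ?y z = \<alpha> *s z \<and> ?y' z = d *s z})"
  proof (rule rank_two[where u = u and s = ?s and c = "- 1" and \<omega> = 1])
    show "\<alpha> + 1 \<noteq> \<alpha> - 1" by (simp add: diff_eq_eq add.assoc)
    show "finite D" using finite_addable[OF p(1)] by (simp add: D_def)
    show "d \<noteq> \<alpha> + 1 \<and> d \<noteq> \<alpha> - 1" if d: "d \<in> D - {\<alpha>}" for d
    proof -
      obtain f where f: "d = of_int (snd f)" "addable p f" "fst f = fst c" using d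
        by (auto simp: D_def)
      have "f \<noteq> up c" "f \<noteq> dn c" using addable_not_adj[OF p(3) f(2)] by (auto simp: adj_def)
      then have "snd f \<noteq> snd c + 1" "snd f \<noteq> snd c - 1" using f(3)
        by (auto simp: up_def dn_def prod_eq_iff)
      then show ?thesis
        unfolding f(1) \<alpha>_def by (metis of_int_add of_int_diff of_int_1 of_int_eq_iff)
    qed
    show "?y (?s z) = \<alpha> *s ?s z - 1 *s z" if "z \<in> X" "?y' z = \<alpha> *s z" for z
      using that cc by (simp add: simps)
    show "X \<subseteq> span (\<Union>d\<in>D. {z \<in> X. ?y z = d *s z})"
    proof
      fix z assume z: "z \<in> X"
      then have "z \<in> span (G.children p)" using br by (auto simp: X_def)
      then obtain D' f where D': "finite D'" "D' \<subseteq> {d. addable p d}" "\<And>d. d \<in> D' \<Longrightarrow> f d \<in> G.wsp (p @ [d])"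
        "z = (\<Sum>d\<in>D'. f d)"
        by (rule span_UN_sumE) (auto intro: G.subspace_wsp)
      have f: "f d \<in> X" if "d \<in> D'" for d
      proof (rule joint_eigenvectors[where D = D' and I = UNIV and f = f and h = "\<lambda>\<kappa>. Y \<kappa> ?i" and m = dval])
        show "Y \<kappa> ?i (f a) = dval \<kappa> a *s f a" if "a \<in> D'" for \<kappa> a
          using D'(3)[OF that] by (simp add: G.wsp_snoc)
        show "\<exists>\<kappa>\<in>UNIV. dval \<kappa> a \<noteq> dval \<kappa> b" if "a \<noteq> b" for a b
          using dval_separates[OF that] by blast
        show "sum f D' \<in> X" using z D'(4) by simp
      qed (use D'(1) subX G.lin_Y Y_closed len that in auto)
      have "f d \<in> span (\<Union>d\<in>D. {z \<in> X. ?y z = d *s z})" if d: "d \<in> D'" for d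
      proof (cases "fst d = ?j")
        case True
        have "?y (f d) = of_int (snd d) *s f d" using D'(3)[OF d] len by (simp add: wsp_snoc_iff)
        then show ?thesis
          using True f[OF d] d D'(2) by (intro span_UN_mem[of "of_int (snd d)"]) (auto simp: D_def)
      next
        case False
        have "e (fst d) ?i (f d) = f d" using D'(3)[OF d] len by (simp add: wsp_snoc_iff)
        moreover have "e ?j ?i (f d) = f d" using f[OF d] by (simp add: X_def)
        ultimately have "f d = 0" using e_e_same[OF len(1), of ?j "fst d" "f d"] False by simp
        then show ?thesis by (simp add: span_zero)
      qed
      then show "z \<in> span (\<Union>d\<in>D. {z \<in> X. ?y z = d *s z})" unfolding D'(4) by (rule span_sum)
    qed
    show "x \<in> X" "?y x = \<alpha> *s x" using x len by (simp_all add: wsp_snoc_iff X_def \<alpha>_def)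
  qed (use lin lin_u closed u_closed y'u yu uu comm subX in \<open>simp_all\<close>)
  also have "\<dots> \<subseteq> span (G.grandchildren p c)"
  proof (rule span_mono, rule UN_least)
    fix d assume "d \<in> (D - {\<alpha>}) \<union> {\<alpha> + 1, \<alpha> - 1}"
    moreover have "\<alpha> + 1 = of_int (snd (up c))" "\<alpha> - 1 = of_int (snd (dn c))"
      by (simp_all add: \<alpha>_def up_def dn_def)
    ultimately have "d \<in> (\<lambda>d. of_int (snd d)) ` ({f. addable p f \<and> fst f = ?j \<and> f \<noteq> c} \<union> {up c, dn c})"
      by (auto simp: \<alpha>_def D_def)
    then obtain f where f': "d = of_int (snd f)" "f \<in> {f. addable p f \<and> fst f = ?j \<and> f \<noteq> c} \<union> {up c, dn c}"
      by blast
    then have f: "addable p f \<and> f \<noteq> c \<or> adj c f" "d = of_int (snd f)" "fst f = ?j"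
      by (auto simp: adj_def up_def dn_def)
    have "{z \<in> X. ?y z = \<alpha> *s z \<and> ?y' z = d *s z} \<subseteq> G.wsp ((p @ [c]) @ [f])"
    proof
      fix z assume "z \<in> {z \<in> X. ?y z = \<alpha> *s z \<and> ?y' z = d *s z}"
      then show "z \<in> G.wsp ((p @ [c]) @ [f])"
        using wsp_snoc_iff[of "p @ [c]" z f] wsp_snoc_iff[of p z c] f len by (simp add: \<alpha>_def X_def)
    qed
    then show "{z \<in> X. ?y z = \<alpha> *s z \<and> ?y' z = d *s z}
      \<subseteq> (G.grandchildren p c)"
      using f(1) by auto
  qed
  finally show ?thesis .
qed

text \<open>Between different components the generator itself exchanges the weights.\<close>

lemma rank_two_other_component:
  assumes p: "std p" "Suc (length p) < n" "addable p c"
    and br: "G.wsp p \<subseteq> span (G.children p)"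
    and x: "x \<in> G.wsp (p @ [c])" "e j (Suc (length p)) x = x" "j \<noteq> fst c"
  shows "x \<in> span (G.grandchildren p c)"
proof -
  let ?i = "length p"
  have len: "?i < n" "Suc ?i < n" using p(2) by auto
  \<comment> \<open>The conditions satisfied by \<open>S ?i x\<close> after the exchange. The
    components of \<open>S ?i x\<close> inherit them, and applying \<open>S ?i\<close> once more
    turns each into a vector of weight \<open>p @ [c, d]\<close> or 0.\<close>
  define U where "U = {z. (e j ?i z = z \<and> e (fst c) (Suc ?i) z = z) \<and> xx (Suc ?i) z = of_int (snd c) *s z}"
  have subU: "subspace U"
    unfolding U_def using subspace_eigen[OF lin_e, of _ _ 1] subspace_eigen[OF lin_xx]
    by (intro subspace_Collect_conj) simp_all
  have xw: "x \<in> G.wsp p" "e (fst c) ?i x = x" "xx ?i x = of_int (snd c) *s x"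
    using x(1) len by (simp_all add: wsp_snoc_iff)
  have "S ?i x \<in> G.wsp p" using G.wsp_S[OF xw(1)] len by simp
  then have "S ?i x \<in> span (G.children p)" using br by blast
  then obtain D f where D: "finite D" "D \<subseteq> {d. addable p d}" "\<And>d. d \<in> D \<Longrightarrow> f d \<in> G.wsp (p @ [d])"
    "S ?i x = (\<Sum>d\<in>D. f d)"
    by (rule span_UN_sumE) (auto intro: G.subspace_wsp)
  have "cc ?i (Suc ?i) x = 0" using cc_weight[OF len xw(2) x(2)] x(3) by simp
  then have SU: "S ?i x \<in> U"
    using e_S_self[OF len(2)] e_Suc_S[OF len(2)] xx_exchange(1)[OF len(2), of x] x(2) xw
    by (simp add: U_def lin_scale[OF lin_S])
  have fU: "f d \<in> U" if "d \<in> D" for d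
  proof (rule joint_eigenvectors[where D = D and I = UNIV and f = f and h = "\<lambda>\<kappa>. Y \<kappa> ?i" and m = dval])
    show "Y \<kappa> ?i z \<in> U" if "z \<in> U" for \<kappa> z
      using that len G.Y_commute[of ?i ?i "Some j" \<kappa> z] G.Y_commute[of "Suc ?i" ?i "Some (fst c)" \<kappa> z]
        G.Y_commute[of "Suc ?i" ?i None \<kappa> z] by (simp add: U_def lin_scale[OF G.lin_Y])
    show "Y \<kappa> ?i (f a) = dval \<kappa> a *s f a" if "a \<in> D" for \<kappa> a
      using D(3)[OF that] by (simp add: G.wsp_snoc)
    show "\<exists>\<kappa>\<in>UNIV. dval \<kappa> a \<noteq> dval \<kappa> b" if "a \<noteq> b" for a b using dval_separates[OF that] by blast
    show "sum f D \<in> U" using SU D(4) by simp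
  qed (use D(1) subU G.lin_Y that in auto)
  have "S ?i (f d) \<in> span (G.grandchildren p c)" if d: "d \<in> D" for d
  proof (cases "fst d = j")
    case True
    have fd: "f d \<in> G.wsp p" "e (fst d) ?i (f d) = f d" "xx ?i (f d) = of_int (snd d) *s f d"
      using D(3)[OF d] len by (simp_all add: wsp_snoc_iff)
    have fd': "e (fst c) (Suc ?i) (f d) = f d" "xx (Suc ?i) (f d) = of_int (snd c) *s f d"
      using fU[OF d] by (simp_all add: U_def)
    have "cc ?i (Suc ?i) (f d) = 0" using cc_weight[OF len fd(2) fd'(1)] True x(3) by simp
    moreover have "S ?i (f d) \<in> G.wsp p" using G.wsp_S[OF fd(1)] len by simp
    ultimately have "S ?i (f d) \<in> G.wsp ((p @ [c]) @ [d])"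
      using wsp_snoc_iff[of "p @ [c]" "S ?i (f d)" d] wsp_snoc_iff[of p "S ?i (f d)" c] len
        e_S_self[OF len(2)] e_Suc_S[OF len(2)] xx_exchange[OF len(2), of "f d"] fd fd'
      by (simp add: lin_scale[OF lin_S])
    then show ?thesis using d D(2) True x(3) by (intro span_UN_mem[of d]) auto
  next
    case False
    have "e (fst d) ?i (f d) = f d" using D(3)[OF d] len by (simp add: wsp_snoc_iff)
    moreover have "e j ?i (f d) = f d" using fU[OF d] by (simp add: U_def)
    ultimately have "f d = 0" using e_e_same[OF len(1), of j "fst d" "f d"] False by simp
    then show ?thesis by (simp add: span_zero lin_zero[OF lin_S])
  qed
  then have "(\<Sum>d\<in>D. S ?i (f d)) \<in> span (G.grandchildren p c)"
    by (rule span_sum)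
  moreover have "(\<Sum>d\<in>D. S ?i (f d)) = x"
    using S_S[OF len(2), of x] unfolding D(4) by (simp add: lin_sum[OF lin_S])
  ultimately show ?thesis by simp
qed

lemma rank_two_branching:
  assumes p: "std p" "Suc (length p) < n" "addable p c"
    and br: "G.wsp p \<subseteq> span (G.children p)"
  shows "G.wsp (p @ [c]) \<subseteq> span (G.grandchildren p c)"
proof
  fix x assume x: "x \<in> G.wsp (p @ [c])"
  let ?i = "Suc (length p)"
  have "e j ?i x \<in> span (G.grandchildren p c)" for j
  proof -
    have "e j ?i x \<in> G.wsp (p @ [c])" using G.wsp_Y[OF x, of ?i "Some j"] p(2) by simp
    moreover have "e j ?i (e j ?i x) = e j ?i x" using e_e_same[OF p(2)] by simp
    ultimately show ?thesis
      using rank_two_same_component[OF assms] rank_two_other_component[OF assms]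
        by (cases "j = fst c") auto
  qed
  then have "(\<Sum>j\<in>UNIV. e j ?i x) \<in> span (G.grandchildren p c)"
    by (intro span_sum)
  then show "x \<in> span (G.grandchildren p c)"
    using sum_e[OF p(2)] by simp
qed

lemma poly_op_closed: "subspace U \<Longrightarrow> (\<And>x. x \<in> U \<Longrightarrow> h x \<in> U) \<Longrightarrow> x \<in> U \<Longrightarrow> poly_op h r js x \<in> U"
  by (induction js) (auto intro!: subspace_diff subspace_scale)

lemma gt_module: "gt_module scale n (q - inverse q) T S Y dval ddd (\<noteq>)"
proof (intro gt_module.intro gt_base gt_module_axioms.intro)
  show "Y \<kappa> i x \<in> U" if m: "m \<le> n" and U: "G.stable m U" and "i < m" "x \<in> U" for m U i x \<kappa>
  proof -
    have sub: "subspace U" using G.stable_subspace[OF U] .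
    have S: "S l z \<in> U" if "Suc l < m" "z \<in> U" for l z using U that by (auto simp: G.stable_def)
    have "prj j z \<in> U" if "z \<in> U" for j z
      unfolding prj_def using that U \<open>i < m\<close>
      by (intro subspace_scale[OF sub] poly_op_closed[OF sub]) (auto simp: G.stable_def)
    then have e: "e j l z \<in> U" if "l < m" "z \<in> U" for j l z
      unfolding e_def using jm_closed[of U "prj j" m l z] S that by blast
    have "xx l z \<in> U" if "l < m" "z \<in> U" for l z
      using that
    proof (induction l arbitrary: z)
      case 0
      then show ?case using subspace_0[OF sub] by simp
    next
      case (Suc l)
      then show ?case
        using S e by (auto simp: xx.simps cc_def intro!: subspace_add[OF sub] subspace_sum[OF sub])
    qed
    then show ?thesis using e that by (cases \<kappa>) auto
  qed
  show "\<exists>b. T x = b *s x" if n: "0 < n" and x: "x \<in> G.wsp [c]" for x c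
  proof -
    have "prj (fst c) x = x" using x wsp_snoc_iff[of "[]" x c] n by (simp add: e_0)
    then show ?thesis using T_prj[OF n, of "fst c" x] by auto
  qed
  show "x \<in> span (\<Union>c\<in>{c. snd c = 0}. G.wsp [c])" if n: "0 < n" for x
  proof -
    have "{x. T x = v j *s x} \<subseteq> G.wsp [(j, 0)]" for j
    proof
      fix x assume "x \<in> {x. T x = v j *s x}"
      then have "prj j x = x" using prj_eigen[of x j j] by simp
      then show "x \<in> G.wsp [(j, 0)]" using wsp_snoc_iff[of "[]" x "(j, 0)"] n by (simp add: e_0)
    qed
    then have "(\<Union>j. {x. T x = v j *s x}) \<subseteq> (\<Union>c\<in>{c. snd c = 0}. G.wsp [c])" by fastforce
    from subsetD[OF span_mono[OF this]] show ?thesis using T_diag[OF n] by blast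
  qed
  show "\<exists>\<kappa>. dval \<kappa> c \<noteq> dval \<kappa> d" if "c \<noteq> d" for c d :: "'m label"
    by (rule dval_separates[OF that])
  show "f \<noteq> d" if "addable p c" "addable p d" "adj c f" for p and c d f :: "'m label"
    using that addable_not_adj by blast
  show "ddd c d + ddd d c = q - inverse q" for c d
    using ddd_swap[of d c] q_inverse by simp
  show "ddd a c * (ddd a b + ddd b c - (q - inverse q)) = ddd a b * ddd b c"
    if "a \<noteq> b" "b \<noteq> c" "a \<noteq> c" for a b c
    using ddd_braid[OF that] q_inverse by simp
  show "ddd c d * ddd d c \<noteq> - 1" if "addable p c" "addable p d" "c \<noteq> d" for p c d
    using that addable_not_adj ddd_free by blast
qed (use ddd_adj intertwine rank_two_branching in auto)

end

section \<open>Representations of the cyclotomic Hecke algebra\<close>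

lemma poly_mapping_sum_single:
  "x = (\<Sum>w\<in>Poly_Mapping.keys x. Poly_Mapping.single w (Poly_Mapping.lookup x w))"
  by (rule poly_mapping_eqI) (simp add: lookup_sum lookup_single when_def in_keys_iff)

lemma single_Cons: "Poly_Mapping.single (Word (g # xs)) c = letter g * Poly_Mapping.single (Word xs) c"
  by (simp add: letter_def mult_single plus_words_def)

lemma free_algebra_induct [consumes 1, case_names const letter add]:
  fixes x :: "'g words \<Rightarrow>\<^sub>0 'k::field"
  assumes "x \<in> carrier (free_algebra G)"
    and const: "\<And>c. P (const c)"
    and letter: "\<And>g y. g \<in> G \<Longrightarrow> y \<in> carrier (free_algebra G) \<Longrightarrow> P y \<Longrightarrow> P (letter g * y)"
    and add: "\<And>y z. y \<in> carrier (free_algebra G) \<Longrightarrow> z \<in> carrier (free_algebra G) \<Longrightarrow> P y \<Longrightarrow> P z \<Longrightarrow> P (y + z)"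
  shows "P x"
proof -
  have word: "Poly_Mapping.single (Word xs) c \<in> carrier (free_algebra G) \<and> P (Poly_Mapping.single (Word xs) c)"
    if "set xs \<subseteq> G" for xs c
    using that
  proof (induction xs)
    case Nil
    then show ?case
      using const[of c] free_algebra_closed(2)[of c G] by (simp add: const_def zero_words_def)
  next
    case (Cons g xs)
    then show ?case
      using letter[of g "Poly_Mapping.single (Word xs) c"] free_algebra_closed(6)[of "letter g" G "Poly_Mapping.single (Word xs) c"]
      by (auto simp: single_Cons free_algebra_closed(1))
  qed
  have "(\<Sum>w\<in>A. Poly_Mapping.single w (Poly_Mapping.lookup x w)) \<in> carrier (free_algebra G) \<and>
      P (\<Sum>w\<in>A. Poly_Mapping.single w (Poly_Mapping.lookup x w))"
    if "finite A" "\<forall>w\<in>A. set (letters w) \<subseteq> G" for A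
    using that
  proof (induction A)
    case empty
    have "const 0 = (0 :: 'g words \<Rightarrow>\<^sub>0 'k)" by (simp add: const_def)
    then show ?case using const[of 0] free_algebra_closed(2)[of "0 :: 'k" G] by simp
  next
    case (insert w A)
    then show ?case
      using word[of "letters w" "Poly_Mapping.lookup x w"] add free_algebra_closed(4) by auto
  qed
  then have "P (\<Sum>w\<in>Poly_Mapping.keys x. Poly_Mapping.single w (Poly_Mapping.lookup x w))"
    using assms(1) by (simp add: free_algebra_def)
  then show ?thesis by (simp flip: poly_mapping_sum_single)
qed

lemma hecke_carrier_cases:
  assumes "X \<in> carrier (hecke q v n)"
  obtains x where "x \<in> carrier (free_algebra (hecke_gens n))" "X = hecke_class q v n x"
  using assms that by (auto simp: hecke_def FactRing_def A_RCOSETS_def' hecke_class_def)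

lemma free_algebra_mono: "G \<subseteq> G' \<Longrightarrow> carrier (free_algebra G) \<subseteq> carrier (free_algebra G')"
  by (auto simp: free_algebra_def)

section \<open>The operators attached to a representation\<close>

locale hecke_rep =
  fixes q :: "'k::field" and v :: "'m::{finite,linorder} \<Rightarrow> 'k" and n :: nat
    and scale :: "'k \<Rightarrow> 'v::ab_group_add \<Rightarrow> 'v" and \<rho> :: "'k free_elt set \<Rightarrow> 'v \<Rightarrow> 'v"
  assumes rep: "representation (hecke q v n) (hecke_scalar q v n) scale \<rho>" and n_pos: "0 < n"
begin

sublocale vspace scale
  using rep by (simp add: Defs.representation_def vspace_def)

abbreviation "F \<equiv> carrier (free_algebra (hecke_gens n) :: 'k free_elt ring)"

definition R :: "'k free_elt \<Rightarrow> 'v \<Rightarrow> 'v" where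
  "R x = \<rho> (hecke_class q v n x)"

lemma class_closed: "x \<in> F \<Longrightarrow> hecke_class q v n x \<in> carrier (hecke q v n)"
  using ring_hom_memE(1)[OF hecke_class_hom] by blast

lemma lin_R: "x \<in> F \<Longrightarrow> lin (R x)"
  using rep class_closed[of x]
  by (auto simp: Defs.representation_def R_def lin_iff Vector_Spaces.linear_iff)

lemma R_add: "x \<in> F \<Longrightarrow> y \<in> F \<Longrightarrow> R (x + y) z = R x z + R y z"
  using rep class_closed[of x] class_closed[of y] ring_hom_memE(3)[OF hecke_class_hom[of q v n], of x y]
  by (simp add: Defs.representation_def R_def free_algebra_def)

lemma R_mult: "x \<in> F \<Longrightarrow> y \<in> F \<Longrightarrow> R (x * y) z = R x (R y z)"
  using rep class_closed[of x] class_closed[of y] ring_hom_memE(2)[OF hecke_class_hom[of q v n], of x y]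
  by (simp add: Defs.representation_def R_def free_algebra_def)

lemma R_const: "R (const c) z = scale c z"
  using rep by (simp add: Defs.representation_def R_def hecke_scalar_def)

lemma R_one: "R 1 z = z"
  using R_const[of 1 z] by (simp add: const_def)

lemma R_diff: "x \<in> F \<Longrightarrow> y \<in> F \<Longrightarrow> R (x - y) z = R x z - R y z"
  using R_add[of "x - y" y z] free_algebra_closed(5)[of x "hecke_gens n" y]
    by (simp add: eq_diff_eq)

lemma R_ideal:
  assumes "x \<in> hecke_ideal q v n" shows "R x z = 0"
proof -
  have "x \<in> F" using assms ideal.Icarr[OF ideal_hecke] by blast
  have "hecke_class q v n x = \<zero>\<^bsub>hecke q v n\<^esub>"
    using ring.a_rcos_zero[OF ring_free_algebra ideal_hecke assms]
    by (simp add: hecke_class_def hecke_def FactRing_def)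
  moreover have "hecke_class q v n 0 = \<zero>\<^bsub>hecke q v n\<^esub>"
    using ring.a_rcos_zero[OF ring_free_algebra ideal_hecke hecke_ideal_closed(1)]
    by (simp add: hecke_class_def hecke_def FactRing_def)
  ultimately have "R x = R (const 0)" by (simp add: R_def const_def)
  then show ?thesis by (simp add: R_const)
qed

lemma R_rel:
  assumes "x - y \<in> hecke_rels q v n" "x \<in> F" "y \<in> F"
  shows "R x z = R y z"
proof -
  have "x - y \<in> hecke_ideal q v n"
    using assms(1) ring.genideal_self[OF ring_free_algebra hecke_rels_subset[of q v n]]
    unfolding hecke_ideal_def by blast
  then show ?thesis using R_ideal R_diff[OF assms(2,3)] by (metis eq_iff_diff_eq_0)
qed

lemma tau_closed: "\<tau> \<in> F" and sigma_closed: "Suc i < n \<Longrightarrow> \<sigma> (Suc i) \<in> F"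
  using n_pos by (auto simp: free_algebra_closed(1) hecke_gens_def)

definition opT :: "'v \<Rightarrow> 'v" where "opT = R \<tau>"

text \<open>The identity outside the range of generators is only there to keep \<open>opS i\<close>
  linear for every \<open>i\<close>.\<close>

definition opS :: "nat \<Rightarrow> 'v \<Rightarrow> 'v" where "opS i = (if Suc i < n then R (\<sigma> (Suc i)) else (\<lambda>x. x))"

lemmas F_closed = free_algebra_closed(2-) tau_closed sigma_closed

lemma hecke_module:
  assumes "inj v"
  shows "hecke_module scale q v n opT opS"
proof (intro hecke_module.intro hecke_module_axioms.intro)
  show "lin opT" unfolding opT_def by (rule lin_R[OF tau_closed])
  show "lin (opS i)" for i unfolding opS_def using lin_R sigma_closed lin_id by auto
  show "opS i (opS i x) = scale (q - inverse q) (opS i x) + x" if i: "Suc i < n" for i x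
  proof -
    have "R (\<sigma> (Suc i) * \<sigma> (Suc i)) x = R (const (q - inverse q) * \<sigma> (Suc i) + 1) x"
      by (rule R_rel) (use i in \<open>auto simp: hecke_rels_def intro!: F_closed\<close>)
    then show ?thesis
      using i by (simp add: opS_def R_mult R_add R_const R_one F_closed)
  qed
  show "opS i (opS j x) = opS j (opS i x)" if i: "Suc i < j" "Suc j < n" for i j x
  proof -
    have "R (\<sigma> (Suc i) * \<sigma> (Suc j)) x = R (\<sigma> (Suc j) * \<sigma> (Suc i)) x"
    proof (rule R_rel)
      have "1 \<le> Suc i \<and> Suc i < n \<and> 1 \<le> Suc j \<and> Suc j < n \<and> \<bar>int (Suc i) - int (Suc j)\<bar> > 1"
        using i by auto
      then show "\<sigma> (Suc i) * \<sigma> (Suc j) - \<sigma> (Suc j) * \<sigma> (Suc i) \<in> hecke_rels q v n"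
        unfolding hecke_rels_def by blast
    qed (use i in \<open>auto intro!: F_closed\<close>)
    then show ?thesis using i by (simp add: opS_def R_mult F_closed)
  qed
  show "opS i (opS (Suc i) (opS i x)) = opS (Suc i) (opS i (opS (Suc i) x))" if i: "Suc (Suc i) < n" for i x
  proof -
    have "R (\<sigma> (Suc i) * \<sigma> (Suc i + 1) * \<sigma> (Suc i)) x = R (\<sigma> (Suc i + 1) * \<sigma> (Suc i) * \<sigma> (Suc i + 1)) x"
    proof (rule R_rel)
      show "\<sigma> (Suc i) * \<sigma> (Suc i + 1) * \<sigma> (Suc i) - \<sigma> (Suc i + 1) * \<sigma> (Suc i) * \<sigma> (Suc i + 1)
          \<in> hecke_rels q v n"
        using i unfolding hecke_rels_def by (intro UnI1 CollectI exI[of _ "Suc i"]) simp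
    qed (use i in \<open>auto intro!: F_closed\<close>)
    then show ?thesis using i by (simp add: opS_def R_mult F_closed)
  qed
  show "opT (opS 0 (opT (opS 0 x))) = opS 0 (opT (opS 0 (opT x)))" if i: "1 < n" for x
  proof -
    have "R (\<tau> * \<sigma> (Suc 0) * \<tau> * \<sigma> (Suc 0)) x = R (\<sigma> (Suc 0) * \<tau> * \<sigma> (Suc 0) * \<tau>) x"
      by (rule R_rel) (use i in \<open>auto simp: hecke_rels_def intro!: F_closed\<close>)
    then show ?thesis using i by (simp add: opT_def opS_def R_mult F_closed)
  qed
  show "opT (opS i x) = opS i (opT x)" if i: "0 < i" "Suc i < n" for i x
  proof -
    have "R (\<tau> * \<sigma> (Suc i)) x = R (\<sigma> (Suc i) * \<tau>) x"
      by (rule R_rel) (use i in \<open>auto simp: hecke_rels_def intro!: F_closed\<close>)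
    then show ?thesis using i by (simp add: opT_def opS_def R_mult F_closed)
  qed
  show "poly_op opT v (sorted_list_of_set UNIV) x = 0" for x
  proof -
    have *: "prod_list (map (\<lambda>j. \<tau> - const (v j)) js) \<in> F \<and>
      R (prod_list (map (\<lambda>j. \<tau> - const (v j)) js)) x = poly_op opT v js x" for js
    proof (induction js)
      case (Cons j js)
      have "\<tau> - const (v j) \<in> F" by (intro F_closed)
      then show ?case
        using Cons by (simp add: R_mult R_diff R_const opT_def F_closed)
    qed (simp add: R_one F_closed)
    have "prod_list (map (\<lambda>j. \<tau> - const (v j)) (sorted_list_of_set UNIV)) \<in> hecke_ideal q v n"
      using ring.genideal_self[OF ring_free_algebra hecke_rels_subset[of q v n]] n_pos
      unfolding hecke_ideal_def hecke_rels_def by auto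
    then show ?thesis using R_ideal *[of "sorted_list_of_set UNIV"] by simp
  qed
qed (rule vspace_axioms assms)+

text \<open>The condition \<open>stable\<close>, stated before any instance of
  \<open>gt_base\<close> is at hand.\<close>

definition stab :: "nat \<Rightarrow> 'v set \<Rightarrow> bool" where
  "stab m U \<longleftrightarrow> subspace U \<and> (0 < m \<longrightarrow> (\<forall>x\<in>U. opT x \<in> U)) \<and> (\<forall>i. Suc i < m \<longrightarrow> (\<forall>x\<in>U. opS i x \<in> U))"

text \<open>The general \<open>m\<close> and \<open>P\<close> cover both the representation at level
  \<open>n\<close> and its restriction at level \<open>n - 1\<close>.\<close>

lemma subrepresentation_iff_stab:
  assumes "m \<le> n"
    and P: "\<And>x. x \<in> carrier (free_algebra (hecke_gens m)) \<Longrightarrow> P (hecke_class q v m x) = R x"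
  shows "subrepresentation (hecke q v m) scale P U \<longleftrightarrow> stab m U"
proof
  have cl: "hecke_class q v m x \<in> carrier (hecke q v m)" if "x \<in> carrier (free_algebra (hecke_gens m))" for x
    using ring_hom_memE(1)[OF hecke_class_hom] that by blast
  assume U: "subrepresentation (hecke q v m) scale P U"
  have R: "R x z \<in> U" if "x \<in> carrier (free_algebra (hecke_gens m))" "z \<in> U" for x z
    using U cl[OF that(1)] that(2) unfolding subrepresentation_def
      by (metis P[OF that(1)] image_subset_iff)
  have "opT z \<in> U" if "0 < m" "z \<in> U" for z
    using R[of \<tau> z] that by (simp add: opT_def free_algebra_closed(1) hecke_gens_def)
  moreover have "opS i z \<in> U" if "Suc i < m" "z \<in> U" for i z
    using R[of "\<sigma> (Suc i)" z] that assms(1)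
      by (simp add: opS_def free_algebra_closed(1) hecke_gens_def)
  ultimately show "stab m U" using U by (simp add: stab_def subrepresentation_def)
next
  assume U: "stab m U"
  have sub: "subspace U" using U by (simp add: stab_def)
  have gens: "hecke_gens m \<subseteq> hecke_gens n" using assms(1) by (auto simp: hecke_gens_def)
  have "\<forall>z\<in>U. R x z \<in> U" if "x \<in> carrier (free_algebra (hecke_gens m))" for x
    using that
  proof (induction rule: free_algebra_induct)
    case (const c)
    then show ?case using subspace_scale[OF sub] by (simp add: R_const)
  next
    case (letter g y)
    have F: "letter g \<in> F" "y \<in> F"
      using letter free_algebra_mono[OF gens] gens by (auto simp: free_algebra_closed(1))
    have "R (letter g) z \<in> U" if "z \<in> U" for z
      using letter(1) U that assms(1)
      by (cases g) (auto simp: hecke_gens_def stab_def opT_def opS_def image_iff Suc_le_eq split: if_splits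
        dest!: gr0_implies_Suc)
    then show ?case using letter F by (simp add: R_mult)
  next
    case (add y z)
    then have "y \<in> F" "z \<in> F" using free_algebra_mono[OF gens] by auto
    then show ?case using add subspace_add[OF sub] by (simp add: R_add)
  qed
  note R = this
  have "P a ` U \<subseteq> U" if "a \<in> carrier (hecke q v m)" for a
    using that
  proof (rule hecke_carrier_cases)
    fix x :: "'k free_elt"
    assume x: "x \<in> carrier (free_algebra (hecke_gens m))" "a = hecke_class q v m x"
    show "P a ` U \<subseteq> U" unfolding x(2) P[OF x(1)] using R[OF x(1)] by blast
  qed
  then show "subrepresentation (hecke q v m) scale P U"
    using sub by (simp add: subrepresentation_def)
qed

abbreviation "B \<equiv> hecke q v (n - 1)"

abbreviation "res \<equiv> \<rho> \<circ> hecke_incl q v n"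

lemma res_class: "x \<in> carrier (free_algebra (hecke_gens (n - 1))) \<Longrightarrow> res (hecke_class q v (n - 1) x) = R x"
  by (simp add: R_def hecke_incl_class del: One_nat_def)

lemma subrepresentation_res: "subrepresentation B scale res U \<longleftrightarrow> stab (n - 1) U"
  using res_class by (intro subrepresentation_iff_stab) auto

lemma multiplicity_free:
  assumes irr: "irreducible_sub (hecke q v n) scale \<rho> UNIV"
    and gt: "gt_module scale n t opT opS Y val dd sep"
  shows "(\<exists>\<W>. irreducible_decomposition B scale res \<W>) \<and>
    (\<forall>\<W>. irreducible_decomposition B scale res \<W> \<longrightarrow>
      (\<forall>(scale' :: 'k \<Rightarrow> 'u::ab_group_add \<Rightarrow> 'u) \<pi>. multiplicity_in B scale res \<W> scale' \<pi> \<in> {0, 1}))"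
proof -
  interpret gt_module scale n t opT opS Y val dd sep by (rule gt)
  have stab: "stab m U \<longleftrightarrow> stable m U" for m U by (simp add: stab_def stable_def)
  have nonzero: "\<exists>x::'v. x \<noteq> 0" using irr by (auto simp: irreducible_sub_def)
  have top: "U = {0} \<or> U = UNIV" if "stable n U" for U
    using irr that subrepresentation_iff_stab[of n \<rho> U]
    by (auto simp: irreducible_sub_def stab R_def)
  have irr_iff: "irreducible_sub B scale res W \<longleftrightarrow> irred (n - 1) W" for W
    unfolding irreducible_sub_def subrepresentation_res stab ..
  have "\<exists>\<W>. irreducible_decomposition B scale res \<W>"
  proof -
    obtain G where G: "finite G" "span (\<Union>G) = UNIV"
      "\<forall>W\<in>G. irred (n - 1) W"
      using restriction_semisimple[OF n_pos nonzero top] by blast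
    have "\<exists>\<W>. \<W> \<subseteq> G \<and> span (\<Union>\<W>) = span (\<Union>G) \<and>
      (\<forall>f. (\<forall>W\<in>\<W>. f W \<in> W) \<longrightarrow> (\<Sum>W\<in>\<W>. f W) = 0 \<longrightarrow> (\<forall>W\<in>\<W>. f W = 0))"
      by (rule direct_subfamily[where St = "stable (n - 1)", OF G(1) _ stable_subspace stable_Int
            stable_span_Union])
        (use G(3) in blast)+
    then obtain \<W> where W0: "\<W> \<subseteq> G \<and> span (\<Union>\<W>) = span (\<Union>G) \<and>
      (\<forall>f. (\<forall>W\<in>\<W>. f W \<in> W) \<longrightarrow> (\<Sum>W\<in>\<W>. f W) = 0 \<longrightarrow> (\<forall>W\<in>\<W>. f W = 0))" ..
    have W: "\<W> \<subseteq> G" "span (\<Union>\<W>) = UNIV"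
      using conjunct1[OF W0] conjunct1[OF conjunct2[OF W0]] G(2) by simp_all
    have direct: "\<forall>W\<in>\<W>. f W = 0" if "\<forall>W\<in>\<W>. f W \<in> W" "(\<Sum>W\<in>\<W>. f W) = 0" for f
      using mp[OF mp[OF spec[OF conjunct2[OF conjunct2[OF W0]]] that(1)] that(2)] .
    have fin: "finite \<W>" using W(1) G(1) finite_subset by blast
    have sub: "subspace W" if "W \<in> \<W>" for W
      using stable_subspace[OF conjunct1[OF bspec[OF G(3) subsetD[OF W(1) that]]]] .
    have "\<exists>!f. f \<in> (\<Pi>\<^sub>E W\<in>\<W>. W) \<and> x = (\<Sum>W\<in>\<W>. f W)" for x
    proof -
      have "x \<in> span (\<Union>W\<in>\<W>. W)" using W(2) by simp
      then obtain D f where D: "finite D" "D \<subseteq> \<W>" "\<And>W. W \<in> D \<Longrightarrow> f W \<in> W" "x = (\<Sum>W\<in>D. f W)"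
        by (rule span_UN_sumE) (use sub in auto)
      define g where "g = (\<lambda>W\<in>\<W>. if W \<in> D then f W else 0)"
      have gP: "g \<in> (\<Pi>\<^sub>E W\<in>\<W>. W)" using D(3) subspace_0[OF sub] by (auto simp: g_def)
      moreover have gx: "x = (\<Sum>W\<in>\<W>. g W)"
        unfolding D(4) by (rule sum.mono_neutral_cong_left) (use fin D(2) in \<open>auto simp: g_def\<close>)
      moreover have "h = g" if h: "h \<in> (\<Pi>\<^sub>E W\<in>\<W>. W)" "x = (\<Sum>W\<in>\<W>. h W)" for h
      proof -
        have "\<forall>W\<in>\<W>. h W - g W = 0"
        proof (rule direct)
          show "\<forall>W\<in>\<W>. h W - g W \<in> W"
          proof
            fix W assume "W \<in> \<W>"
            then show "h W - g W \<in> W"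
              using subspace_diff[OF sub PiE_mem[OF h(1)] PiE_mem[OF gP]] by simp
          qed
          show "(\<Sum>W\<in>\<W>. h W - g W) = 0"
            using h(2) gx by (simp add: sum_subtractf)
        qed
        then show ?thesis using h(1) gP by (intro PiE_ext) auto
      qed
      ultimately show ?thesis by (intro ex1I[of _ g] conjI) auto
    qed
    then show ?thesis
      using fin irr_iff bspec[OF G(3) subsetD[OF W(1)]]
      by (intro exI[of _ \<W>]) (simp add: irreducible_decomposition_def del: One_nat_def)
  qed
  moreover have "multiplicity_in B scale res \<W> scale' \<pi> \<in> {0, 1}"
    if dec: "irreducible_decomposition B scale res \<W>"
    for \<W> and scale' :: "'k \<Rightarrow> 'u \<Rightarrow> 'u" and \<pi>
  proof -
    have fin: "finite \<W>" and irr: "\<And>W. W \<in> \<W> \<Longrightarrow> irreducible_sub B scale res W"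
      and uniq: "\<And>f g x. f \<in> (\<Pi>\<^sub>E W\<in>\<W>. W) \<Longrightarrow> g \<in> (\<Pi>\<^sub>E W\<in>\<W>. W) \<Longrightarrow> (\<Sum>W\<in>\<W>. f W) = (\<Sum>W\<in>\<W>. g W) \<Longrightarrow> f = g"
      using dec unfolding irreducible_decomposition_def by blast+
    have stW: "stable (n - 1) W" "subspace W" if "W \<in> \<W>" for W
      using conjunct1[OF iffD1[OF irr_iff irr[OF that]]] stable_subspace by simp_all
    have "W = W'" if W: "W \<in> \<W>" "W' \<in> \<W>"
      and iso: "iso_sub_rep B scale res W scale' \<pi>"
        "iso_sub_rep B scale res W' scale' \<pi>" for W W'
    proof (rule ccontr)
      assume neq: "W \<noteq> W'"
      obtain f where f: "bij_betw f W UNIV" "\<And>x y. x \<in> W \<Longrightarrow> y \<in> W \<Longrightarrow> f (x + y) = f x + f y"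
        "\<And>c x. x \<in> W \<Longrightarrow> f (scale c x) = scale' c (f x)"
        "\<And>a x. a \<in> carrier B \<Longrightarrow> x \<in> W \<Longrightarrow> f (res a x) = \<pi> a (f x)"
        using iso(1) unfolding iso_sub_rep_def by blast
      obtain f' where f': "bij_betw f' W' UNIV" "\<And>x y. x \<in> W' \<Longrightarrow> y \<in> W' \<Longrightarrow> f' (x + y) = f' x + f' y"
        "\<And>c x. x \<in> W' \<Longrightarrow> f' (scale c x) = scale' c (f' x)"
        "\<And>a x. a \<in> carrier B \<Longrightarrow> x \<in> W' \<Longrightarrow> f' (res a x) = \<pi> a (f' x)"
        using iso(2) unfolding iso_sub_rep_def by blast
      \<comment> \<open>The isomorphism \<open>W\<close> to \<open>W'\<close> through the common
        target \<open>\<pi>\<close>.\<close>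
      define g where "g x = inv_into W' f' (f x)" for x
      have g: "g x \<in> W'" "f' (g x) = f x" for x
        using f'(1) by (auto simp: g_def bij_betw_def inv_into_into f_inv_into_f)
      have inj': "x = y" if "x \<in> W'" "y \<in> W'" "f' x = f' y" for x y
        using f'(1) that by (auto simp: bij_betw_def inj_on_def)
      have inter: "W \<inter> W' = {0}"
      proof -
        have "x = 0" if x: "x \<in> W" "x \<in> W'" for x
        proof -
          \<comment> \<open>\<open>x\<close> placed in the summand \<open>V\<close> alone: two such
            families for \<open>W\<close> and \<open>W'\<close> represent the same vector and must
            agree.\<close>
          define h where "h V = (\<lambda>W\<in>\<W>. if W = V then x else 0)" for V
          have hP: "h V \<in> (\<Pi>\<^sub>E W\<in>\<W>. W)" if "x \<in> V" for V
            using that subspace_0[OF stW(2)] by (auto simp: h_def)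
          have "(\<Sum>U\<in>\<W>. h V U) = x" if "V \<in> \<W>" for V
          proof -
            have "(\<Sum>U\<in>\<W>. h V U) = (\<Sum>U\<in>\<W>. if U = V then x else 0)"
              by (rule sum.cong) (simp_all add: h_def)
            then show ?thesis using fin that by simp
          qed
          then have "h W = h W'" using uniq[OF hP[OF x(1)] hP[OF x(2)]] W by simp
          then have "h W W = h W' W" by simp
          then show ?thesis using W neq by (simp add: h_def)
        qed
        moreover have "0 \<in> W \<inter> W'" using subspace_0[OF stW(2)] W by simp
        ultimately show ?thesis by auto
      qed
      have res_gen: "g (res a x) = res a (g x)"
        if a: "a \<in> carrier B" and x: "x \<in> W" for a x
      proof -
        have "\<forall>a\<in>carrier B. res a ` W' \<subseteq> W'"
          using irr[OF W(2)] by (simp add: irreducible_sub_def subrepresentation_def del: One_nat_def)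
        from subsetD[OF bspec[OF this a]] have "res a (g x) \<in> W'" using g(1) by blast
        then show ?thesis using inj'[OF g(1)] g f(4)[OF a x] f'(4)[OF a g(1)] by simp
      qed
      have cl: "hecke_class q v (n - 1) y \<in> carrier B"
        if "y \<in> carrier (free_algebra (hecke_gens (n - 1)))" for y
        using ring_hom_memE(1)[OF hecke_class_hom] that by blast
      have gR: "g (R y x) = R y (g x)" if "y \<in> carrier (free_algebra (hecke_gens (n - 1)))" "x \<in> W" for y x
        using res_gen[OF cl[OF that(1)] that(2)] unfolding res_class[OF that(1)] .
      show False
      proof (rule restriction_no_isomorphism[OF n_pos nonzero top stW(1)[OF W(1)] stW(1)[OF W(2)] inter])
        show "W \<noteq> {0}" using irr[OF W(1)] by (simp add: irreducible_sub_def)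
        show "g x \<in> W'" for x by (rule g(1))
        show "g (x + y) = g x + g y" if "x \<in> W" "y \<in> W" for x y
          using inj'[OF g(1) subspace_add[OF stW(2)[OF W(2)] g(1) g(1)]] g f(2)[OF that] f'(2)[OF g(1) g(1)]
          by simp
        show "g (scale c x) = scale c (g x)" if "x \<in> W" for c x
          using inj'[OF g(1) subspace_scale[OF stW(2)[OF W(2)] g(1)]] g f(3)[OF that] f'(3)[OF g(1)] by simp
        show "x = 0" if x: "x \<in> W" "g x = 0" for x
        proof -
          have 0: "0 \<in> W" "0 \<in> W'" using subspace_0[OF stW(2)] W by auto
          have "f' 0 = f 0" using f(3)[OF 0(1), of 0] f'(3)[OF 0(2), of 0] f(2)[OF 0(1) 0(1)] f'(2)[OF 0(2) 0(2)]
            by simp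
          then have "f x = f 0" using g(2)[of x] x(2) by simp
          then show ?thesis using f(1) x(1) 0(1) by (auto simp: bij_betw_def inj_on_def)
        qed
        show "g (opT x) = opT (g x)" if "1 < n" "x \<in> W" for x
          using that unfolding opT_def
            by (intro gR) (auto simp: free_algebra_closed(1) hecke_gens_def)
        show "g (opS i x) = opS i (g x)" if i: "Suc (Suc i) < n" "x \<in> W" for i x
          using gR[of "\<sigma> (Suc i)" x] i by (auto simp: opS_def free_algebra_closed(1) hecke_gens_def)
      qed
    qed
    then have "card {W \<in> \<W>. iso_sub_rep B scale res W scale' \<pi>} \<le> Suc 0"
      using fin by (subst card_le_Suc0_iff_eq) auto
    then show ?thesis by (auto simp: multiplicity_in_def le_Suc_eq)
  qed
  ultimately show ?thesis by blast
qed

end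

text \<open>\<open>Y\<close> takes the module as an argument because its operators are built from
  \<open>T\<close> and \<open>S\<close>, whereas the eigenvalues and coefficients depend on the
  parameters alone.\<close>

lemma multiplicity_free_branchingI:
  fixes q :: "'k::field" and v :: "'m::{finite,linorder} \<Rightarrow> 'k"
  assumes "1 \<le> n" "inj v"
    and gt: "\<And>(scale :: 'k \<Rightarrow> 'v \<Rightarrow> 'v) T S. hecke_module scale q v n T S \<Longrightarrow>
      gt_module scale n t T S (Y scale T S) val dd sep"
  shows "multiplicity_free_branching TYPE('v::ab_group_add) TYPE('u::ab_group_add) q v n"
  unfolding multiplicity_free_branching_def Let_def
proof (intro allI impI)
  fix scale :: "'k \<Rightarrow> 'v \<Rightarrow> 'v" and \<rho>
  assume irr: "irreducible_rep (hecke q v n) (hecke_scalar q v n) scale \<rho>"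
  interpret hecke_rep q v n scale \<rho>
    by unfold_locales (use irr assms(1) in \<open>auto simp: irreducible_rep_def\<close>)
  show "(\<exists>\<W>. irreducible_decomposition B scale res \<W>) \<and>
    (\<forall>\<W>. irreducible_decomposition B scale res \<W> \<longrightarrow>
      (\<forall>(scale' :: 'k \<Rightarrow> 'u \<Rightarrow> 'u) \<pi>. irreducible_rep B (hecke_scalar q v (n - 1)) scale' \<pi> \<longrightarrow>
        multiplicity_in B scale res \<W> scale' \<pi> \<in> {0, 1}))"
    using multiplicity_free[OF _ gt[OF hecke_module[OF assms(2)]]] irr
    unfolding irreducible_rep_def by blast
qed

lemma branching_q:
  fixes q :: "'k::field" and v :: "'m::{finite,linorder} \<Rightarrow> 'k"
  assumes n: "1 \<le> n" and q: "q \<noteq> 0" "\<And>i. 0 < i \<Longrightarrow> i \<le> n \<Longrightarrow> q ^ (2 * i) \<noteq> 1"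
    and v: "\<And>j. v j \<noteq> 0" "\<And>j j' e. j \<noteq> j' \<Longrightarrow> - int n < e \<Longrightarrow> e < int n \<Longrightarrow> q powi (2 * e) * v j \<noteq> v j'"
  shows "multiplicity_free_branching TYPE('v::ab_group_add) TYPE('u::ab_group_add) q v n"
proof (rule multiplicity_free_branchingI[OF n])
  show "inj v" using v(2)[of _ _ 0] n by (intro injI) fastforce
  fix scale :: "'k \<Rightarrow> 'v \<Rightarrow> 'v" and T S
  assume "hecke_module scale q v n T S"
  then interpret hecke_module scale q v n T S .
  interpret q_module scale q v n T S by unfold_locales (use q v in auto)
  show "gt_module scale n t T S (\<lambda>_::unit. hecke_module.jm S T) (\<lambda>_. q_module.cval q v)
      (q_module.cdd q v) (q_module.csep q v)"
    by (rule gt_module)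
qed

lemma branching_deg:
  fixes q :: "'k::field_char_0" and v :: "'m::{finite,linorder} \<Rightarrow> 'k"
  assumes n: "1 \<le> n" and "q\<^sup>2 = 1" "inj v"
  shows "multiplicity_free_branching TYPE('v::ab_group_add) TYPE('u::ab_group_add) q v n"
proof (rule multiplicity_free_branchingI[OF n assms(3)])
  fix scale :: "'k \<Rightarrow> 'v \<Rightarrow> 'v" and T S
  assume "hecke_module scale q v n T S"
  then interpret hecke_module scale q v n T S .
  have "q - inverse q = 0" using assms(2) by (auto simp: power2_eq_1_iff)
  then interpret deg_module scale q v n T S by unfold_locales
  show "gt_module scale n (q - inverse q) T S (deg_module.Y scale v T S) deg_module.dval deg_module.ddd (\<noteq>)"
    by (rule gt_module)
qed

section \<open>The parameters\<close>

text \<open>Monomials embed injectively into the field, so the conditions on the indeterminates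
  become comparisons of exponents.\<close>

definition mono_ratfun :: "('m option \<Rightarrow>\<^sub>0 nat) \<Rightarrow> 'm::{finite,linorder} ratfun" where
  "mono_ratfun e = Fract (Poly_Mapping.single e 1) 1"

lemma mono_ratfun_mult: "mono_ratfun e * mono_ratfun f = mono_ratfun (e + f)"
  by (simp add: mono_ratfun_def mult_single)

lemma mono_ratfun_zero: "mono_ratfun 0 = 1"
  by (simp add: mono_ratfun_def One_fract_def)

lemma mono_ratfun_inject: "mono_ratfun e = mono_ratfun f \<longleftrightarrow> e = f"
proof
  assume "mono_ratfun e = mono_ratfun f"
  then have "Poly_Mapping.single e (1 :: complex) = Poly_Mapping.single f 1"
    by (simp add: mono_ratfun_def eq_fract)
  then have "Poly_Mapping.keys (Poly_Mapping.single e (1 :: complex)) = Poly_Mapping.keys (Poly_Mapping.single f (1 :: complex))"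
    by simp
  then show "e = f" by simp
qed simp

lemma single_nonzero: "c \<noteq> 0 \<Longrightarrow> Poly_Mapping.single k c \<noteq> 0"
  by (metis lookup_single_eq lookup_zero)

lemma mono_ratfun_nonzero: "mono_ratfun e \<noteq> 0"
  using single_nonzero[of "1 :: complex" e] by (simp add: mono_ratfun_def Zero_fract_def eq_fract)

lemma q_indet_power: "q_indet ^ k = mono_ratfun (Poly_Mapping.single None k)"
proof (induction k)
  case (Suc k)
  then show ?case
    by (simp add: q_indet_def indet_def mono_ratfun_mult single_add[symmetric] flip: mono_ratfun_def)
qed (simp add: mono_ratfun_zero)

lemma v_indet_eq: "v_indet j = mono_ratfun (Poly_Mapping.single (Some j) 1)"
  by (simp add: v_indet_def indet_def mono_ratfun_def)

text \<open>The exponents of \<open>v_indet j\<close> on the two sides are 1 and 0; a negative power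
  of \<open>q_indet\<close> is moved to the other side beforehand.\<close>

lemma q_indet_powi_v_indet:
  assumes "j \<noteq> j'" shows "q_indet powi e * v_indet j \<noteq> v_indet j'"
proof
  assume eq: "q_indet powi e * v_indet j = v_indet j'"
  have q: "q_indet ^ k \<noteq> (0 :: 'a ratfun)" for k
    by (simp only: q_indet_power mono_ratfun_nonzero not_False_eq_True)
  show False
  proof (cases "0 \<le> e")
    case True
    then have "mono_ratfun (Poly_Mapping.single None (nat e) + Poly_Mapping.single (Some j) 1)
        = mono_ratfun (Poly_Mapping.single (Some j') 1)"
      using eq by (simp add: power_int_def q_indet_power v_indet_eq mono_ratfun_mult)
    then have "Poly_Mapping.lookup (Poly_Mapping.single None (nat e) + Poly_Mapping.single (Some j) 1) (Some j)
        = Poly_Mapping.lookup (Poly_Mapping.single (Some j') (1 :: nat)) (Some j)"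
      unfolding mono_ratfun_inject by simp
    then show False using assms by (simp add: lookup_add lookup_single)
  next
    case False
    then have "v_indet j = q_indet ^ nat (- e) * v_indet j'"
      using eq q[of "nat (- e)"] by (simp add: power_int_def field_simps)
    then have "mono_ratfun (Poly_Mapping.single (Some j) 1)
        = mono_ratfun (Poly_Mapping.single None (nat (- e)) + Poly_Mapping.single (Some j') 1)"
      by (simp add: q_indet_power v_indet_eq mono_ratfun_mult)
    then have "Poly_Mapping.lookup (Poly_Mapping.single (Some j) (1 :: nat)) (Some j)
        = Poly_Mapping.lookup (Poly_Mapping.single None (nat (- e)) + Poly_Mapping.single (Some j') 1) (Some j)"
      unfolding mono_ratfun_inject by simp
    then show False using assms by (simp add: lookup_add lookup_single)
  qed
qed

text \<open>A geometric sum: \<open>1 - q ^ (2 * i)\<close> is \<open>1 - q\<^sup>2\<close> times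
  the sum that admissibility makes nonzero for \<open>N = i - 1\<close>.\<close>

lemma admissible_root:
  assumes "admissible_params q v n" "q\<^sup>2 \<noteq> 1" "0 < i" "i \<le> n"
  shows "q ^ (2 * i) \<noteq> 1"
proof
  assume "q ^ (2 * i) = 1"
  then have "(1 - q\<^sup>2) * (\<Sum>k<i. (q\<^sup>2) ^ k) = 0"
    by (simp add: power_mult flip: one_diff_power_eq)
  then have "(\<Sum>k<i. q ^ (2 * k)) = 0" using assms(2) by (simp add: power_mult)
  moreover have "{..<i} = {0..i - 1}" using assms(3) by auto
  ultimately show False
    using assms by (simp add: admissible_params_def)
qed

theorem corollary15:
  fixes n :: nat
  assumes "n \<ge> 1"
  shows "multiplicity_free_branching TYPE('v::ab_group_add) TYPE('u::ab_group_add)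
           (q_indet :: 'm::{finite,linorder} ratfun) v_indet n
       \<and> (\<forall>(q :: complex) (v :: 'm \<Rightarrow> complex).
            admissible_params q v n \<longrightarrow>
            multiplicity_free_branching TYPE('v) TYPE('u) q v n)"
proof (intro conjI allI impI)
  show "multiplicity_free_branching TYPE('v) TYPE('u) (q_indet :: 'm ratfun) v_indet n"
  proof (rule branching_q[OF assms])
    have "q_indet ^ 1 \<noteq> (0 :: 'm ratfun)" unfolding q_indet_power by (rule mono_ratfun_nonzero)
    then show "q_indet \<noteq> (0 :: 'm ratfun)" by simp
    show "q_indet ^ (2 * i) \<noteq> (1 :: 'm ratfun)" if "0 < i" for i
    proof -
      have "Poly_Mapping.single None (2 * i) \<noteq> (0 :: 'm option \<Rightarrow>\<^sub>0 nat)"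
        using that by (intro single_nonzero) simp
      then show ?thesis unfolding q_indet_power mono_ratfun_zero[symmetric] mono_ratfun_inject .
    qed
    show "v_indet j \<noteq> (0 :: 'm ratfun)" for j unfolding v_indet_eq by (rule mono_ratfun_nonzero)
  qed (rule q_indet_powi_v_indet)
next
  fix q :: complex and v :: "'m \<Rightarrow> complex"
  assume adm: "admissible_params q v n"
  have qv: "q powi (2 * e) * v j \<noteq> v j'" if "j \<noteq> j'" "- int n < e" "e < int n" for j j' e
    using adm that by (simp add: admissible_params_def)
  show "multiplicity_free_branching TYPE('v) TYPE('u) q v n"
  \<comment> \<open>For \<open>q\<^sup>2 = 1\<close> the sums in \<open>admissible_params\<close>
    are the integers \<open>N + 1\<close>, so this case does occur.\<close>
  proof (cases "q\<^sup>2 = 1")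
    case True
    have "inj v" using qv[of _ _ 0] assms by (intro injI) fastforce
    then show ?thesis by (rule branching_deg[OF assms True])
  next
    case False
    show ?thesis
      by (rule branching_q[OF assms _ admissible_root[OF adm False] _ qv])
        (use adm in \<open>auto simp: admissible_params_def\<close>)
  qed
qed

end
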